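(* For any $n,k,m\geq 0$ there are isomorphisms of $\mathfrak{S}_n$-modules $$\mathbb{C}[\mathrm{NC}(n)]\cong V(n)\cong W(n),\qquad \mathbb{C}[\mathrm{NC}(n,k)]\cong V(n,k)\cong W(n,k),\qquad \mathbb{C}[\mathrm{NC}(n,k,m)]\cong V(n,k,m)\cong W(n,k,m),$$ where $\mathbb{C}[\mathrm{NC}(n)]$, $\mathbb{C}[\mathrm{NC}(n,k)]$ and $\mathbb{C}[\mathrm{NC}(n,k,m)]$ are endowed with the skein action. In each case the isomorphisms are given by $\pi\leftrightarrow f_\pi\leftrightarrow F_\pi$ for $\pi$ a noncrossing partition.
   Context: Set partitions. $\Pi(n)$, $\Pi(n,k)$, $\Pi(n,k,m)$ are the sets of all set partitions of $[n]=\{1,\dots,n\}$, those with $k$ blocks, and those with $k$ blocks of which exactly $m$ are singletons. $\mathrm{NC}(n)$, $\mathrm{NC}(n,k)$, $\mathrm{NC}(n,k,m)$ are the subsets of noncrossing partitions (whenever $a<b<c<d$ with $a,c$ in the same block and $b,d$ in the same block, all four are in the same block). $\mathbb{C}[X]$ is the vector space with basis $X$. For $w\in\mathfrak{S}_n$, $w(\pi)$ has blocks $w(B)$, $B$ a block of $\pi$; $s_i=(i,i+1)$. Skein action. For $\mu\in\Pi(n)$ not noncrossing with $s_i(\mu)$ noncrossing, the indices $i,i+1$ lie in different blocks $B_i\ni i$, $B_{i+1}\ni i+1$ of $\mu$, both of size at least 2. Let $\mu_1,\dots,\mu_4$ be obtained from $\mu$ by replacing the pair $B_i,B_{i+1}$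 by the pair: $(B_i-\{i\})\cup\{i+1\}$ and $(B_{i+1}-\{i+1\})\cup\{i\}$ for $\mu_1$; $(B_i\cup B_{i+1})-\{i,i+1\}$ and $\{i,i+1\}$ for $\mu_2$; $B_i-\{i\}$ and $B_{i+1}\cup\{i\}$ for $\mu_3$; $B_{i+1}-\{i+1\}$ and $B_i\cup\{i+1\}$ for $\mu_4$. Set $\sigma(\mu)=\mu_1+\mu_2$ if $|B_i|=|B_{i+1}|=2$; $\mu_1+\mu_2-\mu_3$ if $|B_i|>2,|B_{i+1}|=2$; $\mu_1+\mu_2-\mu_4$ if $|B_i|=2,|B_{i+1}|>2$; $\mu_1+\mu_2-\mu_3-\mu_4$ if $|B_i|,|B_{i+1}|>2$; this lies in $\mathbb{C}[\mathrm{NC}(n)]$ and does not depend on the choice of $i$. The skein action on $\mathbb{C}[\mathrm{NC}(n)]$ is given on generators by $s_i\cdot\pi=-s_i(\pi)$ if $s_i(\pi)$ is noncrossing and $s_i\cdot\pi=\sigma(s_i(\pi))$ otherwise. These operators satisfy the Coxeter relations, so they define an action of $\mathfrak{S}_n$; it preserves $\mathbb{C}[\mathrm{NC}(n,k)]$ and $\mathbb{C}[\mathrm{NC}(n,k,m)]$. Fermions. $\wedge\{\Theta_n,\Xi_n\}$ is the exterior algebra over $\mathbb{C}$ on anticommuting generators $\theta_1,\dots,\theta_n,\xi_1,\dots,\xi_n$, with $\mathfrak{S}_n$ acting by algebra automorphisms $w\cdot\theta_i=\theta_{w(i)}$, $w\cdot\xi_i=\xi_{w(i)}$. For a generator $\omega$,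 $\omega\odot(-)$ is the linear operator sending a product $\omega_1\cdots\omega_r$ of distinct generators to $(-1)^{s-1}\omega_1\cdots\widehat{\omega_s}\cdots\omega_r$ if $\omega=\omega_s$ and to $0$ if $\omega\notin\{\omega_1,\dots,\omega_r\}$; extend linearly in the first argument to linear combinations of generators. For nonempty $B\subseteq[n]$, $\rho_B(f)=\sum_{i,j\in B,\ i\neq j}\xi_i\cdot(\theta_j\odot f)$ if $|B|>1$ and $\rho_B(f)=\xi_i\cdot(\theta_i\odot f)$ if $B=\{i\}$. These operators commute pairwise. For $\pi=\{B_1/\cdots/B_k\}\in\Pi(n)$, $F_\pi=(\rho_{B_1}\circ\cdots\circ\rho_{B_k})(\theta_1\cdots\theta_n)$ and $f_\pi=(\xi_1+\cdots+\xi_n)\odot F_\pi$. Modules. $W(n)$, $W(n,k)$, $W(n,k,m)$ are the spans of the $F_\pi$ for $\pi$ in $\Pi(n)$, $\Pi(n,k)$, $\Pi(n,k,m)$ respectively; $V(n)$, $V(n,k)$, $V(n,k,m)$ are the corresponding spans of the $f_\pi$. All are $\mathfrak{S}_n$-submodules of $\wedge\{\Theta_n,\Xi_n\}$.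
   Formalization: The isomorphisms involving V(n), V(n,k), V(n,k,m) are stated except for n=0, (n,k)=(0,0), (n,k,m)=(0,0,0) respectively, where F=1 but f=0, so V=0 while C[NC] and W are one-dimensional; C[NC]≅W is stated for all n,k,m≥0. *)

theory Defs
  imports Complex_Main "HOL-Library.Poly_Mapping" "HOL-Library.FSet" "HOL-Library.Disjoint_Sets"
    "HOL-Combinatorics.Permutations"
begin

section \<open>Complex vector spaces with a given basis\<close>

text \<open>Finitely supported functions \<^typ>\<open>'a \<Rightarrow>\<^sub>0 complex\<close> are the formal complex linear combinations
  of elements of \<^typ>\<open>'a\<close>.\<close>

definition cscale :: "complex \<Rightarrow> ('a \<Rightarrow>\<^sub>0 complex) \<Rightarrow> ('a \<Rightarrow>\<^sub>0 complex)" where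
  "cscale c x = Poly_Mapping.map ((*) c) x"

lemma lookup_cscale: "Poly_Mapping.lookup (cscale c x) a = c * Poly_Mapping.lookup x a"
  unfolding cscale_def by (transfer) (auto simp: when_def)

interpretation cvs: vector_space cscale
  by unfold_locales (auto intro!: poly_mapping_eqI simp: lookup_cscale lookup_add algebra_simps)

abbreviation basis_vec :: "'a \<Rightarrow> ('a \<Rightarrow>\<^sub>0 complex)" where
  "basis_vec a \<equiv> Poly_Mapping.single a 1"

text \<open>The subspace with basis \<^term>\<open>X\<close>, written C[X] on paper.\<close>
definition free_on :: "'a set \<Rightarrow> ('a \<Rightarrow>\<^sub>0 complex) set" where
  "free_on X = {x. Poly_Mapping.keys x \<subseteq> X}"

text \<open>The linear map with given values on basis elements.\<close>
definition lin_ext :: "('a \<Rightarrow> ('b \<Rightarrow>\<^sub>0 complex)) \<Rightarrow> ('a \<Rightarrow>\<^sub>0 complex) \<Rightarrow> ('b \<Rightarrow>\<^sub>0 complex)" where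
  "lin_ext g x = (\<Sum>a\<in>Poly_Mapping.keys x. cscale (Poly_Mapping.lookup x a) (g a))"

section \<open>Modules over the symmetric group\<close>

definition linear_within ::
  "('a \<Rightarrow>\<^sub>0 complex) set \<Rightarrow> (('a \<Rightarrow>\<^sub>0 complex) \<Rightarrow> ('b \<Rightarrow>\<^sub>0 complex)) \<Rightarrow> bool" where
  "linear_within U \<phi> \<longleftrightarrow>
     (\<forall>x\<in>U. \<forall>y\<in>U. \<phi> (x + y) = \<phi> x + \<phi> y) \<and> (\<forall>c. \<forall>x\<in>U. \<phi> (cscale c x) = cscale c (\<phi> x))"

text \<open>\<^term>\<open>U\<close> is a linear representation of the group of permutations of \<open>{1..n}\<close> under \<^term>\<open>act\<close>.\<close>
definition Sn_module ::
  "nat \<Rightarrow> ('a \<Rightarrow>\<^sub>0 complex) set \<Rightarrow> ((nat \<Rightarrow> nat) \<Rightarrow> ('a \<Rightarrow>\<^sub>0 complex) \<Rightarrow> ('a \<Rightarrow>\<^sub>0 complex)) \<Rightarrow> bool" where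
  "Sn_module n U act \<longleftrightarrow>
     cvs.subspace U \<and>
     (\<forall>w. w permutes {1..n} \<longrightarrow> linear_within U (act w) \<and> act w ` U \<subseteq> U) \<and>
     (\<forall>x\<in>U. act id x = x) \<and>
     (\<forall>v w. v permutes {1..n} \<longrightarrow> w permutes {1..n} \<longrightarrow>
        (\<forall>x\<in>U. act (v \<circ> w) x = act v (act w x)))"

definition Sn_module_iso ::
  "nat \<Rightarrow> ('a \<Rightarrow>\<^sub>0 complex) set \<Rightarrow> ((nat \<Rightarrow> nat) \<Rightarrow> ('a \<Rightarrow>\<^sub>0 complex) \<Rightarrow> ('a \<Rightarrow>\<^sub>0 complex)) \<Rightarrow>
   ('b \<Rightarrow>\<^sub>0 complex) set \<Rightarrow> ((nat \<Rightarrow> nat) \<Rightarrow> ('b \<Rightarrow>\<^sub>0 complex) \<Rightarrow> ('b \<Rightarrow>\<^sub>0 complex)) \<Rightarrow>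
   (('a \<Rightarrow>\<^sub>0 complex) \<Rightarrow> ('b \<Rightarrow>\<^sub>0 complex)) \<Rightarrow> bool" where
  "Sn_module_iso n U actU V actV \<phi> \<longleftrightarrow>
     Sn_module n U actU \<and> Sn_module n V actV \<and>
     linear_within U \<phi> \<and> bij_betw \<phi> U V \<and>
     (\<forall>w. w permutes {1..n} \<longrightarrow> (\<forall>x\<in>U. \<phi> (actU w x) = actV w (\<phi> x)))"

section \<open>Set partitions\<close>

definition noncrossing :: "nat set set \<Rightarrow> bool" where
  "noncrossing \<pi> \<longleftrightarrow>
     (\<forall>B\<in>\<pi>. \<forall>C\<in>\<pi>. \<forall>a b c d. a < b \<and> b < c \<and> c < d \<and> a \<in> B \<and> c \<in> B \<and> b \<in> C \<and> d \<in> C \<longrightarrow> B = C)"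

definition SP :: "nat \<Rightarrow> nat set set set" where
  "SP n = {\<pi>. partition_on {1..n} \<pi>}"

definition SP_blocks :: "nat \<Rightarrow> nat \<Rightarrow> nat set set set" where
  "SP_blocks n k = {\<pi> \<in> SP n. card \<pi> = k}"

definition SP_singles :: "nat \<Rightarrow> nat \<Rightarrow> nat \<Rightarrow> nat set set set" where
  "SP_singles n k m = {\<pi> \<in> SP_blocks n k. card {B \<in> \<pi>. card B = 1} = m}"

definition NC :: "nat \<Rightarrow> nat set set set" where
  "NC n = {\<pi> \<in> SP n. noncrossing \<pi>}"

definition NC_blocks :: "nat \<Rightarrow> nat \<Rightarrow> nat set set set" where
  "NC_blocks n k = {\<pi> \<in> SP_blocks n k. noncrossing \<pi>}"

definition NC_singles :: "nat \<Rightarrow> nat \<Rightarrow> nat \<Rightarrow> nat set set set" where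
  "NC_singles n k m = {\<pi> \<in> SP_singles n k m. noncrossing \<pi>}"

definition perm_partition :: "(nat \<Rightarrow> nat) \<Rightarrow> nat set set \<Rightarrow> nat set set" where
  "perm_partition w \<pi> = (\<lambda>B. w ` B) ` \<pi>"

definition adj :: "nat \<Rightarrow> nat \<Rightarrow> nat" where
  "adj i = Transposition.transpose i (Suc i)"

section \<open>The skein action\<close>

definition block_of :: "nat set set \<Rightarrow> nat \<Rightarrow> nat set" where
  "block_of \<pi> i = (THE B. B \<in> \<pi> \<and> i \<in> B)"

text \<open>The resolution of a partition \<^term>\<open>\<mu>\<close> which is not noncrossing although applying \<^term>\<open>adj i\<close>
  makes it so. Both \<open>B\<close> and \<open>C\<close> then have at least two elements, and the conditional terms
  produce the four cases of the definition. The resolution does not depend on the choice of an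
  admissible \<^term>\<open>i\<close>, but keeping \<^term>\<open>i\<close> as an argument spares us that choice.\<close>
definition skein_resolve :: "nat \<Rightarrow> nat set set \<Rightarrow> (nat set set \<Rightarrow>\<^sub>0 complex)" where
  "skein_resolve i \<mu> =
     (let B = block_of \<mu> i; C = block_of \<mu> (Suc i); R = \<mu> - {B, C};
          \<mu>1 = R \<union> {(B - {i}) \<union> {Suc i}, (C - {Suc i}) \<union> {i}};
          \<mu>2 = R \<union> {(B \<union> C) - {i, Suc i}, {i, Suc i}};
          \<mu>3 = R \<union> {B - {i}, C \<union> {i}};
          \<mu>4 = R \<union> {C - {Suc i}, B \<union> {Suc i}}
      in basis_vec \<mu>1 + basis_vec \<mu>2
         - (if card B > 2 then basis_vec \<mu>3 else 0)
         - (if card C > 2 then basis_vec \<mu>4 else 0))"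

definition skein_gen :: "nat \<Rightarrow> (nat set set \<Rightarrow>\<^sub>0 complex) \<Rightarrow> (nat set set \<Rightarrow>\<^sub>0 complex)" where
  "skein_gen i = lin_ext (\<lambda>\<pi>.
     let \<mu> = perm_partition (adj i) \<pi>
     in if noncrossing \<mu> then - basis_vec \<mu> else skein_resolve i \<mu>)"

definition adj_word :: "nat list \<Rightarrow> nat \<Rightarrow> nat" where
  "adj_word is = foldr (\<lambda>i w. adj i \<circ> w) is id"

definition skein_word :: "nat list \<Rightarrow> (nat set set \<Rightarrow>\<^sub>0 complex) \<Rightarrow> (nat set set \<Rightarrow>\<^sub>0 complex)" where
  "skein_word is x = foldr skein_gen is x"

text \<open>The action of a permutation of \<open>{1..n}\<close>: write it as a word in adjacent transpositions and
  compose the corresponding operators. As the operators \<^term>\<open>skein_gen i\<close> satisfy the Coxeter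
  relations on \<^term>\<open>free_on (NC n)\<close>, the result there does not depend on the word;
  \<open>extends_skein_gens\<close> below expresses that this is an action with the prescribed generators.\<close>
definition skein_act ::
  "nat \<Rightarrow> (nat \<Rightarrow> nat) \<Rightarrow> (nat set set \<Rightarrow>\<^sub>0 complex) \<Rightarrow> (nat set set \<Rightarrow>\<^sub>0 complex)" where
  "skein_act n w = skein_word (SOME is. set is \<subseteq> {1..<n} \<and> adj_word is = w)"

definition extends_skein_gens ::
  "nat \<Rightarrow> ((nat \<Rightarrow> nat) \<Rightarrow> (nat set set \<Rightarrow>\<^sub>0 complex) \<Rightarrow> (nat set set \<Rightarrow>\<^sub>0 complex)) \<Rightarrow> bool" where
  "extends_skein_gens n act \<longleftrightarrow>
     Sn_module n (free_on (NC n)) act \<and>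
     (\<forall>i\<in>{1..<n}. \<forall>x\<in>free_on (NC n). act (adj i) x = skein_gen i x)"

section \<open>The exterior algebra\<close>

datatype fgen = Theta nat | Xi nat

text \<open>Any linear order on the generators would do; we use
  \<open>\<theta>\<^sub>1 < \<theta>\<^sub>2 < \<dots> < \<xi>\<^sub>1 < \<xi>\<^sub>2 < \<dots>\<close>.\<close>
instantiation fgen :: linorder
begin

fun less_eq_fgen :: "fgen \<Rightarrow> fgen \<Rightarrow> bool" where
  "less_eq_fgen (Theta i) (Theta j) = (i \<le> j)"
| "less_eq_fgen (Theta i) (Xi j) = True"
| "less_eq_fgen (Xi i) (Theta j) = False"
| "less_eq_fgen (Xi i) (Xi j) = (i \<le> j)"

definition less_fgen :: "fgen \<Rightarrow> fgen \<Rightarrow> bool" where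
  "less_fgen a b \<longleftrightarrow> a \<le> b \<and> \<not> b \<le> a"

instance
proof
  fix x y z :: fgen
  show "x < y \<longleftrightarrow> x \<le> y \<and> \<not> y \<le> x" by (rule less_fgen_def)
  show "x \<le> x" by (cases x) auto
  show "x \<le> y \<Longrightarrow> y \<le> z \<Longrightarrow> x \<le> z" by (cases x; cases y; cases z) auto
  show "x \<le> y \<Longrightarrow> y \<le> x \<Longrightarrow> x = y" by (cases x; cases y) auto
  show "x \<le> y \<or> y \<le> x" by (cases x; cases y) auto
qed

end

text \<open>The basis element indexed by a finite set of generators stands for their product in
  increasing order. All \<open>\<theta>\<^sub>i\<close> and \<open>\<xi>\<^sub>i\<close> with \<open>i :: nat\<close> are present in the type; the algebra on
  the first \<open>n\<close> of each is the part supported on subsets of \<open>Theta ` {1..n} \<union> Xi ` {1..n}\<close>, and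
  the spans defined at the end of this theory lie in it.\<close>
type_synonym ext = "fgen fset \<Rightarrow>\<^sub>0 complex"

definition wedge :: "ext \<Rightarrow> ext \<Rightarrow> ext" where
  "wedge x y = (\<Sum>S\<in>Poly_Mapping.keys x. \<Sum>T\<in>Poly_Mapping.keys y.
     if S |\<inter>| T = {||}
     then Poly_Mapping.single (S |\<union>| T)
       ((- 1) ^ card {(s, t). s |\<in>| S \<and> t |\<in>| T \<and> t < s} * Poly_Mapping.lookup x S * Poly_Mapping.lookup y T)
     else 0)"

definition gen :: "fgen \<Rightarrow> ext" where
  "gen \<omega> = basis_vec {|\<omega>|}"

definition prod_gens :: "fgen list \<Rightarrow> ext" where
  "prod_gens \<omega>s = foldr (\<lambda>\<omega> x. wedge (gen \<omega>) x) \<omega>s (basis_vec {||})"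

text \<open>The operator \<open>\<omega> \<odot> (-)\<close>: if \<open>\<omega>\<close> is the \<open>s\<close>-th factor of the increasing product of
  the elements of \<open>S\<close>, exactly \<open>s - 1\<close> elements of \<open>S\<close> are smaller than \<open>\<omega>\<close>.\<close>
definition contract :: "fgen \<Rightarrow> ext \<Rightarrow> ext" where
  "contract \<omega> = lin_ext (\<lambda>S.
     if \<omega> |\<in>| S
     then Poly_Mapping.single (S |-| {|\<omega>|}) ((- 1) ^ card {\<eta>. \<eta> |\<in>| S \<and> \<eta> < \<omega>})
     else 0)"

fun perm_gen :: "(nat \<Rightarrow> nat) \<Rightarrow> fgen \<Rightarrow> fgen" where
  "perm_gen w (Theta i) = Theta (w i)"
| "perm_gen w (Xi i) = Xi (w i)"

definition perm_act :: "(nat \<Rightarrow> nat) \<Rightarrow> ext \<Rightarrow> ext" where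
  "perm_act w = lin_ext (\<lambda>S. prod_gens (map (perm_gen w) (sorted_list_of_fset S)))"

definition rho :: "nat set \<Rightarrow> ext \<Rightarrow> ext" where
  "rho B x =
     (if card B > 1
      then \<Sum>i\<in>B. \<Sum>j\<in>B - {i}. wedge (gen (Xi i)) (contract (Theta j) x)
      else let i = the_elem B in wedge (gen (Xi i)) (contract (Theta i) x))"

text \<open>The operators \<^const>\<open>rho\<close> commute pairwise, so the fold over the set of blocks is their composition
  in any order.\<close>
definition F_part :: "nat \<Rightarrow> nat set set \<Rightarrow> ext" where
  "F_part n \<pi> = Finite_Set.fold rho (prod_gens (map Theta [1..<Suc n])) \<pi>"

text \<open>Contraction with \<open>\<xi>\<^sub>1 + \<dots> + \<xi>\<^sub>n\<close>, by linearity in the first argument.\<close>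
definition f_part :: "nat \<Rightarrow> nat set set \<Rightarrow> ext" where
  "f_part n \<pi> = (\<Sum>i\<in>{1..n}. contract (Xi i) (F_part n \<pi>))"

definition W_all :: "nat \<Rightarrow> ext set" where
  "W_all n = cvs.span (F_part n ` SP n)"

definition W_blocks :: "nat \<Rightarrow> nat \<Rightarrow> ext set" where
  "W_blocks n k = cvs.span (F_part n ` SP_blocks n k)"

definition W_singles :: "nat \<Rightarrow> nat \<Rightarrow> nat \<Rightarrow> ext set" where
  "W_singles n k m = cvs.span (F_part n ` SP_singles n k m)"

text \<open>For \<open>n = 0\<close> the only partition is the empty one; there \<open>F_part\<close> is 1 but \<open>f_part\<close>, being a contraction
  with an empty sum, is 0. So the spans below vanish although those above are one-dimensional.\<close>

definition V_all :: "nat \<Rightarrow> ext set" where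
  "V_all n = cvs.span (f_part n ` SP n)"

definition V_blocks :: "nat \<Rightarrow> nat \<Rightarrow> ext set" where
  "V_blocks n k = cvs.span (f_part n ` SP_blocks n k)"

definition V_singles :: "nat \<Rightarrow> nat \<Rightarrow> nat \<Rightarrow> ext set" where
  "V_singles n k m = cvs.span (f_part n ` SP_singles n k m)"

end

(*
Up to the factor theta_1 ... theta_n, the vector F_pi is a product of commuting operators
rho_B = A_B D_B - (sum over i in B of xi_i d/dtheta_i), where A_B and D_B are the sums over B of
the multiplications by xi_i and of the contractions with theta_i, and all these odd operators
anticommute. Expanding gives the skein relation for the rho_B, so pi |-> F_pi intertwines the
skein operators with the action on the exterior algebra; once it is injective on C[NC(n)], the
Coxeter relations come for free. The span of the noncrossing F_pi is then stable under the
symmetric group, and every set partition is a permutation of one into intervals, hence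
noncrossing, with the same number of blocks and singletons.

Independence: the monomials of F_pi choose in each block B an index i of xi and an index j of a
deleted theta (distinct unless |B| = 1). Taking i = min B and j = max B gives the unique monomial
of least weight, and a noncrossing partition is determined by its sets of minima and of maxima.

Let d be the contraction with xi_1 + ... + xi_n, so f_pi = d F_pi. Replacing rho_B by A_B D_B in F_nu
gives a vector G_nu that is a multiple of xi_1 + ... + xi_n, because A_B A_B = 0. Hence d F = 0 makes
F orthogonal to all G_nu. If the singletons of pi are among those of nu, then
<F_pi, G_nu> = <F_pi, F_nu>; if some singleton of nu is not one of pi, then <F_pi, G_nu> = 0. Going down
through the sets of singletons, each homogeneous part of F is orthogonal to itself, so F = 0.
*)
theory Submission
  imports Defs
begin

section \<open>Linear combinations and the exterior algebra\<close>

text \<open>The minus sign in the skein generators is the sign by which an adjacent transposition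
  acts on theta_1 ... theta_n, so F intertwines the two actions without any twist.

  The obstacle on the side of f is that d is far from injective on the whole exterior algebra, as d
  d = 0. Injectivity on W is obtained from orthogonality: d is adjoint to multiplication by xi_1 +
  ... + xi_n for the Hermitian form in which the monomials are orthonormal, so an element killed by
  d is orthogonal to every multiple of that sum. The vectors F_nu need not be such multiples, owing
  to the diagonal terms subtracted in rho_B; G_nu retains them. A diagonal term contains xi_i and
  deletes theta_i for the same i, which a monomial of F_pi does only at a singleton of pi; hence the
  bookkeeping by sets of singletons.

  For n = 0 the sum of the xi_i is empty and d = 0, while F of the empty partition is 1; this is the
  exception in the claims on V.\<close>

lemma lin_ext_superset:
  assumes "finite K" "Poly_Mapping.keys x \<subseteq> K"
  shows "lin_ext g x = (\<Sum>a\<in>K. cscale (Poly_Mapping.lookup x a) (g a))"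
  unfolding lin_ext_def using assms
  by (intro sum.mono_neutral_left) (auto simp: in_keys_iff)

abbreviation clinear :: "(('a \<Rightarrow>\<^sub>0 complex) \<Rightarrow> ('b \<Rightarrow>\<^sub>0 complex)) \<Rightarrow> bool" where
  "clinear \<equiv> linear_within UNIV"

lemma clinear_add: "clinear f \<Longrightarrow> f (x + y) = f x + f y"
  by (simp add: linear_within_def)

lemma clinear_scale: "clinear f \<Longrightarrow> f (cscale c x) = cscale c (f x)"
  by (simp add: linear_within_def)

lemma clinear_0: "clinear f \<Longrightarrow> f 0 = 0"
  using clinear_scale[of f 0 0] by simp

lemma clinear_minus: "clinear f \<Longrightarrow> f (- x) = - f x"
  using clinear_scale[of f "-1" x] by simp

lemma clinear_diff: "clinear f \<Longrightarrow> f (x - y) = f x - f y"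
  using clinear_add[of f x "- y"] clinear_minus[of f y] by simp

lemma clinear_sum: "clinear f \<Longrightarrow> f (\<Sum>a\<in>K. g a) = (\<Sum>a\<in>K. f (g a))"
  by (induction K rule: infinite_finite_induct) (auto simp: clinear_0 clinear_add)

lemmas clinear_simps = clinear_add clinear_scale clinear_0 clinear_minus clinear_diff clinear_sum

lemma clinear_lin_ext: "clinear (lin_ext g)"
  unfolding linear_within_def
proof safe
  fix x y :: "'a \<Rightarrow>\<^sub>0 complex"
  let ?K = "Poly_Mapping.keys x \<union> Poly_Mapping.keys y"
  show "lin_ext g (x + y) = lin_ext g x + lin_ext g y"
    using keys_add[of x y]
    by (simp add: lin_ext_superset[of ?K] lookup_add cvs.scale_left_distrib sum.distrib)
next
  fix c and x :: "'a \<Rightarrow>\<^sub>0 complex"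
  have "Poly_Mapping.keys (cscale c x) \<subseteq> Poly_Mapping.keys x"
    by (auto simp: in_keys_iff lookup_cscale)
  then show "lin_ext g (cscale c x) = cscale c (lin_ext g x)"
    by (simp add: lin_ext_superset[of "Poly_Mapping.keys x"] lookup_cscale cvs.scale_sum_right)
qed

lemma lin_ext_basis_vec [simp]: "lin_ext g (basis_vec a) = g a"
  by (simp add: lin_ext_def)

lemma basis_expansion:
  "x = (\<Sum>a\<in>Poly_Mapping.keys x. cscale (Poly_Mapping.lookup x a) (basis_vec a))"
  by (rule poly_mapping_eqI)
    (simp add: lookup_sum lookup_cscale lookup_single when_def in_keys_iff if_distrib[where f = "(*) _"] cong: if_cong)

lemma clinear_eqI:
  assumes "clinear f" "clinear g" "\<And>a. f (basis_vec a) = g (basis_vec a)"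
  shows "f x = g x"
  by (subst (1 2) basis_expansion) (simp add: assms clinear_simps)

lemma clinear_comp: "clinear f \<Longrightarrow> clinear g \<Longrightarrow> clinear (\<lambda>x. f (g x))"
  by (simp add: linear_within_def)

lemma clinear_id: "clinear (\<lambda>x. x)"
  by (simp add: linear_within_def)

lemma clinear_sumI:
  "(\<And>a. a \<in> K \<Longrightarrow> clinear (f a)) \<Longrightarrow> clinear (\<lambda>x. \<Sum>a\<in>K. f a x)"
  by (simp add: linear_within_def cvs.scale_sum_right sum.distrib)

section \<open>Multiplication by a generator, contraction with a generator, and their
  anticommutation relations\<close>

text \<open>The sign of moving \<omega> past the smaller elements of \<open>S\<close>. It governs
  both multiplication and contraction, which makes these two operators adjoint to each
  other.\<close>

definition esgn :: "fgen \<Rightarrow> fgen fset \<Rightarrow> complex" where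
  "esgn \<omega> S = (- 1) ^ card {\<eta>. \<eta> |\<in>| S \<and> \<eta> < \<omega>}"

lemma esgn_sq [simp]: "esgn \<omega> S * esgn \<omega> S = 1"
  by (simp add: esgn_def flip: power_add mult_2)

lemma esgn_nonzero [simp]: "esgn \<omega> S \<noteq> 0"
  by (simp add: esgn_def)

lemma esgn_remove: "esgn \<omega> (S |-| {|\<omega>|}) = esgn \<omega> S"
  unfolding esgn_def by (rule arg_cong[where f = "\<lambda>A. (- 1) ^ card A"]) auto

lemma esgn_finsert_self: "esgn \<omega> (finsert \<omega> S) = esgn \<omega> S"
  unfolding esgn_def by (rule arg_cong[where f = "\<lambda>A. (- 1) ^ card A"]) auto

lemma finite_fset_Collect: "finite {\<eta>. \<eta> |\<in>| S \<and> P \<eta>}"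
  by (rule finite_subset[of _ "fset S"]) auto

lemma esgn_finsert:
  assumes "\<eta> \<noteq> \<omega>" "\<eta> |\<notin>| S"
  shows "esgn \<omega> (finsert \<eta> S) = (if \<eta> < \<omega> then - esgn \<omega> S else esgn \<omega> S)"
proof (cases "\<eta> < \<omega>")
  case True
  then have *: "{\<zeta>. \<zeta> |\<in>| finsert \<eta> S \<and> \<zeta> < \<omega>} = insert \<eta> {\<zeta>. \<zeta> |\<in>| S \<and> \<zeta> < \<omega>}" by auto
  show ?thesis unfolding esgn_def * using True assms
    by (subst card_insert_disjoint) (auto simp: finite_fset_Collect)
next
  case False
  then have *: "{\<zeta>. \<zeta> |\<in>| finsert \<eta> S \<and> \<zeta> < \<omega>} = {\<zeta>. \<zeta> |\<in>| S \<and> \<zeta> < \<omega>}" by auto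
  show ?thesis unfolding esgn_def * using False by simp
qed

abbreviation ext_mult :: "fgen \<Rightarrow> ext \<Rightarrow> ext" where
  "ext_mult \<omega> \<equiv> wedge (gen \<omega>)"

lemma sum_keys_basis_vec: "(\<Sum>b\<in>Poly_Mapping.keys (basis_vec a). f b) = f a"
  by simp

text \<open>A monomial \<open>S\<close> arises from at most one monomial of \<open>x\<close>, namely
  \<open>S\<close> without \<omega>. With this closed form, operator identities become comparisons
  of single coefficients.\<close>

lemma lookup_ext_mult:
  "Poly_Mapping.lookup (ext_mult \<omega> x) S =
     (if \<omega> |\<in>| S then esgn \<omega> S * Poly_Mapping.lookup x (S |-| {|\<omega>|}) else 0)"
proof -
  have card1: "card {(s, t). s = \<omega> \<and> t |\<in>| T \<and> t < s} = card {t. t |\<in>| T \<and> t < \<omega>}" for T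
  proof -
    have "{(s, t). s = \<omega> \<and> t |\<in>| T \<and> t < s} = Pair \<omega> ` {t. t |\<in>| T \<and> t < \<omega>}" by auto
    then show ?thesis by (simp add: card_image inj_on_def)
  qed
  have "ext_mult \<omega> x =
      (\<Sum>T\<in>Poly_Mapping.keys x. if {|\<omega>|} |\<inter>| T = {||} then Poly_Mapping.single (finsert \<omega> T) (esgn \<omega> T * Poly_Mapping.lookup x T) else 0)"
    unfolding wedge_def gen_def sum_keys_basis_vec
    by (intro sum.cong if_cong refl) (auto simp: card1 esgn_def)
  then have "Poly_Mapping.lookup (ext_mult \<omega> x) S =
      (\<Sum>T\<in>Poly_Mapping.keys x. Poly_Mapping.lookup (if {|\<omega>|} |\<inter>| T = {||} then Poly_Mapping.single (finsert \<omega> T) (esgn \<omega> T * Poly_Mapping.lookup x T) else 0) S)"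
    by (simp only: lookup_sum)
  also have "\<dots> =
      (\<Sum>T\<in>Poly_Mapping.keys x. if \<omega> |\<notin>| T \<and> S = finsert \<omega> T then esgn \<omega> T * Poly_Mapping.lookup x T else 0)"
    by (intro sum.cong refl) (auto simp: lookup_single when_def)
  also have "\<dots> = (\<Sum>T\<in>Poly_Mapping.keys x. if T = S |-| {|\<omega>|} then (if \<omega> |\<in>| S then esgn \<omega> T * Poly_Mapping.lookup x T else 0) else 0)"
    by (intro sum.cong refl) (auto 4 3)
  also have "\<dots> = (if \<omega> |\<in>| S then esgn \<omega> S * Poly_Mapping.lookup x (S |-| {|\<omega>|}) else 0)"
    by (auto simp: esgn_remove in_keys_iff)
  finally show ?thesis .
qed

lemma lookup_contract:
  "Poly_Mapping.lookup (contract \<omega> x) S =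
     (if \<omega> |\<in>| S then 0 else esgn \<omega> S * Poly_Mapping.lookup x (finsert \<omega> S))"
proof -
  have "Poly_Mapping.lookup (contract \<omega> x) S =
      (\<Sum>T\<in>Poly_Mapping.keys x. if \<omega> |\<in>| T \<and> S = T |-| {|\<omega>|} then esgn \<omega> T * Poly_Mapping.lookup x T else 0)"
    unfolding contract_def lin_ext_def lookup_sum
    by (intro sum.cong refl, auto simp: lookup_single when_def lookup_cscale esgn_def)
  also have "\<dots> = (\<Sum>T\<in>Poly_Mapping.keys x. if T = finsert \<omega> S then (if \<omega> |\<in>| S then 0 else esgn \<omega> T * Poly_Mapping.lookup x T) else 0)"
    by (intro sum.cong refl) (auto 4 3)
  also have "\<dots> = (if \<omega> |\<in>| S then 0 else esgn \<omega> S * Poly_Mapping.lookup x (finsert \<omega> S))"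
    by (auto simp: esgn_finsert_self in_keys_iff)
  finally show ?thesis .
qed

lemma clinear_ext_mult: "clinear (ext_mult \<omega>)"
  unfolding linear_within_def
  by (auto intro!: poly_mapping_eqI simp: lookup_ext_mult lookup_add lookup_cscale algebra_simps)

lemma clinear_contract: "clinear (contract \<omega>)"
  unfolding contract_def by (rule clinear_lin_ext)

lemmas ext_simps = clinear_simps[OF clinear_ext_mult] clinear_simps[OF clinear_contract]

text \<open>Of two distinct generators exactly one precedes the other, so exactly one of the two
  orders of insertion pays an extra sign.\<close>

lemma esgn_swap:
  assumes "\<omega> \<noteq> \<eta>" "\<omega> |\<notin>| S" "\<eta> |\<notin>| S"
  shows "esgn \<omega> (finsert \<eta> S) * esgn \<eta> S = - (esgn \<eta> (finsert \<omega> S) * esgn \<omega> S)"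
  using assms by (auto simp: esgn_finsert)

lemma ext_mult_anticommute: "ext_mult \<omega> (ext_mult \<eta> x) = - ext_mult \<eta> (ext_mult \<omega> x)"
proof (rule poly_mapping_eqI)
  fix S
  show "Poly_Mapping.lookup (ext_mult \<omega> (ext_mult \<eta> x)) S = Poly_Mapping.lookup (- ext_mult \<eta> (ext_mult \<omega> x)) S"
  proof (cases "\<omega> \<noteq> \<eta> \<and> \<omega> |\<in>| S \<and> \<eta> |\<in>| S")
    case True
    define T where "T = S |-| {|\<omega>|} |-| {|\<eta>|}"
    have *: "S |-| {|\<omega>|} = finsert \<eta> T" "S |-| {|\<eta>|} = finsert \<omega> T" "S = finsert \<omega> (finsert \<eta> T)"
        "\<omega> |\<notin>| T" "\<eta> |\<notin>| T"
      "finsert \<eta> T |-| {|\<eta>|} = T" "finsert \<omega> T |-| {|\<omega>|} = T"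
      using True by (auto simp: T_def)
    have s1: "esgn \<omega> S = esgn \<omega> (finsert \<eta> T)" "esgn \<eta> S = esgn \<eta> (finsert \<omega> T)"
      using *(1,2) by (metis esgn_remove)+
    have "Poly_Mapping.lookup (ext_mult \<omega> (ext_mult \<eta> x)) S =
        (esgn \<omega> (finsert \<eta> T) * esgn \<eta> T) * Poly_Mapping.lookup x T"
      using True by (simp add: lookup_ext_mult *(1,6) s1 esgn_finsert_self)
    moreover have "Poly_Mapping.lookup (ext_mult \<eta> (ext_mult \<omega> x)) S =
        (esgn \<eta> (finsert \<omega> T) * esgn \<omega> T) * Poly_Mapping.lookup x T"
      using True by (simp add: lookup_ext_mult *(2,7) s1 esgn_finsert_self)
    ultimately show ?thesis using True *(4,5) by (simp add: esgn_swap)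
  qed (auto simp: lookup_ext_mult)
qed

lemma contract_anticommute: "contract \<omega> (contract \<eta> x) = - contract \<eta> (contract \<omega> x)"
proof (rule poly_mapping_eqI)
  fix S
  show "Poly_Mapping.lookup (contract \<omega> (contract \<eta> x)) S = Poly_Mapping.lookup (- contract \<eta> (contract \<omega> x)) S"
  proof (cases "\<omega> \<noteq> \<eta> \<and> \<omega> |\<notin>| S \<and> \<eta> |\<notin>| S")
    case True
    then have "esgn \<omega> S * esgn \<eta> (finsert \<omega> S) = - (esgn \<eta> S * esgn \<omega> (finsert \<eta> S))"
      using esgn_swap[of \<omega> \<eta> S] by (simp add: mult.commute)
    with True show ?thesis
      by (auto simp: lookup_contract finsert_commute[of \<eta>] simp flip: mult.assoc)
  qed (auto simp: lookup_contract)
qed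

lemma contract_ext_mult:
  assumes "\<omega> \<noteq> \<eta>"
  shows "contract \<omega> (ext_mult \<eta> x) = - ext_mult \<eta> (contract \<omega> x)"
proof (rule poly_mapping_eqI)
  fix S
  show "Poly_Mapping.lookup (contract \<omega> (ext_mult \<eta> x)) S = Poly_Mapping.lookup (- ext_mult \<eta> (contract \<omega> x)) S"
  proof (cases "\<omega> |\<notin>| S \<and> \<eta> |\<in>| S")
    case True
    define T where "T = S |-| {|\<eta>|}"
    have *: "S = finsert \<eta> T" "\<omega> |\<notin>| T" "\<eta> |\<notin>| T"
      "finsert \<omega> (finsert \<eta> T) |-| {|\<eta>|} = finsert \<omega> T" "finsert \<eta> T |-| {|\<eta>|} = T"
      using True assms by (auto simp: T_def)
    have s1: "esgn \<eta> (finsert \<omega> (finsert \<eta> T)) = esgn \<eta> (finsert \<omega> T)"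
      by (metis esgn_finsert_self finsert_commute)
    have "esgn \<omega> (finsert \<eta> T) * esgn \<eta> (finsert \<omega> T) = - (esgn \<eta> T * esgn \<omega> T)"
      using *(2,3) assms by (auto simp: esgn_finsert)
    with assms *(2,3) show ?thesis unfolding *(1)
      by (simp add: lookup_contract lookup_ext_mult *(4,5) s1 esgn_finsert_self flip: mult.assoc)
  qed (use assms in \<open>auto simp: lookup_contract lookup_ext_mult\<close>)
qed

text \<open>The one canonical anticommutation relation with a nonzero right-hand side: for equal
  generators the anticommutator is the identity.\<close>

lemma contract_ext_mult_self: "contract \<omega> (ext_mult \<omega> x) = x - ext_mult \<omega> (contract \<omega> x)"
proof (rule poly_mapping_eqI)
  fix S
  have *: "\<omega> |\<notin>| S \<Longrightarrow> finsert \<omega> S |-| {|\<omega>|} = S" "\<omega> |\<in>| S \<Longrightarrow> finsert \<omega> (S |-| {|\<omega>|}) = S"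
    by auto
  show "Poly_Mapping.lookup (contract \<omega> (ext_mult \<omega> x)) S = Poly_Mapping.lookup (x - ext_mult \<omega> (contract \<omega> x)) S"
    by (auto simp: lookup_contract lookup_ext_mult lookup_minus esgn_remove esgn_finsert_self * finsert_absorb
        simp flip: mult.assoc)
qed

lemma contract_one [simp]: "contract \<omega> (basis_vec {||}) = 0"
  by (rule poly_mapping_eqI) (auto simp: lookup_contract lookup_single when_def)

lemma ext_mult_twice [simp]: "ext_mult \<omega> (ext_mult \<omega> x) = 0"
  by (rule poly_mapping_eqI) (auto simp: lookup_ext_mult)

lemma prod_gens_Nil [simp]: "prod_gens [] = basis_vec {||}"
  and prod_gens_Cons [simp]: "prod_gens (\<omega> # \<omega>s) = ext_mult \<omega> (prod_gens \<omega>s)"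
  by (simp_all add: prod_gens_def)

lemma prod_gens_append: "prod_gens (xs @ ys) = foldr ext_mult xs (prod_gens ys)"
  by (simp add: prod_gens_def)

lemma ext_mult_basis_vec:
  assumes "\<omega> |\<notin>| S"
  shows "ext_mult \<omega> (basis_vec S) = cscale (esgn \<omega> S) (basis_vec (finsert \<omega> S))"
proof (rule poly_mapping_eqI)
  fix T
  have "\<omega> |\<in>| T \<Longrightarrow> S \<noteq> T |-| {|\<omega>|}" if "T \<noteq> finsert \<omega> S" using that by auto
  moreover have "finsert \<omega> S |-| {|\<omega>|} = S" using assms by auto
  ultimately show "Poly_Mapping.lookup (ext_mult \<omega> (basis_vec S)) T =
      Poly_Mapping.lookup (cscale (esgn \<omega> S) (basis_vec (finsert \<omega> S))) T"
    by (cases "T = finsert \<omega> S")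
      (simp_all add: lookup_ext_mult lookup_cscale lookup_single when_def esgn_finsert_self)
qed

text \<open>Products of generators span. Linear operators with known commutation rules with
  \<open>ext_mult\<close> can thus be compared without returning to sorted lists and their
  signs.\<close>

lemma ext_induct [case_names one mult add scale]:
  assumes one: "P (basis_vec {||})"
    and mult: "\<And>\<omega> x. P x \<Longrightarrow> P (ext_mult \<omega> x)"
    and add: "\<And>x y. P x \<Longrightarrow> P y \<Longrightarrow> P (x + y)"
    and scale: "\<And>c x. P x \<Longrightarrow> P (cscale c x)"
  shows "P x"
proof -
  have basis: "P (basis_vec S)" for S
  proof (induction S)
    case empty
    show ?case by (rule one)
  next
    case (insert \<omega> S)
    have "basis_vec (finsert \<omega> S) = cscale (esgn \<omega> S) (ext_mult \<omega> (basis_vec S))"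
      using insert.hyps by (simp add: ext_mult_basis_vec)
    then show ?case using insert mult scale by metis
  qed
  have "P (\<Sum>a\<in>K. cscale (Poly_Mapping.lookup x a) (basis_vec a))" if "finite K" for K
    using that
  proof (induction K rule: finite_induct)
    case empty
    show ?case using scale[OF one, of 0] by simp
  qed (simp add: add scale basis)
  then show ?thesis using basis_expansion[of x] by (metis finite_keys)
qed

text \<open>The image of a sorted list under \<open>f\<close> need not be sorted, yet the sign
  depends only on the position of \<omega> in the original list: each smaller element contributes
  one anticommutation, whatever its image.\<close>

lemma prod_gens_insort:
  assumes "sorted xs" "distinct xs" "\<omega> \<notin> set xs"
  shows "prod_gens (map f (insort \<omega> xs)) =
    cscale (esgn \<omega> (fset_of_list xs)) (ext_mult (f \<omega>) (prod_gens (map f xs)))"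
  using assms
proof (induction xs)
  case Nil
  then show ?case by (simp add: esgn_def)
next
  case (Cons \<eta> xs)
  show ?case
  proof (cases "\<omega> \<le> \<eta>")
    case True
    have "\<not> \<zeta> < \<omega>" if "\<zeta> = \<eta> \<or> \<zeta> \<in> set xs" for \<zeta> using that True Cons.prems by auto
    then have "{\<zeta>. \<zeta> |\<in>| fset_of_list (\<eta> # xs) \<and> \<zeta> < \<omega>} = {}"
      by (auto simp: fset_of_list_elem)
    then have "esgn \<omega> (fset_of_list (\<eta> # xs)) = 1" unfolding esgn_def by (metis card.empty power_0)
    then show ?thesis using True by simp
  next
    case False
    have "esgn \<omega> (fset_of_list (\<eta> # xs)) = - esgn \<omega> (fset_of_list xs)"
      using False Cons.prems by (simp add: esgn_finsert fset_of_list_elem)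
    with False Cons show ?thesis
      by (simp add: ext_simps ext_mult_anticommute[of "f \<eta>"])
  qed
qed

section \<open>The symmetric group acting on the exterior algebra\<close>

lemma clinear_perm_act: "clinear (perm_act w)"
  unfolding perm_act_def by (rule clinear_lin_ext)

lemmas perm_act_simps = clinear_simps[OF clinear_perm_act]

lemma perm_act_one [simp]: "perm_act w (basis_vec {||}) = basis_vec {||}"
  by (simp add: perm_act_def sorted_list_of_fset.rep_eq)

lemma perm_act_ext_mult: "perm_act w (ext_mult \<omega> x) = ext_mult (perm_gen w \<omega>) (perm_act w x)"
proof (rule clinear_eqI[where x = x])
  fix S
  show "perm_act w (ext_mult \<omega> (basis_vec S)) = ext_mult (perm_gen w \<omega>) (perm_act w (basis_vec S))"
  proof (cases "\<omega> |\<in>| S")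
    case False
    have "sorted_list_of_fset (finsert \<omega> S) = insort \<omega> (sorted_list_of_fset S)"
      using False by (simp add: sorted_list_of_fset.rep_eq)
    then show ?thesis using False
        prod_gens_insort[of "sorted_list_of_fset S" \<omega> "perm_gen w"]
      by (simp add: ext_mult_basis_vec perm_act_simps)
         (simp add: perm_act_def sorted_list_of_fset.rep_eq)
  next
    case True
    have "ext_mult \<omega> (basis_vec S) = 0" using True
      by (auto intro!: poly_mapping_eqI simp: lookup_ext_mult lookup_single when_def)
    \<comment> \<open>The image of \<omega> already occurs in the product; it anticommutes up to its
      copy, where the square vanishes.\<close>
    moreover have "ext_mult (perm_gen w \<omega>) (prod_gens (map (perm_gen w) xs)) = 0" if "\<omega> \<in> set xs" for xs
      using that
    proof (induction xs)
      case (Cons \<eta> xs)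
      then show ?case
        by (cases "\<eta> = \<omega>") (auto simp: ext_mult_anticommute[of "perm_gen w \<omega>" "perm_gen w \<eta>"] ext_simps)
    qed simp
    ultimately show ?thesis using True by (simp add: perm_act_simps) (simp add: perm_act_def)
  qed
qed (rule clinear_comp[OF clinear_perm_act clinear_ext_mult] clinear_comp[OF clinear_ext_mult clinear_perm_act])+

lemma perm_act_prod_gens: "perm_act w (prod_gens \<omega>s) = prod_gens (map (perm_gen w) \<omega>s)"
  by (induction \<omega>s) (simp_all add: perm_act_ext_mult)

lemma perm_act_id: "perm_act id x = x"
proof (induction x rule: ext_induct)
  case (mult \<omega> x)
  then show ?case by (cases \<omega>) (simp_all add: perm_act_ext_mult)
qed (simp_all add: perm_act_simps)

lemma perm_act_comp: "perm_act (v \<circ> w) x = perm_act v (perm_act w x)"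
proof (induction x rule: ext_induct)
  case (mult \<omega> x)
  then show ?case by (cases \<omega>) (simp_all add: perm_act_ext_mult)
qed (simp_all add: perm_act_simps)

lemma perm_gen_inject: "inj w \<Longrightarrow> perm_gen w \<omega> = perm_gen w \<eta> \<longleftrightarrow> \<omega> = \<eta>"
  by (cases \<omega>; cases \<eta>) (auto simp: inj_eq)

text \<open>Both sides satisfy the same relations with multiplication by a generator. Injectivity
  keeps distinct generators distinct, so that the same relation applies before and after
  \<open>w\<close>.\<close>

lemma perm_act_contract:
  assumes "inj w"
  shows "perm_act w (contract \<omega> x) = contract (perm_gen w \<omega>) (perm_act w x)"
proof (induction x rule: ext_induct)
  case (mult \<eta> x)
  then show ?case using assms
    by (cases "\<eta> = \<omega>")
       (simp_all add: contract_ext_mult_self contract_ext_mult perm_act_ext_mult perm_act_simps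
         ext_simps perm_gen_inject)
qed (simp_all add: perm_act_simps ext_simps)

section \<open>The operators attached to blocks and the skein relation\<close>

definition xi_sum :: "nat set \<Rightarrow> ext \<Rightarrow> ext" where
  "xi_sum S x = (\<Sum>i\<in>S. ext_mult (Xi i) x)"

definition dtheta_sum :: "nat set \<Rightarrow> ext \<Rightarrow> ext" where
  "dtheta_sum S x = (\<Sum>i\<in>S. contract (Theta i) x)"

text \<open>This agrees with \<^const>\<open>rho\<close> except on singletons, where it vanishes; that convention accounts
  for the four cases of the skein relation.\<close>
definition pair_op :: "nat set \<Rightarrow> ext \<Rightarrow> ext" where
  "pair_op S x = (\<Sum>i\<in>S. \<Sum>j\<in>S - {i}. ext_mult (Xi i) (contract (Theta j) x))"

lemma clinear_xi_sum: "clinear (xi_sum S)"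
  unfolding xi_sum_def[abs_def] by (intro clinear_sumI clinear_ext_mult)

lemma clinear_dtheta_sum: "clinear (dtheta_sum S)"
  unfolding dtheta_sum_def[abs_def] by (intro clinear_sumI clinear_contract)

lemma clinear_pair_op: "clinear (pair_op S)"
  unfolding pair_op_def[abs_def]
  by (intro clinear_sumI clinear_comp[OF clinear_ext_mult clinear_contract])

lemmas op_simps = clinear_simps[OF clinear_xi_sum] clinear_simps[OF clinear_dtheta_sum]
  clinear_simps[OF clinear_pair_op]

lemma sum_sum_anticommute:
  assumes "\<And>i j. i \<in> S \<Longrightarrow> j \<in> T \<Longrightarrow> f i j = - (g j i :: 'a::ab_group_add)"
  shows "(\<Sum>i\<in>S. \<Sum>j\<in>T. f i j) = - (\<Sum>j\<in>T. \<Sum>i\<in>S. g j i)"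
proof -
  have "(\<Sum>i\<in>S. \<Sum>j\<in>T. f i j) = (\<Sum>i\<in>S. \<Sum>j\<in>T. - g j i)"
    using assms by (intro sum.cong refl) auto
  then show ?thesis by (simp add: sum_negf sum.swap[of _ S T])
qed

lemma xi_sum_anticommute: "xi_sum S (xi_sum T x) = - xi_sum T (xi_sum S x)"
  unfolding xi_sum_def ext_simps by (intro sum_sum_anticommute ext_mult_anticommute)

lemma dtheta_sum_anticommute: "dtheta_sum S (dtheta_sum T x) = - dtheta_sum T (dtheta_sum S x)"
  unfolding dtheta_sum_def ext_simps by (intro sum_sum_anticommute contract_anticommute)

lemma dtheta_xi_sum: "dtheta_sum S (xi_sum T x) = - xi_sum T (dtheta_sum S x)"
  unfolding dtheta_sum_def xi_sum_def ext_simps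
  by (intro sum_sum_anticommute contract_ext_mult) simp

lemma pair_op_eq_sum: "pair_op S x = xi_sum S (dtheta_sum S x) - (\<Sum>i\<in>S. ext_mult (Xi i) (contract (Theta i) x))"
proof (cases "finite S")
  case True
  then have "(\<Sum>j\<in>S - {i}. ext_mult (Xi i) (contract (Theta j) x)) =
      (\<Sum>j\<in>S. ext_mult (Xi i) (contract (Theta j) x)) - ext_mult (Xi i) (contract (Theta i) x)" if "i \<in> S" for i
    using that by (simp add: sum_diff1)
  then show ?thesis
    by (simp add: pair_op_def xi_sum_def dtheta_sum_def ext_simps sum_subtractf)
qed (simp add: pair_op_def xi_sum_def)

lemma xi_sum_Un: "finite S \<Longrightarrow> finite T \<Longrightarrow> S \<inter> T = {} \<Longrightarrow> xi_sum (S \<union> T) x = xi_sum S x + xi_sum T x"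
  by (simp add: xi_sum_def sum.union_disjoint)

lemma dtheta_sum_Un: "finite S \<Longrightarrow> finite T \<Longrightarrow> S \<inter> T = {} \<Longrightarrow> dtheta_sum (S \<union> T) x = dtheta_sum S x + dtheta_sum T x"
  by (simp add: dtheta_sum_def sum.union_disjoint)

text \<open>The diagonal terms are additive over disjoint unions, so only the cross terms of the
  product of the two sums are new.\<close>

lemma pair_op_Un:
  assumes "finite S" "finite T" "S \<inter> T = {}"
  shows "pair_op (S \<union> T) x =
    pair_op S x + pair_op T x + xi_sum S (dtheta_sum T x) + xi_sum T (dtheta_sum S x)"
  using assms by (simp add: pair_op_eq_sum xi_sum_Un dtheta_sum_Un sum.union_disjoint op_simps)

lemma pair_op_singleton [simp]: "pair_op {i} x = 0"
  by (simp add: pair_op_def)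

text \<open>The operator xi_i d/dtheta_j is even: moving another xi out past both factors costs two
  signs, which cancel.\<close>

lemma xi_dtheta_ext_mult:
  "ext_mult (Xi i) (contract (Theta j) (ext_mult (Xi k) x)) = ext_mult (Xi k) (ext_mult (Xi i) (contract (Theta j) x))"
  by (subst ext_mult_anticommute) (simp add: contract_ext_mult ext_simps)

lemma xi_dtheta_contract:
  "ext_mult (Xi i) (contract (Theta j) (contract (Theta k) x)) = contract (Theta k) (ext_mult (Xi i) (contract (Theta j) x))"
  by (subst contract_anticommute) (simp add: contract_ext_mult ext_simps)

lemma xi_dtheta_commute:
  "ext_mult (Xi i) (contract (Theta j) (ext_mult (Xi k) (contract (Theta l) x))) =
   ext_mult (Xi k) (contract (Theta l) (ext_mult (Xi i) (contract (Theta j) x)))"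
  by (simp only: xi_dtheta_ext_mult[of i j k] xi_dtheta_contract[of i j l])

lemma pair_op_xi_sum: "pair_op S (xi_sum T x) = xi_sum T (pair_op S x)"
proof -
  have "xi_sum T (pair_op S x) = (\<Sum>i\<in>S. xi_sum T (\<Sum>j\<in>S - {i}. ext_mult (Xi i) (contract (Theta j) x)))"
    unfolding pair_op_def op_simps ..
  also have "\<dots> = (\<Sum>i\<in>S. \<Sum>j\<in>S - {i}. ext_mult (Xi i) (contract (Theta j) (xi_sum T x)))"
    by (simp add: xi_sum_def ext_simps xi_dtheta_ext_mult sum.swap[of _ T])
  finally show ?thesis by (simp add: pair_op_def)
qed

lemma pair_op_dtheta_sum: "pair_op S (dtheta_sum T x) = dtheta_sum T (pair_op S x)"
proof -
  have "dtheta_sum T (pair_op S x) = (\<Sum>i\<in>S. dtheta_sum T (\<Sum>j\<in>S - {i}. ext_mult (Xi i) (contract (Theta j) x)))"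
    unfolding pair_op_def op_simps ..
  also have "\<dots> = (\<Sum>i\<in>S. \<Sum>j\<in>S - {i}. ext_mult (Xi i) (contract (Theta j) (dtheta_sum T x)))"
    by (simp add: dtheta_sum_def ext_simps xi_dtheta_contract sum.swap[of _ T])
  finally show ?thesis by (simp add: pair_op_def)
qed

section \<open>Commutation of the operators \<open>rho\<close> and the skein relation\<close>

text \<open>Writes both cases of \<open>rho\<close> as one sum, so that commutation needs a single
  proof. The second case repeats the \<open>the_elem\<close> of \<open>rho\<close>, so the two agree
  even where that element is arbitrary.\<close>

definition rho_pairs :: "nat set \<Rightarrow> (nat \<times> nat) set" where
  "rho_pairs B = (if card B > 1 then SIGMA i:B. B - {i} else {(the_elem B, the_elem B)})"

lemma rho_eq_sum: "rho B x = (\<Sum>(i, j)\<in>rho_pairs B. ext_mult (Xi i) (contract (Theta j) x))"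
proof (cases "card B > 1")
  case True
  then have "finite B" by (metis card.infinite not_one_less_zero)
  with True show ?thesis by (simp add: rho_def rho_pairs_def sum.Sigma)
qed (simp add: rho_def rho_pairs_def Let_def)

lemma rho_eq_pair_op: "card B > 1 \<Longrightarrow> rho B x = pair_op B x"
  by (simp add: rho_def pair_op_def)

lemma rho_singleton: "rho {i} x = ext_mult (Xi i) (contract (Theta i) x)"
  by (simp add: rho_def)

lemma clinear_rho: "clinear (rho B)"
proof -
  have "clinear (\<lambda>x. \<Sum>p\<in>rho_pairs B. ext_mult (Xi (fst p)) (contract (Theta (snd p)) x))"
    by (intro clinear_sumI clinear_comp[OF clinear_ext_mult clinear_contract])
  then show ?thesis by (simp add: rho_eq_sum[abs_def] case_prod_unfold)
qed

lemmas rho_simps = clinear_simps[OF clinear_rho]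

lemma rho_ext_mult_contract:
  "rho B (ext_mult (Xi k) (contract (Theta l) x)) = ext_mult (Xi k) (contract (Theta l) (rho B x))"
  by (simp add: rho_eq_sum case_prod_unfold ext_simps xi_dtheta_commute[of k l])

lemma rho_commute: "rho B (rho C x) = rho C (rho B x)"
proof -
  have "rho B (rho C x) = (\<Sum>p\<in>rho_pairs C. rho B (ext_mult (Xi (fst p)) (contract (Theta (snd p)) x)))"
    unfolding rho_eq_sum[of C] case_prod_unfold rho_simps ..
  then show ?thesis
    by (simp add: rho_ext_mult_contract rho_eq_sum[of C "rho B x"] case_prod_unfold)
qed

interpretation rho_fold: comp_fun_commute rho
  by unfold_locales (simp add: fun_eq_iff rho_commute)

lemma pair_op_commute: "pair_op S (pair_op T x) = pair_op T (pair_op S x)"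
proof -
  have "pair_op S (ext_mult (Xi k) (contract (Theta l) x)) = ext_mult (Xi k) (contract (Theta l) (pair_op S x))" for k l
    by (simp add: pair_op_def ext_simps xi_dtheta_commute[of k l])
  then show ?thesis
    by (simp add: pair_op_def[of T x] pair_op_def[of T "pair_op S x"] op_simps)
qed

text \<open>The operators \<open>A 0, \<dots>, A 3\<close> stand for the multiplications by the sums of the \<open>\<xi>\<close> over
  \<open>S\<close>, \<open>T\<close>, \<open>{i}\<close>, \<open>{j}\<close>, and \<open>A 4, \<dots>, A 7\<close> for the contractions with the sums of the \<open>\<theta>\<close> over
  the same sets. Indexing them by numbers lets the simplifier sort products.\<close>
lemma skein_identity:
  fixes A :: "nat \<Rightarrow> 'a::ab_group_add \<Rightarrow> 'a"
  assumes add: "\<And>k x y. A k (x + y) = A k x + A k y"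
    and anti: "\<And>k l x. A k (A l x) = - A l (A k x)"
    and R: "\<And>x y. R (x + y) = R x + R y" "\<And>k x. R (A k x) = A k (R x)"
    and Q: "\<And>x y. Q (x + y) = Q x + Q y" "\<And>k x. Q (A k x) = A k (Q x)" "\<And>x. Q (R x) = R (Q x)"
  defines "RI \<equiv> \<lambda>y. R y + A 0 (A 6 y) + A 2 (A 4 y)"
    and "RJ \<equiv> \<lambda>y. R y + A 0 (A 7 y) + A 3 (A 4 y)"
    and "QI \<equiv> \<lambda>y. Q y + A 1 (A 6 y) + A 2 (A 5 y)"
    and "QJ \<equiv> \<lambda>y. Q y + A 1 (A 7 y) + A 3 (A 5 y)"
    and "RQ \<equiv> \<lambda>y. R y + Q y + A 0 (A 5 y) + A 1 (A 4 y)"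
    and "IJ \<equiv> \<lambda>y. A 2 (A 7 y) + A 3 (A 6 y)"
    and "RIJ \<equiv> \<lambda>y. R y + A 0 (A 6 y) + A 2 (A 4 y) + A 0 (A 7 y) + A 3 (A 4 y) + A 2 (A 7 y) + A 3 (A 6 y)"
    and "QIJ \<equiv> \<lambda>y. Q y + A 1 (A 6 y) + A 2 (A 5 y) + A 1 (A 7 y) + A 3 (A 5 y) + A 2 (A 7 y) + A 3 (A 6 y)"
  shows "RI (QJ x) + RJ (QI x) + RQ (IJ x) =
    R (QIJ x) + Q (RIJ x)"
proof -
  have neg: "A k (- y) = - A k y" for k y
    by (metis add add.right_inverse add_cancel_right_right minus_unique)
  have Rn: "R (- y) = - R y" for y
    by (metis R(1) add.right_inverse add_cancel_right_right minus_unique)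
  have Qn: "Q (- y) = - Q y" for y
    by (metis Q(1) add.right_inverse add_cancel_right_right minus_unique)
  have sort: "A k (A l y) = - A l (A k y)" if "l < k" for k l y by (rule anti)
  show ?thesis unfolding assms(8-)
    by (simp add: add neg R Q Rn Qn sort diff_conv_add_uminus del: add_uminus_conv_diff uminus_add_conv_diff)
qed


text \<open>For \<open>j = Suc i\<close> the terms on the left belong to \<mu>, \<pi> and the
  resolution with block {i, i+1}; those on the right belong to the two resolutions that the skein
  action subtracts. Each operator expands by \<open>pair_op_Un\<close> into products of
  anticommuting sums, to which \<open>skein_identity\<close> applies.\<close>

lemma rho_skein:
  assumes "finite S" "finite T" "S \<noteq> {}" "T \<noteq> {}" "S \<inter> T = {}"
    and "i \<noteq> j" "i \<notin> S \<union> T" "j \<notin> S \<union> T"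
  shows "rho (insert i S) (rho (insert j T) x) + rho (insert j S) (rho (insert i T) x)
      + rho (S \<union> T) (rho {i, j} x) =
    (if card S > 1 then rho S (rho (T \<union> {i, j}) x) else 0)
      + (if card T > 1 then rho T (rho (S \<union> {i, j}) x) else 0)"
proof -
  define A :: "nat \<Rightarrow> ext \<Rightarrow> ext" where
    "A k = (if k < 4 then xi_sum ([S, T, {i}, {j}] ! k) else dtheta_sum ([S, T, {i}, {j}] ! (k - 4)))" for k
  have A_simps: "A 0 = xi_sum S" "A 1 = xi_sum T" "A 2 = xi_sum {i}" "A 3 = xi_sum {j}"
    "A 4 = dtheta_sum S" "A 5 = dtheta_sum T" "A 6 = dtheta_sum {i}" "A 7 = dtheta_sum {j}"
    by (simp_all add: A_def numeral_eq_Suc)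
  have A_add: "A k (x + y) = A k x + A k y" for k x y
    by (simp add: A_def op_simps)
  have A_anti: "A k (A l x) = - A l (A k x)" for k l x
    by (cases "k < 4"; cases "l < 4")
      (simp_all add: A_def dtheta_xi_sum, (rule xi_sum_anticommute dtheta_sum_anticommute)+)
  have A_pair: "pair_op U (A k x) = A k (pair_op U x)" for U k x
    by (simp add: A_def pair_op_xi_sum pair_op_dtheta_sum)
  have ex: "(if card U > 1 then rho U y else 0) = pair_op U y" if "finite U" "U \<noteq> {}" for U y
  proof (cases "card U > 1")
    case False
    then have "card U = 1" using that card_gt_0_iff[of U] by linarith
    then show ?thesis by (metis card_1_singletonE False pair_op_singleton)
  qed (simp add: rho_eq_pair_op)
  have card: "card (insert k U) > 1" if "finite U" "U \<noteq> {}" "k \<notin> U" for k :: nat and U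
    using that by (simp add: card_gt_0_iff)
  have rho_ins: "rho (insert k U) = (\<lambda>y. pair_op U y + xi_sum U (dtheta_sum {k} y) + xi_sum {k} (dtheta_sum U y))"
    if "finite U" "U \<noteq> {}" "k \<notin> U" for k U
    using that pair_op_Un[of U "{k}"] card[of U k] by (auto simp: rho_eq_pair_op)
  have c2: "card (U \<union> V) > 1" if "finite U" "finite V" "U \<noteq> {}" "V \<noteq> {}" "U \<inter> V = {}" for U V :: "nat set"
    using that card_gt_0_iff[of U] card_gt_0_iff[of V] by (simp add: card_Un_disjoint)
  have ij: "pair_op {i, j} = (\<lambda>y. xi_sum {i} (dtheta_sum {j} y) + xi_sum {j} (dtheta_sum {i} y))"
    using pair_op_Un[of "{i}" "{j}"] \<open>i \<noteq> j\<close> by (auto simp: insert_commute)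
  have rho_ij: "rho {i, j} = pair_op {i, j}"
    using \<open>i \<noteq> j\<close> by (auto simp: rho_eq_pair_op)
  have rho_ST: "rho (S \<union> T) = (\<lambda>y. pair_op S y + pair_op T y + xi_sum S (dtheta_sum T y) + xi_sum T (dtheta_sum S y))"
    using c2[of S T] assms by (auto simp: rho_eq_pair_op pair_op_Un)
  have rho_Uij: "rho (U \<union> {i, j}) = (\<lambda>y. pair_op U y + xi_sum U (dtheta_sum {i} y) + xi_sum {i} (dtheta_sum U y)
      + xi_sum U (dtheta_sum {j} y) + xi_sum {j} (dtheta_sum U y)
      + xi_sum {i} (dtheta_sum {j} y) + xi_sum {j} (dtheta_sum {i} y))"
    if "finite U" "U \<noteq> {}" "i \<notin> U" "j \<notin> U" for U
  proof
    fix y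
    have "card (U \<union> {i, j}) > 1" using that \<open>i \<noteq> j\<close> by (intro c2) auto
    then have "rho (U \<union> {i, j}) y = pair_op U y + pair_op {i, j} y + xi_sum U (dtheta_sum {i, j} y) + xi_sum {i, j} (dtheta_sum U y)"
      using that \<open>i \<noteq> j\<close> pair_op_Un[of U "{i, j}" y] by (simp add: rho_eq_pair_op)
    moreover have "dtheta_sum {i, j} z = dtheta_sum {i} z + dtheta_sum {j} z"
      "xi_sum {i, j} z = xi_sum {i} z + xi_sum {j} z" for z
      using \<open>i \<noteq> j\<close> by (simp_all add: dtheta_sum_def xi_sum_def)
    ultimately show "rho (U \<union> {i, j}) y = pair_op U y + xi_sum U (dtheta_sum {i} y) + xi_sum {i} (dtheta_sum U y)
      + xi_sum U (dtheta_sum {j} y) + xi_sum {j} (dtheta_sum U y)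
      + xi_sum {i} (dtheta_sum {j} y) + xi_sum {j} (dtheta_sum {i} y)"
      by (simp add: ij op_simps algebra_simps)
  qed
  have iS: "i \<notin> S" and jS: "j \<notin> S" and iT: "i \<notin> T" and jT: "j \<notin> T" using assms by auto
  have "rho (insert i S) (rho (insert j T) x) + rho (insert j S) (rho (insert i T) x)
      + rho (S \<union> T) (rho {i, j} x) =
    pair_op S (rho (T \<union> {i, j}) x) + pair_op T (rho (S \<union> {i, j}) x)"
    using skein_identity[of A "pair_op S" "pair_op T" x, OF A_add A_anti clinear_add[OF clinear_pair_op] A_pair
        clinear_add[OF clinear_pair_op] A_pair pair_op_commute]
    by (simp only: A_simps rho_ij rho_ST ij rho_ins[OF assms(1,3) iS] rho_ins[OF assms(1,3) jS]
        rho_ins[OF assms(2,4) iT] rho_ins[OF assms(2,4) jT] rho_Uij[OF assms(1,3) iS jS] rho_Uij[OF assms(2,4) iT jT])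
  then show ?thesis by (simp only: ex[OF assms(1,3)] ex[OF assms(2,4)])
qed

lemma perm_act_rho:
  assumes "inj w" "finite B" "B \<noteq> {}"
  shows "perm_act w (rho B x) = rho (w ` B) (perm_act w x)"
proof (cases "card B > 1")
  case True
  have inj: "inj_on w A" for A using assms inj_on_subset by blast
  have "w ` B - {w i} = w ` (B - {i})" for i using assms by (auto simp: inj_eq)
  then show ?thesis using True inj
    by (simp add: rho_def card_image sum.reindex perm_act_simps perm_act_ext_mult perm_act_contract assms)
next
  case False
  then have "card B = 1" using assms card_gt_0_iff[of B] by linarith
  then obtain i where "B = {i}" by (rule card_1_singletonE)
  then show ?thesis by (simp add: rho_singleton perm_act_ext_mult perm_act_contract assms)
qed

section \<open>Equivariance of \<open>F_part\<close> and of the contraction with the sum of the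
  xi_i\<close>

abbreviation theta_top :: "nat \<Rightarrow> ext" where
  "theta_top n \<equiv> prod_gens (map Theta [1..<Suc n])"

lemma F_part_empty [simp]: "F_part n {} = theta_top n"
  by (simp add: F_part_def)

lemma F_part_insert: "finite Q \<Longrightarrow> B \<notin> Q \<Longrightarrow> F_part n (insert B Q) = rho B (F_part n Q)"
  unfolding F_part_def by (rule rho_fold.fold_insert)

lemma foldr_ext_mult_minus: "foldr ext_mult \<omega>s (- x) = - foldr ext_mult \<omega>s x"
  by (induction \<omega>s) (simp_all add: ext_simps)

text \<open>Two neighbouring factors are exchanged. This is the origin of the sign in the skein
  generators.\<close>

lemma perm_act_adj_theta_top:
  assumes "i \<in> {1..<n}"
  shows "perm_act (adj i) (theta_top n) = - theta_top n"
proof -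
  have split: "[1..<Suc n] = [1..<i] @ i # Suc i # [Suc (Suc i)..<Suc n]"
  proof -
    have "[1..<Suc n] = [1..<i] @ [i..<Suc n]"
      using assms upt_add_eq_append[of 1 i "Suc n - i"] by simp
    then show ?thesis using assms by (simp add: upt_conv_Cons del: upt_Suc)
  qed
  have "map (perm_gen (adj i)) (map Theta [1..<i]) = map Theta [1..<i]"
    "map (perm_gen (adj i)) (map Theta [Suc (Suc i)..<Suc n]) = map Theta [Suc (Suc i)..<Suc n]"
    by (auto simp: adj_def transpose_def)
  moreover have "perm_gen (adj i) (Theta i) = Theta (Suc i)" "perm_gen (adj i) (Theta (Suc i)) = Theta i"
    by (simp_all add: adj_def)
  ultimately have "perm_act (adj i) (theta_top n) = foldr ext_mult (map Theta [1..<i])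
      (ext_mult (Theta (Suc i)) (ext_mult (Theta i) (prod_gens (map Theta [Suc (Suc i)..<Suc n]))))"
    unfolding perm_act_prod_gens
    by (simp only: split map_append list.map prod_gens_append prod_gens_Cons)
  then show ?thesis
    by (simp only: split map_append list.map prod_gens_append prod_gens_Cons
        ext_mult_anticommute[of "Theta (Suc i)" "Theta i"] foldr_ext_mult_minus minus_minus)
qed

text \<open>\<open>w\<close> carries \<open>rho B\<close> to \<open>rho\<close> of the image block,
  so the only scalar comes from theta_1 ... theta_n. The scalar is left open since the lemma serves
  both adjacent transpositions, with -1, and arbitrary permutations.\<close>

lemma perm_act_F_part:
  assumes "inj w" "perm_act w (theta_top n) = cscale c (theta_top n)"
    and "finite Q" "\<And>B. B \<in> Q \<Longrightarrow> finite B \<and> B \<noteq> {}"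
  shows "perm_act w (F_part n Q) = cscale c (F_part n (perm_partition w Q))"
  using assms(3,4)
proof (induction Q rule: finite_induct)
  case empty
  then show ?case using assms(2) by (simp add: perm_partition_def)
next
  case (insert B Q)
  have "w ` B \<notin> perm_partition w Q"
    using insert.hyps(2) assms(1) by (auto simp: perm_partition_def inj_image_eq_iff)
  moreover have "perm_partition w (insert B Q) = insert (w ` B) (perm_partition w Q)"
    "finite (perm_partition w Q)"
    using insert.hyps by (simp_all add: perm_partition_def)
  ultimately show ?case using insert assms(1)
    by (simp add: F_part_insert perm_act_rho rho_simps)
qed

lemma inj_adj: "inj (adj i)"
  by (simp add: adj_def)

lemma perm_act_adj_F_part:
  assumes "i \<in> {1..<n}" "\<pi> \<in> SP n"
  shows "perm_act (adj i) (F_part n \<pi>) = - F_part n (perm_partition (adj i) \<pi>)"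
proof -
  have p: "partition_on {1..n} \<pi>" using assms by (simp add: SP_def)
  have fin: "finite \<pi>" using finite_elements[OF _ p] by simp
  have "finite B \<and> B \<noteq> {}" if "B \<in> \<pi>" for B
    using that p finite_subset[of B "{1..n}"] by (auto simp: partition_on_def)
  from perm_act_F_part[OF inj_adj _ fin this, of i n "- 1"] show ?thesis
    using perm_act_adj_theta_top[OF assms(1)] by simp
qed

definition dxi :: "nat \<Rightarrow> ext \<Rightarrow> ext" where
  "dxi n x = (\<Sum>i\<in>{1..n}. contract (Xi i) x)"

lemma clinear_dxi: "clinear (dxi n)"
  unfolding dxi_def[abs_def] by (intro clinear_sumI clinear_contract)

lemma f_part_eq_dxi: "f_part n \<pi> = dxi n (F_part n \<pi>)"
  by (simp add: f_part_def dxi_def)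

text \<open>The sum of all xi_i is invariant: \<open>w\<close> merely permutes its summands.\<close>

lemma perm_act_dxi:
  assumes "w permutes {1..n}"
  shows "perm_act w (dxi n x) = dxi n (perm_act w x)"
proof -
  have "perm_act w (dxi n x) = (\<Sum>i\<in>{1..n}. contract (Xi (w i)) (perm_act w x))"
    using permutes_inj[OF assms] by (simp add: dxi_def perm_act_simps perm_act_contract)
  also have "\<dots> = dxi n (perm_act w x)"
    unfolding dxi_def by (rule sum.permute[OF assms, of "\<lambda>i. contract (Xi i) (perm_act w x)", unfolded o_def, symmetric])
  finally show ?thesis .
qed

section \<open>Noncrossing partitions under adjacent transpositions\<close>

text \<open>Two disjoint blocks do not cross iff no pair in one separates two elements of the other; this
  form is insensitive to the cyclic position of the four elements.\<close>
definition unseparated :: "nat set \<Rightarrow> nat set \<Rightarrow> bool" where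
  "unseparated B C \<longleftrightarrow> (\<forall>x\<in>B. \<forall>y\<in>B. \<forall>u\<in>C. \<forall>v\<in>C. x < u \<and> u < y \<longrightarrow> x < v \<and> v < y)"

lemma unseparated_iff:
  assumes "unseparated B C" "x \<in> B" "y \<in> B" "u \<in> C" "v \<in> C"
  shows "x < u \<and> u < y \<longleftrightarrow> x < v \<and> v < y"
  using assms unfolding unseparated_def by metis

text \<open>If \<open>v\<close> lay outside the interval from \<open>x\<close> to \<open>y\<close>,
  then one of these two points would lie between \<open>u\<close> and \<open>v\<close> and the other
  would not. Disjointness excludes that \<open>v\<close> is an endpoint.\<close>

lemma unseparated_sym:
  assumes "unseparated B C" "B \<inter> C = {}"
  shows "unseparated C B"
  unfolding unseparated_def
proof (intro ballI impI)
  fix x y u v assume *: "x \<in> C" "y \<in> C" "u \<in> B" "v \<in> B" "x < u \<and> u < y"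
  have "v \<noteq> x" "v \<noteq> y" using * assms(2) by auto
  have "\<not> v < x"
    using assms(1)[unfolded unseparated_def, rule_format, of v u x y] * by auto
  moreover have "\<not> y < v"
    using assms(1)[unfolded unseparated_def, rule_format, of u v y x] * by auto
  ultimately show "x < v \<and> v < y" using \<open>v \<noteq> x\<close> \<open>v \<noteq> y\<close> by auto
qed

lemma unseparated_mono: "unseparated B C \<Longrightarrow> B' \<subseteq> B \<Longrightarrow> C' \<subseteq> C \<Longrightarrow> unseparated B' C'"
  unfolding unseparated_def by blast

text \<open>A failure of \<open>unseparated B C\<close> places \<open>v\<close> to the left of
  \<open>x\<close> or to the right of \<open>y\<close>; these are the crossing patterns that start
  in \<open>C\<close> and in \<open>B\<close> respectively.\<close>

lemma noncrossing_iff_unseparated: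
  assumes "disjoint \<pi>"
  shows "noncrossing \<pi> \<longleftrightarrow> (\<forall>B\<in>\<pi>. \<forall>C\<in>\<pi>. B \<noteq> C \<longrightarrow> unseparated B C)"
proof
  assume nc: "noncrossing \<pi>"
  show "\<forall>B\<in>\<pi>. \<forall>C\<in>\<pi>. B \<noteq> C \<longrightarrow> unseparated B C"
    unfolding unseparated_def
  proof (intro ballI impI)
    fix B C x y u v
    assume *: "B \<in> \<pi>" "C \<in> \<pi>" "B \<noteq> C" "x \<in> B" "y \<in> B" "u \<in> C" "v \<in> C" "x < u \<and> u < y"
    have "B \<inter> C = {}" using * assms by (auto simp: disjoint_def)
    then have "v \<noteq> x" "v \<noteq> y" using * by auto
    moreover have "\<not> v < x"
      using nc[unfolded noncrossing_def, rule_format, of C B v x u y] * by auto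
    moreover have "\<not> y < v"
      using nc[unfolded noncrossing_def, rule_format, of B C x u y v] * by auto
    ultimately show "x < v \<and> v < y" by auto
  qed
next
  assume R: "\<forall>B\<in>\<pi>. \<forall>C\<in>\<pi>. B \<noteq> C \<longrightarrow> unseparated B C"
  show "noncrossing \<pi>" unfolding noncrossing_def
  proof (intro ballI allI impI)
    fix B C a b c d
    assume *: "B \<in> \<pi>" "C \<in> \<pi>" "a < b \<and> b < c \<and> c < d \<and> a \<in> B \<and> c \<in> B \<and> b \<in> C \<and> d \<in> C"
    show "B = C"
    proof (rule ccontr)
      assume "B \<noteq> C"
      then have "unseparated B C" using R * by blast
      then have "a < d \<and> d < c" unfolding unseparated_def using * by blast
      then show False using * by auto
    qed
  qed
qed

lemma noncrossing_insert2:
  assumes "disjoint (R \<union> {B, C})" "B \<inter> C = {}"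
    and "\<And>D E. D \<in> R \<Longrightarrow> E \<in> R \<Longrightarrow> D \<noteq> E \<Longrightarrow> unseparated D E"
    and "\<And>D. D \<in> R \<Longrightarrow> D \<inter> (B \<union> C) = {}"
    and "\<And>D. D \<in> R \<Longrightarrow> unseparated D B" "\<And>D. D \<in> R \<Longrightarrow> unseparated D C"
    and "unseparated B C"
  shows "noncrossing (R \<union> {B, C})"
  unfolding noncrossing_iff_unseparated[OF assms(1)]
proof (intro ballI impI)
  have D: "unseparated B D" "unseparated C D" if "D \<in> R" for D
    using that assms(4)[of D] assms(5,6) by (blast intro: unseparated_sym)+
  fix X Y assume "X \<in> R \<union> {B, C}" "Y \<in> R \<union> {B, C}" "X \<noteq> Y"
  then show "unseparated X Y"
    using D assms(3,5,6,7) unseparated_sym[OF assms(7,2)] by blast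
qed

text \<open>No element of \<open>D\<close> is i or i+1, so \<open>D\<close> cannot distinguish these
  two points. All of \<open>S\<close> lies in the same gap of \<open>D\<close> as i+1 and all of
  \<open>T\<close> in the same gap as i, hence everything lies in one gap. A third block therefore
  crosses no redistribution of the two blocks.\<close>

lemma unseparated_adjacent_merge:
  assumes "unseparated D (insert (Suc i) S)" "unseparated D (insert i T)" "i \<notin> D" "Suc i \<notin> D"
  shows "unseparated D (S \<union> T \<union> {i, Suc i})"
proof -
  have adj: "x < i \<longleftrightarrow> x < Suc i" "i < x \<longleftrightarrow> Suc i < x" if "x \<in> D" for x
  proof -
    have "x \<noteq> i" "x \<noteq> Suc i" using that assms(3,4) by auto
    then show "x < i \<longleftrightarrow> x < Suc i" "i < x \<longleftrightarrow> Suc i < x" by auto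
  qed
  have S: "x < s \<and> s < y \<longleftrightarrow> x < Suc i \<and> Suc i < y" if "x \<in> D" "y \<in> D" "s \<in> S" for x y s
    using that by (intro unseparated_iff[OF assms(1)]) auto
  have T: "x < t \<and> t < y \<longleftrightarrow> x < i \<and> i < y" if "x \<in> D" "y \<in> D" "t \<in> T" for x y t
    using that by (intro unseparated_iff[OF assms(2)]) auto
  have "x < w \<and> w < y \<longleftrightarrow> x < i \<and> i < y" if "x \<in> D" "y \<in> D" "w \<in> S \<union> T \<union> {i, Suc i}" for x y w
    using that(3) S[OF that(1,2)] T[OF that(1,2)] adj[OF that(1)] adj[OF that(2)] by auto
  then show ?thesis unfolding unseparated_def by metis
qed

section \<open>Splitting a partition at two adjacent elements\<close>

definition singles :: "nat set set \<Rightarrow> nat" where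
  "singles \<pi> = card {B \<in> \<pi>. card B = 1}"

text \<open>\<open>M\<close> stands for the union of the blocks of i and i+1, and \<open>R\<close>
  for the remaining blocks: all resolutions arise by cutting the same \<open>M\<close> in
  two.\<close>

lemma partition_on_replace_two:
  assumes "partition_on (A - M) R" "M \<subseteq> A" "B \<union> C = M" "B \<inter> C = {}" "B \<noteq> {}" "C \<noteq> {}"
  shows "partition_on A (R \<union> {B, C})" "B \<notin> R" "C \<notin> R"
proof -
  have "D \<inter> M = {}" if "D \<in> R" for D using that assms(1) by (auto simp: partition_on_def)
  then have D: "D \<inter> B = {}" "D \<inter> C = {}" if "D \<in> R" for D using that assms(3) by blast+
  show "B \<notin> R" "C \<notin> R" using D assms(5,6) by blast+
  show "partition_on A (R \<union> {B, C})"
    unfolding partition_on_def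
  proof (intro conjI)
    show "\<Union> (R \<union> {B, C}) = A" using assms by (auto simp: partition_on_def)
    have dR: "X \<inter> Y = {}" if "X \<in> R" "Y \<in> R" "X \<noteq> Y" for X Y
      using that assms(1) by (auto simp: partition_on_def disjoint_def)
    show "disjoint (R \<union> {B, C})"
    proof (rule disjointI)
      fix X Y assume *: "X \<in> R \<union> {B, C}" "Y \<in> R \<union> {B, C}" "X \<noteq> Y"
      consider "X \<in> R" "Y \<in> R" | "X \<in> R" "Y = B \<or> Y = C" | "Y \<in> R" "X = B \<or> X = C"
        | "X = B" "Y = C" | "X = C" "Y = B" using * by blast
      then show "X \<inter> Y = {}" using D[of X] D[of Y] dR[of X Y] * assms(4)
        by cases (simp_all add: Int_commute, blast+)
    qed
    show "{} \<notin> R \<union> {B, C}" using assms by (auto simp: partition_on_def)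
  qed
qed

text \<open>\<open>S\<close> is attached to i+1 and \<open>T\<close> to i. After the transposition
  \<open>S\<close> accompanies i and \<open>T\<close> accompanies i+1, which matches the blocks
  \<open>B\<close> and \<open>C\<close> of \<open>skein_resolve\<close>.\<close>

lemma SP_split_adjacent:
  assumes \<pi>: "\<pi> \<in> SP n" and i: "i \<in> {1..<n}" and diff: "\<And>B. B \<in> \<pi> \<Longrightarrow> i \<in> B \<Longrightarrow> Suc i \<notin> B"
  obtains R S T where "\<pi> = R \<union> {insert (Suc i) S, insert i T}" "i \<notin> S \<union> T" "Suc i \<notin> S \<union> T"
    "S \<inter> T = {}" "finite S" "finite T" "S \<union> T \<union> {i, Suc i} \<subseteq> {1..n}"
    "partition_on ({1..n} - (S \<union> T \<union> {i, Suc i})) R"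
proof -
  have p: "\<Union>\<pi> = {1..n}" "disjoint \<pi>" "{} \<notin> \<pi>" using \<pi> by (auto simp: SP_def partition_on_def)
  obtain B where B: "B \<in> \<pi>" "Suc i \<in> B"
    using p(1) i by (metis UnionE atLeastAtMost_iff atLeastLessThan_iff Suc_leI le_SucI)
  obtain C where C: "C \<in> \<pi>" "i \<in> C"
    using p(1) i by (metis UnionE atLeastAtMost_iff atLeastLessThan_iff less_imp_le)
  have BC: "i \<notin> B" "Suc i \<notin> C" "B \<noteq> C" using diff B C by auto
  have disj: "B \<inter> C = {}" using p(2) B C BC by (auto simp: disjoint_def)
  have sub: "B \<subseteq> {1..n}" "C \<subseteq> {1..n}" using p(1) B C by blast+
  define S T R where "S = B - {Suc i}" and "T = C - {i}" and "R = \<pi> - {B, C}"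
  have Beq: "B = insert (Suc i) S" and Ceq: "C = insert i T" using B C by (auto simp: S_def T_def)
  show ?thesis
  proof
    show "\<pi> = R \<union> {insert (Suc i) S, insert i T}" using B C Beq Ceq by (auto simp: R_def)
    show "i \<notin> S \<union> T" "Suc i \<notin> S \<union> T" "S \<inter> T = {}" using BC disj by (auto simp: S_def T_def)
    show "finite S" "finite T" using sub by (auto simp: S_def T_def intro: finite_subset)
    show "S \<union> T \<union> {i, Suc i} \<subseteq> {1..n}" using sub B C by (auto simp: S_def T_def)
    have eq: "S \<union> T \<union> {i, Suc i} = B \<union> C" using B C by (auto simp: S_def T_def)
    show "partition_on ({1..n} - (S \<union> T \<union> {i, Suc i})) R"
      unfolding eq partition_on_def
    proof (intro conjI)
      have "D \<inter> (B \<union> C) = {}" if "D \<in> R" for D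
        using that disjointD[OF p(2), of D B] disjointD[OF p(2), of D C] B C unfolding R_def by auto
      then have "\<Union>R \<inter> (B \<union> C) = {}" by blast
      moreover have "\<Union>\<pi> = \<Union>R \<union> (B \<union> C)" using B C by (auto simp: R_def)
      ultimately show "\<Union>R = {1..n} - (B \<union> C)" using p(1) by blast
      show "disjoint R" using p(2) by (auto simp: R_def disjoint_def)
      show "{} \<notin> R" using p(3) by (simp add: R_def)
    qed
  qed
qed

lemma adj_image:
  assumes "i \<notin> S" "Suc i \<notin> S"
  shows "adj i ` S = S" "adj i ` insert i S = insert (Suc i) S" "adj i ` insert (Suc i) S = insert i S"
proof -
  have "adj i x = x" if "x \<in> S" for x using that assms by (auto simp: adj_def transpose_def)
  then show S: "adj i ` S = S" by force
  show "adj i ` insert i S = insert (Suc i) S" "adj i ` insert (Suc i) S = insert i S"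
    using S by (simp_all add: adj_def)
qed

lemma block_of_eq:
  assumes "disjoint \<pi>" "B \<in> \<pi>" "i \<in> B"
  shows "block_of \<pi> i = B"
  unfolding block_of_def using assms by (intro the_equality) (auto simp: disjoint_def)

lemma card_singles_replace_two:
  assumes "finite R" "B \<notin> R" "C \<notin> R" "B \<noteq> C" "card B > 1" "card C > 1"
  shows "card (R \<union> {B, C}) = card R + 2" "singles (R \<union> {B, C}) = singles R"
proof -
  show "card (R \<union> {B, C}) = card R + 2" using assms by (simp add: card_insert_if)
  have "{X \<in> R \<union> {B, C}. card X = 1} = {X \<in> R. card X = 1}" using assms by auto
  then show "singles (R \<union> {B, C}) = singles R" by (simp add: singles_def)
qed

lemma F_part_replace_two:
  assumes "finite R" "B \<notin> R" "C \<notin> R" "B \<noteq> C"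
  shows "F_part n (R \<union> {B, C}) = rho B (rho C (F_part n R))"
  using assms F_part_insert[of "insert C R" B n] F_part_insert[of R C n] by (simp add: insert_commute)

lemma free_on_basis_vec: "a \<in> X \<Longrightarrow> basis_vec a \<in> free_on X"
  by (simp add: free_on_def)

lemma subspace_free_on: "cvs.subspace (free_on X)"
  unfolding cvs.subspace_def free_on_def
  by (auto simp: in_keys_iff lookup_add lookup_cscale subset_iff) (metis add_0)

lemma perm_partition_SP:
  assumes w: "w permutes {1..n}" and \<pi>: "\<pi> \<in> SP n"
  shows "perm_partition w \<pi> \<in> SP n" "card (perm_partition w \<pi>) = card \<pi>"
    "singles (perm_partition w \<pi>) = singles \<pi>"
proof -
  have inj: "inj w" using w by (rule permutes_inj)
  have injI: "inj_on ((`) w) X" for X using inj by (simp add: inj_on_def inj_image_eq_iff)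
  have cB: "card (w ` B) = card B" for B using inj by (simp add: card_image inj_on_subset[OF inj])
  have p: "partition_on {1..n} \<pi>" using \<pi> by (simp add: SP_def)
  have "{} \<notin> (`) w ` \<pi>" using p by (auto simp: partition_on_def)
  then show "perm_partition w \<pi> \<in> SP n"
    using partition_on_inj_image[OF p inj_on_subset[OF inj]] permutes_image[OF w]
    by (simp add: SP_def perm_partition_def)
  show "card (perm_partition w \<pi>) = card \<pi>" unfolding perm_partition_def by (rule card_image[OF injI])
  have "{B \<in> perm_partition w \<pi>. card B = 1} = (`) w ` {B \<in> \<pi>. card B = 1}"
    by (auto simp: perm_partition_def cB)
  then show "singles (perm_partition w \<pi>) = singles \<pi>"
    unfolding singles_def by (simp add: card_image[OF injI])
qed

lemma adj_permutes: "i \<in> {1..<n} \<Longrightarrow> adj i permutes {1..n}"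
  unfolding adj_def by (intro permutes_swap_id) auto

section \<open>Skein generators correspond to adjacent transpositions\<close>

text \<open>If \<mu> is noncrossing, both claims reduce to a sign; otherwise both rest on the same
  analysis of the blocks of i and i+1, and are therefore proved together.\<close>

lemma perm_act_adj_noncrossing:
  assumes \<pi>: "\<pi> \<in> NC n" and i: "i \<in> {1..<n}"
  defines "x \<equiv> skein_gen i (basis_vec \<pi>)"
  shows skein_gen_in: "x \<in> free_on {\<nu> \<in> NC n. card \<nu> = card \<pi> \<and> singles \<nu> = singles \<pi>}" (is "x \<in> ?X")
    and lin_ext_skein_gen: "lin_ext (F_part n) x = perm_act (adj i) (F_part n \<pi>)"
proof -
  define \<mu> where "\<mu> = perm_partition (adj i) \<pi>"
  have SP: "\<pi> \<in> SP n" and nc: "noncrossing \<pi>" using \<pi> by (auto simp: NC_def)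
  have x: "x = (if noncrossing \<mu> then - basis_vec \<mu> else skein_resolve i \<mu>)"
    by (simp add: x_def skein_gen_def \<mu>_def Let_def)
  note \<mu> = perm_partition_SP[OF adj_permutes[OF i] SP, folded \<mu>_def]
  note F = perm_act_adj_F_part[OF i SP, folded \<mu>_def]
  have "x \<in> ?X \<and> lin_ext (F_part n) x = perm_act (adj i) (F_part n \<pi>)"
  proof (cases "noncrossing \<mu>")
    case True
    then have "basis_vec \<mu> \<in> ?X" using \<mu> by (intro free_on_basis_vec) (auto simp: NC_def)
    then show ?thesis using True F
      by (simp add: x cvs.subspace_neg[OF subspace_free_on] clinear_simps[OF clinear_lin_ext])
  next
    case crossing: False
    have diff: "Suc i \<notin> B" if B: "B \<in> \<pi>" "i \<in> B" for B
    proof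
      assume Suc: "Suc i \<in> B"
      have "adj i ` D = D" if "D \<in> \<pi>" for D
      proof (cases "D = B")
        case True
        then show ?thesis using B Suc by (simp add: adj_def)
      next
        case False
        then have "D \<inter> B = {}" using SP that B by (auto simp: SP_def partition_on_def disjoint_def)
        then show ?thesis using B Suc by (intro adj_image(1)) auto
      qed
      then have "\<mu> = \<pi>" by (simp add: \<mu>_def perm_partition_def)
      then show False using crossing nc by simp
    qed
    obtain R S T where \<pi>eq: "\<pi> = R \<union> {insert (Suc i) S, insert i T}"
      and ni: "i \<notin> S \<union> T" "Suc i \<notin> S \<union> T" and ST: "S \<inter> T = {}" and fin: "finite S" "finite T"
      and sub: "S \<union> T \<union> {i, Suc i} \<subseteq> {1..n}"
      and part: "partition_on ({1..n} - (S \<union> T \<union> {i, Suc i})) R"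
      by (rule SP_split_adjacent[OF SP i diff])
    define M where "M = S \<union> T \<union> {i, Suc i}"
    note sub = sub[folded M_def] and part = part[folded M_def]
    have RM: "D \<inter> M = {}" if "D \<in> R" for D using that part by (auto simp: partition_on_def)
    have finR: "finite R" using finite_elements[OF _ part] by simp
    have unsep: "unseparated D E" if "D \<in> \<pi>" "E \<in> \<pi>" "D \<noteq> E" for D E
      using that nc noncrossing_iff_unseparated[of \<pi>] SP by (auto simp: SP_def partition_on_def)
    have \<mu>eq: "\<mu> = R \<union> {insert i S, insert (Suc i) T}"
    proof -
      have "adj i ` D = D" if "D \<in> R" for D using RM[OF that] by (intro adj_image) (auto simp: M_def)
      moreover have "adj i i = Suc i" "adj i (Suc i) = i" by (simp_all add: adj_def)
      ultimately show ?thesis using ni by (simp add: \<mu>_def \<pi>eq perm_partition_def adj_image)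
    qed
    have unsepM: "unseparated D B" if "D \<in> R" "B \<subseteq> M" for D B
    proof -
      have D: "i \<notin> D" "Suc i \<notin> D" "D \<noteq> insert (Suc i) S" "D \<noteq> insert i T"
        using RM[OF that(1)] by (auto simp: M_def)
      then have "unseparated D (S \<union> T \<union> {i, Suc i})"
        using that by (intro unseparated_adjacent_merge unsep) (auto simp: \<pi>eq)
      then show ?thesis using that(2) by (auto simp: M_def intro: unseparated_mono)
    qed
    \<comment> \<open>Pairs of blocks within \<open>R\<close>, or between \<open>R\<close> and a
      part of \<open>M\<close>, never cross; only the two new blocks remain to be compared with each
      other.\<close>
    have new: "R \<union> {B, C} \<in> NC n \<and> B \<notin> R \<and> C \<notin> R"
      if BC: "B \<union> C = M" "B \<inter> C = {}" "B \<noteq> {}" "C \<noteq> {}" "unseparated B C" for B C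
    proof -
      note p = partition_on_replace_two[OF part sub BC(1-4)]
      have "noncrossing (R \<union> {B, C})"
      proof (rule noncrossing_insert2)
        show "disjoint (R \<union> {B, C})" using p(1) by (simp add: partition_on_def)
        show "unseparated D E" if "D \<in> R" "E \<in> R" "D \<noteq> E" for D E
          using that by (intro unsep) (auto simp: \<pi>eq)
        show "D \<inter> (B \<union> C) = {}" if "D \<in> R" for D using RM[OF that] BC by simp
        show "unseparated D B" "unseparated D C" if "D \<in> R" for D
          using BC(1) by (auto intro: unsepM[OF that])
      qed (use BC in auto)
      then show ?thesis using p by (simp add: NC_def SP_def)
    qed
    \<comment> \<open>With \<open>S\<close> empty, \<mu> has the block {i}, which crosses nothing,
      so \<mu> would be noncrossing. The same holds for \<open>T\<close> and {i+1}; hence both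
      blocks of \<mu> have at least two elements.\<close>
    have S: "S \<noteq> {}"
    proof
      assume "S = {}"
      then have "R \<union> {{i}, insert (Suc i) T} \<in> NC n"
        using ni by (intro new[THEN conjunct1]) (auto simp: M_def unseparated_def)
      then show False using crossing \<open>S = {}\<close> by (simp add: NC_def \<mu>eq)
    qed
    have T: "T \<noteq> {}"
    proof
      assume "T = {}"
      then have "R \<union> {insert i S, {Suc i}} \<in> NC n"
        using ni by (intro new[THEN conjunct1]) (auto simp: M_def unseparated_def)
      then show False using crossing \<open>T = {}\<close> by (simp add: NC_def \<mu>eq)
    qed
    have ST1: "unseparated (insert (Suc i) S) (insert i T)" "unseparated (insert i T) (insert (Suc i) S)"
      using ni ST by (auto intro!: unsep simp: \<pi>eq)
    have c1: "card (insert k U) > 1" if "finite U" "U \<noteq> {}" "k \<notin> U" for k :: nat and U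
      using that by (simp add: card_gt_0_iff)
    have cU: "card U > 1" if "insert k V \<subseteq> U" "finite U" "V \<noteq> {}" "k \<notin> V" for U V and k :: nat
      using that card_mono[OF that(2,1)] c1[of V k] finite_subset[OF that(1,2)] by auto
    define \<pi>2 \<pi>3 \<pi>4 where "\<pi>2 = R \<union> {S \<union> T, {i, Suc i}}"
      and "\<pi>3 = R \<union> {S, T \<union> {i, Suc i}}" and "\<pi>4 = R \<union> {T, S \<union> {i, Suc i}}"
    have nS: "i \<notin> S" "Suc i \<notin> S" and nT: "i \<notin> T" "Suc i \<notin> T" using ni by auto
    have u2: "unseparated (S \<union> T) {i, Suc i}"
      unfolding unseparated_def
    proof (intro ballI impI)
      fix x y u v assume *: "x \<in> S \<union> T" "y \<in> S \<union> T" "u \<in> {i, Suc i}" "v \<in> {i, Suc i}" "x < u \<and> u < y"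
      have "x \<noteq> i" "x \<noteq> Suc i" "y \<noteq> i" "y \<noteq> Suc i" using * ni by auto
      then show "x < v \<and> v < y" using * by auto
    qed
    \<comment> \<open>\<open>U\<close> contains neither i nor i+1 and cannot tell them apart, so the
      single point \<open>k\<close> decides on which side every other point lies.\<close>
    have merge: "unseparated U (insert i V \<union> {i, Suc i})"
      if "unseparated U (insert k V)" "k \<in> {i, Suc i}" "i \<notin> U" "Suc i \<notin> U" for U V k
    proof -
      have "unseparated U {k}" using that(1) by (auto intro: unseparated_mono)
      have adj: "x < i \<longleftrightarrow> x < Suc i" "i < x \<longleftrightarrow> Suc i < x" if "x \<in> U" for x
      proof -
        have "x \<noteq> i" "x \<noteq> Suc i" using that \<open>i \<notin> U\<close> \<open>Suc i \<notin> U\<close> by auto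
        then show "x < i \<longleftrightarrow> x < Suc i" "i < x \<longleftrightarrow> Suc i < x" by auto
      qed
      have "x < w \<and> w < y \<longleftrightarrow> x < k \<and> k < y" if "x \<in> U" "y \<in> U" "w \<in> insert i V \<union> {i, Suc i}" for x y w
      proof (cases "w \<in> V")
        case True
        then show ?thesis using that by (intro unseparated_iff[OF \<open>unseparated U (insert k V)\<close>]) auto
      next
        case False
        then show ?thesis using that adj[OF that(1)] adj[OF that(2)] \<open>k \<in> {i, Suc i}\<close> by auto
      qed
      then show ?thesis unfolding unseparated_def by metis
    qed
    have u3: "unseparated S (T \<union> {i, Suc i})"
      using merge[of S i T] ST1(1) nS by (auto intro: unseparated_mono)
    have u4: "unseparated T (S \<union> {i, Suc i})"
      using merge[of T "Suc i" S] ST1(2) nT by (auto intro: unseparated_mono)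
    have n1: "insert (Suc i) S \<notin> R" "insert i T \<notin> R"
      using new[of "insert (Suc i) S" "insert i T"] ni ST ST1 by (auto simp: M_def)
    have nm: "insert i S \<notin> R" "insert (Suc i) T \<notin> R"
      using RM by (auto simp: M_def)
    have n2: "\<pi>2 \<in> NC n" "S \<union> T \<notin> R" "{i, Suc i} \<notin> R"
      using new[of "S \<union> T" "{i, Suc i}"] ni S u2 by (auto simp: M_def \<pi>2_def)
    have n3: "\<pi>3 \<in> NC n" "S \<notin> R" "T \<union> {i, Suc i} \<notin> R"
      using new[of S "T \<union> {i, Suc i}"] ni ST S u3 by (auto simp: M_def \<pi>3_def)
    have n4: "\<pi>4 \<in> NC n" "T \<notin> R" "S \<union> {i, Suc i} \<notin> R"
      using new[of T "S \<union> {i, Suc i}"] ni ST T u4 by (auto simp: M_def \<pi>4_def)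
    have cS: "card (insert (Suc i) S) > 1" "card (insert i S) > 1" "card (S \<union> {i, Suc i}) > 1"
      using fin S nS by (auto intro!: c1 cU[of i S])
    have cT: "card (insert (Suc i) T) > 1" "card (insert i T) > 1" "card (T \<union> {i, Suc i}) > 1"
      using fin T nT by (auto intro!: c1 cU[of i T])
    have cST: "card (S \<union> T) > 1"
      using card_gt_0_iff[of S] card_gt_0_iff[of T] S T ST fin by (simp add: card_Un_disjoint)
    have d1: "insert (Suc i) S \<noteq> insert i T" "insert i S \<noteq> insert (Suc i) T" using ni by auto
    have d2: "S \<union> T \<noteq> {i, Suc i}" "S \<noteq> T \<union> {i, Suc i}" "T \<noteq> S \<union> {i, Suc i}" using ni by auto
    have t0: "card \<pi> = card R + 2" "singles \<pi> = singles R"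
      unfolding \<pi>eq using card_singles_replace_two[OF finR n1 d1(1) cS(1) cT(2)] by auto
    have t2: "card \<pi>2 = card R + 2" "singles \<pi>2 = singles R"
      unfolding \<pi>2_def using card_singles_replace_two[OF finR n2(2,3) d2(1) cST] by auto
    \<comment> \<open>The condition under which the third and fourth resolutions enter excludes
      precisely the case in which they would create a singleton block.\<close>
    have t3: "card \<pi>3 = card R + 2" "singles \<pi>3 = singles R" if "card S > 1"
      unfolding \<pi>3_def using card_singles_replace_two[OF finR n3(2,3) d2(2) that cT(3)] by auto
    have t4: "card \<pi>4 = card R + 2" "singles \<pi>4 = singles R" if "card T > 1"
      unfolding \<pi>4_def using card_singles_replace_two[OF finR n4(2,3) d2(3) that cS(3)] by auto
    \<comment> \<open>The first resolution exchanges i and i+1 back and is \<pi> itself. A block of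
      \<mu> has more than two elements iff \<open>S\<close>, respectively \<open>T\<close>, has more
      than one.\<close>
    have resolve: "x = basis_vec \<pi> + basis_vec \<pi>2
        - (if card S > 1 then basis_vec \<pi>3 else 0) - (if card T > 1 then basis_vec \<pi>4 else 0)"
    proof -
      have dj: "disjoint \<mu>" using \<mu>(1) by (simp add: SP_def partition_on_def)
      have b: "block_of \<mu> i = insert i S" "block_of \<mu> (Suc i) = insert (Suc i) T"
        by (rule block_of_eq[OF dj]; simp add: \<mu>eq)+
      have "\<mu> - {insert i S, insert (Suc i) T} = R" using nm by (auto simp: \<mu>eq)
      moreover have "insert i S - {i} = S" "insert (Suc i) T - {Suc i} = T"
        "insert i S \<union> insert (Suc i) T - {i, Suc i} = S \<union> T"
        "insert (Suc i) T \<union> {i} = T \<union> {i, Suc i}" "insert i S \<union> {Suc i} = S \<union> {i, Suc i}"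
        using ni by auto
      moreover have "card (insert i S) > 2 \<longleftrightarrow> card S > 1" "card (insert (Suc i) T) > 2 \<longleftrightarrow> card T > 1"
        using ni fin by auto
      ultimately show ?thesis using crossing
        by (simp add: x skein_resolve_def b Let_def \<pi>eq \<pi>2_def \<pi>3_def \<pi>4_def)
    qed
    have "x \<in> ?X"
      unfolding resolve using t0 t2 t3 t4 n2 n3 n4 \<pi>
      by (intro cvs.subspace_diff[OF subspace_free_on] cvs.subspace_add[OF subspace_free_on])
        (auto intro!: free_on_basis_vec simp: cvs.subspace_0[OF subspace_free_on])
    \<comment> \<open>The target is the image of \<open>F_part n \<pi>\<close> under the
      transposition, which is minus \<open>F_part n \<mu>\<close>; the skein relation expresses this
      through noncrossing partitions.\<close>
    moreover have "lin_ext (F_part n) x = - F_part n \<mu>"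
    proof -
      let ?y = "F_part n R"
      have "F_part n \<pi> = rho (insert (Suc i) S) (rho (insert i T) ?y)"
        "F_part n \<mu> = rho (insert i S) (rho (insert (Suc i) T) ?y)"
        "F_part n \<pi>2 = rho (S \<union> T) (rho {i, Suc i} ?y)"
        "F_part n \<pi>3 = rho S (rho (T \<union> {i, Suc i}) ?y)"
        "F_part n \<pi>4 = rho T (rho (S \<union> {i, Suc i}) ?y)"
        unfolding \<pi>eq \<mu>eq \<pi>2_def \<pi>3_def \<pi>4_def
        by (intro F_part_replace_two finR n1 nm n2 n3 n4 d1 d2)+
      then have "F_part n \<mu> + F_part n \<pi> + F_part n \<pi>2 =
          (if card S > 1 then F_part n \<pi>3 else 0) + (if card T > 1 then F_part n \<pi>4 else 0)"
        using rho_skein[OF fin S T ST _ ni, of ?y] by simp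
      then show ?thesis
        unfolding resolve
        by (simp add: clinear_simps[OF clinear_lin_ext] algebra_simps split: if_splits)
    qed
    ultimately show ?thesis using F by simp
  qed
  then show "x \<in> ?X" "lin_ext (F_part n) x = perm_act (adj i) (F_part n \<pi>)" by auto
qed

section \<open>Linear independence: leading monomials\<close>

lemma prod_gens_distinct:
  "distinct \<omega>s \<Longrightarrow> \<exists>c. c \<noteq> 0 \<and> prod_gens \<omega>s = cscale c (basis_vec (fset_of_list \<omega>s))"
proof (induction \<omega>s)
  case Nil
  then show ?case by (intro exI[of _ 1]) simp
next
  case (Cons \<omega> \<omega>s)
  then obtain c where c: "c \<noteq> 0" "prod_gens \<omega>s = cscale c (basis_vec (fset_of_list \<omega>s))" by auto
  have "ext_mult \<omega> (basis_vec (fset_of_list \<omega>s)) =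
      cscale (esgn \<omega> (fset_of_list \<omega>s)) (basis_vec (fset_of_list (\<omega> # \<omega>s)))"
    using Cons.prems by (simp add: ext_mult_basis_vec fset_of_list_elem)
  then show ?case using c
    by (intro exI[of _ "c * esgn \<omega> (fset_of_list \<omega>s)"]) (simp add: ext_simps)
qed

section \<open>The monomials occurring in \<open>F_part\<close>\<close>

definition picks :: "nat set \<Rightarrow> fgen fset \<Rightarrow> nat \<Rightarrow> nat \<Rightarrow> bool" where
  "picks B S i j \<longleftrightarrow> i \<in> B \<and> j \<in> B \<and> (card B > 1 \<longrightarrow> i \<noteq> j) \<and>
     (\<forall>l\<in>B. (Xi l |\<in>| S \<longleftrightarrow> l = i) \<and> (Theta l |\<notin>| S \<longleftrightarrow> l = j))"

text \<open>Outside the blocks treated so far the monomial must agree with theta_1 ... theta_n. This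
  lets \<open>Q\<close> be any family of disjoint blocks, as the induction over blocks
  requires.\<close>

definition F_monomial :: "nat \<Rightarrow> nat set set \<Rightarrow> fgen fset \<Rightarrow> bool" where
  "F_monomial n Q S \<longleftrightarrow> (\<forall>B\<in>Q. \<exists>i j. picks B S i j) \<and>
     (\<forall>l. l \<notin> \<Union>Q \<longrightarrow> Xi l |\<notin>| S \<and> (Theta l |\<in>| S \<longleftrightarrow> l \<in> {1..n}))"

lemma lookup_xi_dtheta:
  "Poly_Mapping.lookup (ext_mult (Xi i) (contract (Theta j) y)) S =
     (if Xi i |\<in>| S \<and> Theta j |\<notin>| S
      then esgn (Xi i) S * (esgn (Theta j) (S |-| {|Xi i|}) * Poly_Mapping.lookup y (finsert (Theta j) (S |-| {|Xi i|})))
      else 0)"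
  by (auto simp: lookup_ext_mult lookup_contract)

text \<open>No cancellation occurs: \<open>S\<close> determines the pair chosen in each block, so at
  most one term of the sum for \<open>rho B\<close> contributes to its coefficient.\<close>

lemma lookup_F_part_nonzero:
  assumes "finite Q" "disjoint Q" "\<And>B. B \<in> Q \<Longrightarrow> finite B \<and> B \<noteq> {}" "\<Union>Q \<subseteq> {1..n}"
  shows "Poly_Mapping.lookup (F_part n Q) S \<noteq> 0 \<longleftrightarrow> F_monomial n Q S"
  using assms
proof (induction Q arbitrary: S rule: finite_induct)
  case empty
  have "distinct (map Theta [1..<Suc n])" by (simp add: distinct_map inj_on_def)
  then obtain c where c: "c \<noteq> 0" "theta_top n = cscale c (basis_vec (fset_of_list (map Theta [1..<Suc n])))"
    using prod_gens_distinct by blast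
  have mem: "\<omega> |\<in>| fset_of_list (map Theta [1..<Suc n]) \<longleftrightarrow> \<omega> \<in> Theta ` {1..n}" for \<omega>
    by (auto simp: fset_of_list_elem)
  have "fset_of_list (map Theta [1..<Suc n]) = S \<longleftrightarrow> F_monomial n {} S"
  proof
    assume "fset_of_list (map Theta [1..<Suc n]) = S"
    then show "F_monomial n {} S" using mem by (auto simp: F_monomial_def)
  next
    assume *: "F_monomial n {} S"
    have S: "Xi l |\<notin>| S" "Theta l |\<in>| S \<longleftrightarrow> l \<in> {1..n}" for l
      using *[unfolded F_monomial_def] by blast+
    have "\<omega> |\<in>| S \<longleftrightarrow> \<omega> \<in> Theta ` {1..n}" for \<omega>
    proof (cases \<omega>)
      case (Theta l)
      show ?thesis unfolding Theta S(2) by auto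
    next
      case (Xi l)
      then show ?thesis using S(1)[of l] by auto
    qed
    then show "fset_of_list (map Theta [1..<Suc n]) = S" by (intro fset_eqI) (simp only: mem)
  qed
  then show ?case using c by (simp add: lookup_cscale lookup_single when_def del: upt_Suc)
next
  case (insert B Q)
  have dQ: "disjoint Q" using insert.prems(1) by (auto simp: disjoint_def)
  note IH = insert.IH[OF dQ]
  have IH: "Poly_Mapping.lookup (F_part n Q) S \<noteq> 0 \<longleftrightarrow> F_monomial n Q S" for S
    using insert.prems by (intro IH) auto
  have BQ: "B \<inter> \<Union>Q = {}"
    using insert.prems(1) insert.hyps(2) by (auto simp: disjoint_def)
  have B: "finite B" "B \<noteq> {}" "B \<subseteq> {1..n}" using insert.prems by auto
  have pairs: "(i, j) \<in> rho_pairs B \<longleftrightarrow> i \<in> B \<and> j \<in> B \<and> (card B > 1 \<longrightarrow> i \<noteq> j)" for i j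
  proof (cases "card B > 1")
    case False
    then have "card B = 1" using B card_gt_0_iff[of B] by linarith
    then obtain b where "B = {b}" by (rule card_1_singletonE)
    then show ?thesis by (auto simp: rho_pairs_def)
  qed (auto simp: rho_pairs_def)
  have finp: "finite (rho_pairs B)" using B by (simp add: rho_pairs_def)
  let ?t = "\<lambda>i j. Poly_Mapping.lookup (ext_mult (Xi i) (contract (Theta j) (F_part n Q))) S"
  have t: "?t i j \<noteq> 0 \<longleftrightarrow> Xi i |\<in>| S \<and> Theta j |\<notin>| S \<and> F_monomial n Q (finsert (Theta j) (S |-| {|Xi i|}))" for i j
    unfolding lookup_xi_dtheta by (simp flip: IH)
  have Q: "picks C (finsert (Theta j) (S |-| {|Xi i|})) = picks C S" if "C \<in> Q" "i \<in> B" "j \<in> B" for C i j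
  proof -
    have "i \<notin> C" "j \<notin> C" using that BQ by auto
    then show ?thesis by (auto simp: picks_def fun_eq_iff)
  qed
  have t_iff: "?t i j \<noteq> 0 \<longleftrightarrow> picks B S i j \<and> (\<forall>C\<in>Q. \<exists>i j. picks C S i j) \<and>
       (\<forall>l. l \<notin> \<Union>(insert B Q) \<longrightarrow> Xi l |\<notin>| S \<and> (Theta l |\<in>| S \<longleftrightarrow> l \<in> {1..n}))"
    if "(i, j) \<in> rho_pairs B" for i j
  proof -
    have ij: "i \<in> B" "j \<in> B" "card B > 1 \<longrightarrow> i \<noteq> j" using that pairs by auto
    have 1: "(\<forall>C\<in>Q. \<exists>k l. picks C (finsert (Theta j) (S |-| {|Xi i|})) k l) \<longleftrightarrow> (\<forall>C\<in>Q. \<exists>k l. picks C S k l)"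
      using Q[OF _ ij(1,2)] by simp
    have 2: "Xi i |\<in>| S \<and> Theta j |\<notin>| S \<and>
        (\<forall>l. l \<notin> \<Union>Q \<longrightarrow> Xi l |\<notin>| finsert (Theta j) (S |-| {|Xi i|}) \<and>
             (Theta l |\<in>| finsert (Theta j) (S |-| {|Xi i|}) \<longleftrightarrow> l \<in> {1..n})) \<longleftrightarrow>
      picks B S i j \<and> (\<forall>l. l \<notin> \<Union>(insert B Q) \<longrightarrow> Xi l |\<notin>| S \<and> (Theta l |\<in>| S \<longleftrightarrow> l \<in> {1..n}))" (is "?L \<longleftrightarrow> ?R")
    proof
      assume L: ?L
      have "picks B S i j" unfolding picks_def
      proof (intro conjI ballI ij)
        fix l assume l: "l \<in> B"
        then have "l \<notin> \<Union>Q" "l \<in> {1..n}" using BQ B by auto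
        then have "Xi l |\<notin>| finsert (Theta j) (S |-| {|Xi i|})" "Theta l |\<in>| finsert (Theta j) (S |-| {|Xi i|})"
          using L by blast+
        then show "Xi l |\<in>| S \<longleftrightarrow> l = i" "Theta l |\<notin>| S \<longleftrightarrow> l = j" using L by auto
      qed
      moreover have "Xi l |\<notin>| S \<and> (Theta l |\<in>| S \<longleftrightarrow> l \<in> {1..n})" if "l \<notin> \<Union>(insert B Q)" for l
      proof -
        have "l \<noteq> i" "l \<noteq> j" "l \<notin> \<Union>Q" using that ij by auto
        then show ?thesis using L by auto
      qed
      ultimately show ?R by blast
    next
      assume R: ?R
      have "Xi l |\<notin>| finsert (Theta j) (S |-| {|Xi i|}) \<and>
             (Theta l |\<in>| finsert (Theta j) (S |-| {|Xi i|}) \<longleftrightarrow> l \<in> {1..n})" if "l \<notin> \<Union>Q" for l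
      proof (cases "l \<in> B")
        case True
        then have "(Xi l |\<in>| S \<longleftrightarrow> l = i)" "(Theta l |\<notin>| S \<longleftrightarrow> l = j)" "l \<in> {1..n}"
          using R B by (auto simp: picks_def)
        then show ?thesis by auto
      next
        case False
        then have "Xi l |\<notin>| S" "Theta l |\<in>| S \<longleftrightarrow> l \<in> {1..n}" "l \<noteq> i" "l \<noteq> j" using R that ij by auto
        then show ?thesis by auto
      qed
      then show ?L using R ij by (auto simp: picks_def)
    qed
    show ?thesis unfolding t F_monomial_def 1 using 2 by blast
  qed
  have sum: "Poly_Mapping.lookup (F_part n (insert B Q)) S = (\<Sum>(i, j)\<in>rho_pairs B. ?t i j)"
    using insert.hyps by (simp add: F_part_insert rho_eq_sum lookup_sum case_prod_unfold)
  have F: "F_monomial n (insert B Q) S \<longleftrightarrow> (\<exists>i j. (i, j) \<in> rho_pairs B \<and> ?t i j \<noteq> 0)"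
  proof
    assume *: "F_monomial n (insert B Q) S"
    then obtain i j where "picks B S i j" unfolding F_monomial_def by blast
    moreover then have "(i, j) \<in> rho_pairs B" by (simp add: pairs picks_def)
    ultimately show "\<exists>i j. (i, j) \<in> rho_pairs B \<and> ?t i j \<noteq> 0"
      using * t_iff[of i j] unfolding F_monomial_def by blast
  next
    assume "\<exists>i j. (i, j) \<in> rho_pairs B \<and> ?t i j \<noteq> 0"
    then show "F_monomial n (insert B Q) S" using t_iff unfolding F_monomial_def by blast
  qed
  show ?case
  proof
    assume "Poly_Mapping.lookup (F_part n (insert B Q)) S \<noteq> 0"
    then obtain p where "p \<in> rho_pairs B" "(case p of (i, j) \<Rightarrow> ?t i j) \<noteq> 0"
      unfolding sum by (metis (no_types, lifting) sum.neutral)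
    then show "F_monomial n (insert B Q) S" unfolding F by (cases p) auto
  next
    assume "F_monomial n (insert B Q) S"
    then obtain i j where ij: "(i, j) \<in> rho_pairs B" "?t i j \<noteq> 0" unfolding F by blast
    have "?t k l = 0" if "(k, l) \<in> rho_pairs B - {(i, j)}" for k l
    proof (rule ccontr)
      assume "?t k l \<noteq> 0"
      then have "picks B S k l" "picks B S i j" using t_iff that ij by auto
      then have "k = i" "l = j" unfolding picks_def by auto
      then show False using that by simp
    qed
    then have "(\<Sum>(i, j)\<in>rho_pairs B - {(i, j)}. ?t i j) = 0" by (intro sum.neutral) auto
    then have "(\<Sum>(i, j)\<in>rho_pairs B. ?t i j) = ?t i j"
      using sum.remove[OF finp ij(1), of "\<lambda>(i, j). ?t i j"] by simp
    then show "Poly_Mapping.lookup (F_part n (insert B Q)) S \<noteq> 0" unfolding sum using ij by simp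
  qed
qed

lemma SP_facts:
  assumes "\<pi> \<in> SP n"
  shows "finite \<pi>" "disjoint \<pi>" "\<Union>\<pi> = {1..n}" "\<And>B. B \<in> \<pi> \<Longrightarrow> finite B \<and> B \<noteq> {}"
    "\<And>B. B \<in> \<pi> \<Longrightarrow> B \<subseteq> {1..n}"
proof -
  have p: "partition_on {1..n} \<pi>" using assms by (simp add: SP_def)
  show "finite \<pi>" using finite_elements[OF _ p] by simp
  show "disjoint \<pi>" "\<Union>\<pi> = {1..n}" using p by (auto simp: partition_on_def)
  then show sub: "B \<subseteq> {1..n}" if "B \<in> \<pi>" for B using that by blast
  show "finite B \<and> B \<noteq> {}" if "B \<in> \<pi>" for B
    using sub[OF that] that p finite_subset[of B "{1..n}"] by (auto simp: partition_on_def)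
qed

lemma keys_F_part:
  assumes "\<pi> \<in> SP n"
  shows "S \<in> Poly_Mapping.keys (F_part n \<pi>) \<longleftrightarrow> F_monomial n \<pi> S"
  using lookup_F_part_nonzero[of \<pi> n S] SP_facts[OF assms] by (simp add: in_keys_iff)

section \<open>Weights and leading monomials\<close>

fun gen_index :: "fgen \<Rightarrow> nat" where
  "gen_index (Theta i) = i"
| "gen_index (Xi i) = i"

text \<open>The index of a deleted theta is missing from the sum, so weight is lowered both by a
  small xi index and by a large deleted index; hence the pairing of \<open>Min\<close> with
  \<open>Max\<close> in \<open>leading\<close>.\<close>

definition weight :: "fgen fset \<Rightarrow> int" where
  "weight S = (\<Sum>\<omega>\<in>fset S. int (gen_index \<omega>))"

definition transversal_monomial :: "nat \<Rightarrow> nat set set \<Rightarrow> (nat set \<Rightarrow> nat) \<Rightarrow> (nat set \<Rightarrow> nat) \<Rightarrow> fgen fset" where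
  "transversal_monomial n \<pi> p q = Abs_fset (Xi ` p ` \<pi> \<union> Theta ` ({1..n} - q ` \<pi>))"

definition leading :: "nat \<Rightarrow> nat set set \<Rightarrow> fgen fset" where
  "leading n \<pi> = transversal_monomial n \<pi> Min Max"

lemma fset_transversal_monomial:
  "finite \<pi> \<Longrightarrow> fset (transversal_monomial n \<pi> p q) = Xi ` p ` \<pi> \<union> Theta ` ({1..n} - q ` \<pi>)"
  unfolding transversal_monomial_def by (rule Abs_fset_inverse) simp

lemma inj_on_transversal:
  assumes "disjoint \<pi>" "\<And>B. B \<in> \<pi> \<Longrightarrow> p B \<in> B"
  shows "inj_on p \<pi>"
  using assms by (metis IntI disjointD empty_iff inj_onI)

lemma transversal_image_iff:
  assumes "disjoint \<pi>" "\<And>B. B \<in> \<pi> \<Longrightarrow> p B \<in> B" "B \<in> \<pi>" "l \<in> B"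
  shows "l \<in> p ` \<pi> \<longleftrightarrow> l = p B"
proof
  assume "l \<in> p ` \<pi>"
  then obtain C where C: "C \<in> \<pi>" "l = p C" by blast
  then have "l \<in> C" using assms(2) by blast
  then have "C = B" using disjointD[OF assms(1) C(1) assms(3)] assms(4) by blast
  then show "l = p B" using C by simp
qed (use assms(3) in blast)

lemma weight_transversal_monomial:
  assumes \<pi>: "\<pi> \<in> SP n" and p: "\<And>B. B \<in> \<pi> \<Longrightarrow> p B \<in> B" and q: "\<And>B. B \<in> \<pi> \<Longrightarrow> q B \<in> B"
  shows "weight (transversal_monomial n \<pi> p q) = (\<Sum>B\<in>\<pi>. int (p B)) + (\<Sum>i\<in>{1..n}. int i) - (\<Sum>B\<in>\<pi>. int (q B))"
proof -
  note f = SP_facts[OF \<pi>]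
  have q_sub: "q ` \<pi> \<subseteq> {1..n}" using q f(5) by blast
  have "weight (transversal_monomial n \<pi> p q) =
      (\<Sum>\<omega>\<in>Xi ` p ` \<pi>. int (gen_index \<omega>)) + (\<Sum>\<omega>\<in>Theta ` ({1..n} - q ` \<pi>). int (gen_index \<omega>))"
    unfolding weight_def fset_transversal_monomial[OF f(1)] using f(1)
    by (intro sum.union_disjoint) auto
  also have "(\<Sum>\<omega>\<in>Xi ` p ` \<pi>. int (gen_index \<omega>)) = (\<Sum>B\<in>\<pi>. int (p B))"
    using inj_on_transversal[OF f(2) p] by (simp add: sum.reindex inj_on_def)
  also have "(\<Sum>\<omega>\<in>Theta ` ({1..n} - q ` \<pi>). int (gen_index \<omega>)) = (\<Sum>i\<in>{1..n} - q ` \<pi>. int i)"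
    by (simp add: sum.reindex inj_on_def)
  also have "\<dots> = (\<Sum>i\<in>{1..n}. int i) - (\<Sum>i\<in>q ` \<pi>. int i)"
    using q_sub by (intro sum_diff) auto
  also have "(\<Sum>i\<in>q ` \<pi>. int i) = (\<Sum>B\<in>\<pi>. int (q B))"
    using inj_on_transversal[OF f(2) q] by (simp add: sum.reindex)
  finally show ?thesis by simp
qed

lemma transversal_monomial_cong:
  "(\<And>B. B \<in> \<pi> \<Longrightarrow> p B = p' B \<and> q B = q' B) \<Longrightarrow> transversal_monomial n \<pi> p q = transversal_monomial n \<pi> p' q'"
  unfolding transversal_monomial_def by (simp cong: image_cong)

lemma F_monomial_transversal:
  assumes \<pi>: "\<pi> \<in> SP n" and S: "F_monomial n \<pi> S"
  obtains p q where "S = transversal_monomial n \<pi> p q"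
    "\<And>B. B \<in> \<pi> \<Longrightarrow> p B \<in> B" "\<And>B. B \<in> \<pi> \<Longrightarrow> q B \<in> B"
proof -
  note f = SP_facts[OF \<pi>]
  have "\<forall>B\<in>\<pi>. \<exists>ij. picks B S (fst ij) (snd ij)" using S by (auto simp: F_monomial_def)
  then obtain r where r: "\<And>B. B \<in> \<pi> \<Longrightarrow> picks B S (fst (r B)) (snd (r B))" by metis
  define p q where "p = fst \<circ> r" and "q = snd \<circ> r"
  have pq: "picks B S (p B) (q B)" if "B \<in> \<pi>" for B using r that by (simp add: p_def q_def)
  have p: "p B \<in> B" and q: "q B \<in> B" if "B \<in> \<pi>" for B using pq[OF that] by (auto simp: picks_def)
  have out: "Xi l |\<notin>| S" "Theta l |\<notin>| S" if "l \<notin> {1..n}" for l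
    using S that f(3) unfolding F_monomial_def by blast+
  have X: "Xi l |\<in>| S \<longleftrightarrow> l \<in> p ` \<pi>" and T: "Theta l |\<in>| S \<longleftrightarrow> l \<in> {1..n} - q ` \<pi>" for l
  proof -
    have in_blocks: "l \<in> {1..n} \<and> (Xi l |\<in>| S \<longleftrightarrow> l \<in> p ` \<pi>) \<and> (Theta l |\<notin>| S \<longleftrightarrow> l \<in> q ` \<pi>)" if "B \<in> \<pi>" "l \<in> B" for B
    proof -
      have "l \<in> p ` \<pi> \<longleftrightarrow> l = p B" "l \<in> q ` \<pi> \<longleftrightarrow> l = q B"
        using transversal_image_iff[OF f(2) _ that] p q by blast+
      then show ?thesis using pq[OF that(1)] that f(5)[OF that(1)] unfolding picks_def by blast
    qed
    have "l \<notin> p ` \<pi>" "l \<notin> q ` \<pi>" if "l \<notin> {1..n}" using p q that f(5) by blast+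
    then show "Xi l |\<in>| S \<longleftrightarrow> l \<in> p ` \<pi>" "Theta l |\<in>| S \<longleftrightarrow> l \<in> {1..n} - q ` \<pi>"
      using in_blocks out[of l] f(3) by (metis DiffE DiffI UnionE)+
  qed
  have "S = transversal_monomial n \<pi> p q"
  proof (rule fset_eqI)
    fix \<omega>
    have "\<omega> |\<in>| S \<longleftrightarrow> \<omega> \<in> Xi ` p ` \<pi> \<union> Theta ` ({1..n} - q ` \<pi>)"
      using X T by (cases \<omega>) (auto simp: image_iff)
    then show "\<omega> |\<in>| S \<longleftrightarrow> \<omega> |\<in>| transversal_monomial n \<pi> p q"
      using fset_transversal_monomial[OF f(1), of n p q] by simp
  qed
  then show ?thesis using that p q by blast
qed

text \<open>The excess of weight over the leading monomial is a sum of nonnegative contributions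
  \<open>?d B\<close> of the blocks; it vanishes only if every choice is extreme.\<close>

lemma weight_leading_le:
  assumes \<pi>: "\<pi> \<in> SP n" and S: "F_monomial n \<pi> S"
  shows "weight (leading n \<pi>) \<le> weight S" "weight S = weight (leading n \<pi>) \<Longrightarrow> S = leading n \<pi>"
proof -
  note f = SP_facts[OF \<pi>]
  obtain p q where pq: "S = transversal_monomial n \<pi> p q"
    "\<And>B. B \<in> \<pi> \<Longrightarrow> p B \<in> B" "\<And>B. B \<in> \<pi> \<Longrightarrow> q B \<in> B"
    using F_monomial_transversal[OF assms] by blast
  let ?d = "\<lambda>B. (int (p B) - int (Min B)) + (int (Max B) - int (q B))"
  have le: "Min B \<le> p B" "q B \<le> Max B" if "B \<in> \<pi>" for B using f(4) pq that by simp_all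
  then have nonneg: "0 \<le> ?d B" if "B \<in> \<pi>" for B using that by fastforce
  have diff: "weight S - weight (leading n \<pi>) = (\<Sum>B\<in>\<pi>. ?d B)"
    unfolding pq(1) leading_def using pq(2,3) f(4)
    by (simp add: weight_transversal_monomial[OF \<pi>] sum.distrib sum_subtractf)
  then show "weight (leading n \<pi>) \<le> weight S" using sum_nonneg[of \<pi> ?d] nonneg by simp
  assume "weight S = weight (leading n \<pi>)"
  then have "(\<Sum>B\<in>\<pi>. ?d B) = 0" using diff by simp
  then have "?d B = 0" if "B \<in> \<pi>" for B
    using sum_nonneg_eq_0_iff[OF f(1), of ?d] nonneg that by blast
  then have "p B = Min B \<and> q B = Max B" if "B \<in> \<pi>" for B using le that by force
  then show "S = leading n \<pi>" unfolding pq(1) leading_def by (rule transversal_monomial_cong)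
qed

lemma leading_monomial:
  assumes \<pi>: "\<pi> \<in> SP n"
  shows "F_monomial n \<pi> (leading n \<pi>)"
proof -
  note f = SP_facts[OF \<pi>]
  have fs: "fset (leading n \<pi>) = Xi ` Min ` \<pi> \<union> Theta ` ({1..n} - Max ` \<pi>)"
    unfolding leading_def by (rule fset_transversal_monomial[OF f(1)])
  have X: "Xi l |\<in>| leading n \<pi> \<longleftrightarrow> l \<in> Min ` \<pi>" and T: "Theta l |\<in>| leading n \<pi> \<longleftrightarrow> l \<in> {1..n} - Max ` \<pi>" for l
    using fs by auto
  have mm: "Min B \<in> B" "Max B \<in> B" if "B \<in> \<pi>" for B using f(4) that by auto
  show ?thesis unfolding F_monomial_def
  proof (intro conjI ballI allI impI)
    fix B assume B: "B \<in> \<pi>"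
    have "Min B \<noteq> Max B" if "card B > 1"
    proof
      assume eq: "Min B = Max B"
      have "x = Max B" if "x \<in> B" for x
      proof (rule antisym)
        have fB: "finite B" using f(4)[OF B] by blast
        show "x \<le> Max B" using Max_ge[OF fB that] .
        show "Max B \<le> x" unfolding eq[symmetric] using Min_le[OF fB that] .
      qed
      then have "B \<subseteq> {Max B}" by blast
      then have "card B \<le> 1" using card_mono[of "{Max B}" B] by simp
      then show False using \<open>card B > 1\<close> by simp
    qed
    moreover have "(Xi l |\<in>| leading n \<pi> \<longleftrightarrow> l = Min B) \<and> (Theta l |\<notin>| leading n \<pi> \<longleftrightarrow> l = Max B)" if l: "l \<in> B" for l
    proof -
      have "l \<in> Min ` \<pi> \<longleftrightarrow> l = Min B" "l \<in> Max ` \<pi> \<longleftrightarrow> l = Max B"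
        using transversal_image_iff[OF f(2) _ B l] mm by blast+
      then show ?thesis using X T f(5)[OF B] l by blast
    qed
    ultimately have "picks B (leading n \<pi>) (Min B) (Max B)" using mm[OF B] by (simp add: picks_def)
    then show "\<exists>i j. picks B (leading n \<pi>) i j" by blast
  next
    fix l assume l: "l \<notin> \<Union>\<pi>"
    then have "l \<notin> {1..n}" "l \<notin> Min ` \<pi>" using f(3) mm(1) by blast+
    then show "Xi l |\<notin>| leading n \<pi>" "Theta l |\<in>| leading n \<pi> \<longleftrightarrow> l \<in> {1..n}" using X T by auto
  qed
qed

section \<open>Recovering a noncrossing partition from its minima and maxima\<close>

text \<open>Partitions are compared through their equivalence relations because these can be
  restricted to the elements below \<open>x\<close>, which is what the induction from left to right
  uses.\<close>

definition same_block :: "nat set set \<Rightarrow> nat \<Rightarrow> nat \<Rightarrow> bool" where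
  "same_block \<pi> x y \<longleftrightarrow> (\<exists>B\<in>\<pi>. x \<in> B \<and> y \<in> B)"

text \<open>If the predecessor \<open>p'\<close> of \<open>x\<close> in its block of \<open>\<pi>'\<close> exceeded the predecessor \<open>p\<close> in \<open>\<pi>\<close>, the
  block of \<open>p'\<close> in \<open>\<pi>\<close> would continue beyond \<open>x\<close>, as \<open>p'\<close> is not a maximum, and cross that of \<open>p\<close>.\<close>
lemma noncrossing_predecessor_le:
  assumes \<pi>: "\<pi> \<in> NC n" and \<pi>': "\<pi>' \<in> NC n" and max: "Max ` \<pi> = Max ` \<pi>'"
    and IH: "\<And>y z. y < x \<Longrightarrow> z < x \<Longrightarrow> same_block \<pi> y z \<longleftrightarrow> same_block \<pi>' y z"
    and p: "p < x" "same_block \<pi> p x" "\<And>y. p < y \<Longrightarrow> y < x \<Longrightarrow> \<not> same_block \<pi> y x"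
    and p': "p' < x" "same_block \<pi>' p' x" "\<And>y. p' < y \<Longrightarrow> y < x \<Longrightarrow> \<not> same_block \<pi>' y x"
  shows "p' \<le> p"
proof (rule ccontr)
  assume less: "\<not> p' \<le> p"
  have SP: "\<pi> \<in> SP n" "\<pi>' \<in> SP n" "noncrossing \<pi>" using \<pi> \<pi>' by (auto simp: NC_def)
  note f = SP_facts[OF SP(1)] and f' = SP_facts[OF SP(2)]
  have trans: "same_block \<rho> a b \<Longrightarrow> same_block \<rho> b c \<Longrightarrow> same_block \<rho> a c" if "disjoint \<rho>" for \<rho> a b c
    using that unfolding same_block_def disjoint_def by blast
  obtain B' where B': "B' \<in> \<pi>'" "p' \<in> B'" "x \<in> B'" using p'(2) by (auto simp: same_block_def)
  have "p' \<notin> Max ` \<pi>'"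
  proof
    assume "p' \<in> Max ` \<pi>'"
    then obtain C where C: "C \<in> \<pi>'" "p' = Max C" by blast
    then have "p' \<in> C" using f'(4) by auto
    then have "C = B'" using C B' f'(2) by (auto simp: disjoint_def)
    then have "x \<le> p'" using C B' f'(4) by auto
    then show False using p' by simp
  qed
  then have nmax: "p' \<notin> Max ` \<pi>" using max by simp
  have "p' \<in> {1..n}" using B' f'(5) by blast
  then obtain C where C: "C \<in> \<pi>" "p' \<in> C" using f(3) by blast
  have "p' \<noteq> Max C" using nmax C by auto
  moreover have "p' \<le> Max C" using f(4)[OF C(1)] C(2) by (intro Max_ge) auto
  ultimately have "p' < Max C" by simp
  define z where "z = Max C"
  have z: "p' < z" "z \<in> C" using \<open>p' < Max C\<close> f(4)[OF C(1)] by (auto simp: z_def)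
  obtain B where B: "B \<in> \<pi>" "p \<in> B" "x \<in> B" using p(2) by (auto simp: same_block_def)
  have "C \<noteq> B" using p(3)[of p'] less p'(1) C B by (auto simp: same_block_def)
  \<comment> \<open>If \<open>z < x\<close>, the hypothesis on smaller elements puts
    \<open>z\<close> into the block of \<open>x\<close> in \<pi>', between \<open>p'\<close> and
    \<open>x\<close>. If \<open>z = x\<close>, two blocks of \<pi> meet. If \<open>x < z\<close>,
    the pairs \<open>p, x\<close> and \<open>p', z\<close> cross.\<close>
  consider "z < x" | "z = x" | "x < z" by linarith
  then show False
  proof cases
    case 1
    have "same_block \<pi> z p'" using z C by (auto simp: same_block_def)
    then have "same_block \<pi>' z p'" using IH 1 p'(1) by blast
    then have "same_block \<pi>' z x" using trans[OF f'(2)] p'(2) by blast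
    then show False using p'(3)[OF z(1) 1] by simp
  next
    case 2
    then show False using \<open>C \<noteq> B\<close> B z C f(2) by (auto simp: disjoint_def)
  next
    case 3
    then show False using SP(3) B C z less p'(1) \<open>C \<noteq> B\<close> unfolding noncrossing_def
      by (metis not_le_imp_less)
  qed
qed

lemma predecessor_exists:
  assumes "y < x" "same_block \<pi> y x"
  obtains p where "p < x" "same_block \<pi> p x" "\<And>z. p < z \<Longrightarrow> z < x \<Longrightarrow> \<not> same_block \<pi> z x"
proof -
  let ?P = "{y. y < x \<and> same_block \<pi> y x}"
  have fin: "finite ?P" by simp
  have "?P \<noteq> {}" using assms by blast
  then have "Max ?P \<in> ?P" using fin by (rule Max_in[rotated])
  moreover have "z \<le> Max ?P" if "z \<in> ?P" for z using that fin by simp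
  ultimately show ?thesis
    by (intro that[of "Max ?P"]) (blast, blast, metis (mono_tags, lifting) leD mem_Collect_eq)
qed

text \<open>Since \<open>x\<close> is no minimum in \<pi>, it is none in \<pi>', so it continues a
  block there too. The comparison of predecessors, applied in both directions, shows that it has the
  same predecessor in both.\<close>

lemma noncrossing_same_block:
  assumes \<pi>: "\<pi> \<in> NC n" and \<pi>': "\<pi>' \<in> NC n" and min: "Min ` \<pi> = Min ` \<pi>'" and max: "Max ` \<pi> = Max ` \<pi>'"
    and y: "y < x" "same_block \<pi> y x"
    and IH: "\<And>y z. y < x \<Longrightarrow> z < x \<Longrightarrow> same_block \<pi> y z \<longleftrightarrow> same_block \<pi>' y z"
  shows "same_block \<pi>' y x"
proof -
  have SP: "\<pi> \<in> SP n" "\<pi>' \<in> SP n" using \<pi> \<pi>' by (auto simp: NC_def)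
  note f = SP_facts[OF SP(1)] and f' = SP_facts[OF SP(2)]
  have trans: "same_block \<rho> a b \<Longrightarrow> same_block \<rho> b c \<Longrightarrow> same_block \<rho> a c" if "disjoint \<rho>" for \<rho> a b c
    using that unfolding same_block_def disjoint_def by blast
  have sym: "same_block \<rho> a b \<Longrightarrow> same_block \<rho> b a" for \<rho> a b by (auto simp: same_block_def)
  obtain B where B: "B \<in> \<pi>" "y \<in> B" "x \<in> B" using y by (auto simp: same_block_def)
  have "x \<notin> Min ` \<pi>"
  proof
    assume "x \<in> Min ` \<pi>"
    then obtain C where C: "C \<in> \<pi>" "x = Min C" by blast
    then have "x \<in> C" using f(4) by auto
    then have "C = B" using C B f(2) by (auto simp: disjoint_def)
    then have "x \<le> y" using C B f(4) by auto
    then show False using y by simp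
  qed
  then have nmin: "x \<notin> Min ` \<pi>'" using min by simp
  have "x \<in> {1..n}" using B f(5) by blast
  then obtain C where C: "C \<in> \<pi>'" "x \<in> C" using f'(3) by blast
  have "Min C \<noteq> x" using nmin C by auto
  moreover have "Min C \<le> x" using f'(4)[OF C(1)] C(2) by (intro Min_le) auto
  ultimately have "Min C < x" by simp
  have "Min C \<in> C" using f'(4)[OF C(1)] by simp
  then have "same_block \<pi>' (Min C) x" using C by (auto simp: same_block_def)
  then obtain p' where p': "p' < x" "same_block \<pi>' p' x" "\<And>z. p' < z \<Longrightarrow> z < x \<Longrightarrow> \<not> same_block \<pi>' z x"
    using predecessor_exists \<open>Min C < x\<close> by blast
  obtain p where p: "p < x" "same_block \<pi> p x" "\<And>z. p < z \<Longrightarrow> z < x \<Longrightarrow> \<not> same_block \<pi> z x"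
    using predecessor_exists[OF y] by blast
  have "p' \<le> p" by (rule noncrossing_predecessor_le[OF \<pi> \<pi>' max IH p p'])
  moreover have "p \<le> p'" using IH by (intro noncrossing_predecessor_le[OF \<pi>' \<pi> max[symmetric] _ p' p]) auto
  ultimately have "p' = p" by simp
  have "same_block \<pi> y p" using trans[OF f(2)] sym y p by blast
  then have "same_block \<pi>' y p" using IH y p by blast
  then show ?thesis using trans[OF f'(2)] p' \<open>p' = p\<close> by blast
qed

lemma noncrossing_eqI:
  assumes \<pi>: "\<pi> \<in> NC n" and \<pi>': "\<pi>' \<in> NC n" and min: "Min ` \<pi> = Min ` \<pi>'" and max: "Max ` \<pi> = Max ` \<pi>'"
  shows "\<pi> = \<pi>'"
proof -
  have SP: "\<pi> \<in> SP n" "\<pi>' \<in> SP n" using \<pi> \<pi>' by (auto simp: NC_def)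
  note f = SP_facts[OF SP(1)] and f' = SP_facts[OF SP(2)]
  have sym: "same_block \<rho> a b \<longleftrightarrow> same_block \<rho> b a" for \<rho> a b by (auto simp: same_block_def)
  have refl: "same_block \<pi> x x \<longleftrightarrow> same_block \<pi>' x x" for x
    using f(3) f'(3) unfolding same_block_def by blast
  have *: "\<forall>y<x. \<forall>z<x. same_block \<pi> y z \<longleftrightarrow> same_block \<pi>' y z" for x
  proof (induction x)
    case (Suc x)
    then have IH: "\<And>y z. y < x \<Longrightarrow> z < x \<Longrightarrow> same_block \<pi> y z \<longleftrightarrow> same_block \<pi>' y z" by blast
    have "same_block \<pi> y x \<longleftrightarrow> same_block \<pi>' y x" if "y < x" for y
      using noncrossing_same_block[OF \<pi> \<pi>' min max that] 
        noncrossing_same_block[OF \<pi>' \<pi> min[symmetric] max[symmetric] that] IH by blast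
    then show ?case using IH refl sym by (metis less_SucE)
  qed simp
  then have eq: "same_block \<pi> y z \<longleftrightarrow> same_block \<pi>' y z" for y z
    using *[of "Suc (y + z)", rule_format, of y z] by simp
  have block: "B = {y. same_block \<rho> x y}" if "disjoint \<rho>" "B \<in> \<rho>" "x \<in> B" for \<rho> B x
    using that unfolding same_block_def disjoint_def by blast
  have sub: "\<rho> \<subseteq> \<tau>" if H: "disjoint \<rho>" "disjoint \<tau>" "{} \<notin> \<rho>" "\<Union>\<rho> = \<Union>\<tau>" "\<And>y z. same_block \<rho> y z \<longleftrightarrow> same_block \<tau> y z" for \<rho> \<tau>
  proof
    fix B assume B: "B \<in> \<rho>"
    then obtain x where x: "x \<in> B" using H(3) by (metis ex_in_conv)
    then obtain C where C: "C \<in> \<tau>" "x \<in> C" using B H(4) by (metis UnionE UnionI)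
    have "B = C" unfolding block[OF H(1) B x] block[OF H(2) C] H(5) ..
    then show "B \<in> \<tau>" using C by simp
  qed
  have "{} \<notin> \<pi>" "{} \<notin> \<pi>'" using f(4) f'(4) by blast+
  then show ?thesis using f(2,3) f'(2,3) eq by (intro equalityI sub) simp_all
qed

lemma leading_inj:
  assumes \<pi>: "\<pi> \<in> NC n" and \<pi>': "\<pi>' \<in> NC n" and eq: "leading n \<pi> = leading n \<pi>'"
  shows "\<pi> = \<pi>'"
proof -
  have SP: "\<pi> \<in> SP n" "\<pi>' \<in> SP n" using \<pi> \<pi>' by (auto simp: NC_def)
  have fs: "fset (leading n \<rho>) = Xi ` Min ` \<rho> \<union> Theta ` ({1..n} - Max ` \<rho>)" if "\<rho> \<in> SP n" for \<rho>
    unfolding leading_def by (rule fset_transversal_monomial[OF SP_facts(1)[OF that]])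
  have sub: "Max ` \<rho> \<subseteq> {1..n}" if "\<rho> \<in> SP n" for \<rho>
    using SP_facts(4,5)[OF that] Max_in by blast
  have "Xi ` Min ` \<pi> \<union> Theta ` ({1..n} - Max ` \<pi>) = Xi ` Min ` \<pi>' \<union> Theta ` ({1..n} - Max ` \<pi>')"
    using fs SP eq by metis
  then have "Min ` \<pi> = Min ` \<pi>'" "{1..n} - Max ` \<pi> = {1..n} - Max ` \<pi>'" by blast+
  moreover from this(2) have "Max ` \<pi> = Max ` \<pi>'" using sub[OF SP(1)] sub[OF SP(2)] by blast
  ultimately show ?thesis using noncrossing_eqI[OF \<pi> \<pi>'] by blast
qed

text \<open>Triangularity. Take \<pi> in the support with leading monomial of least weight. If that
  monomial occurred in another \<open>F_part n \<nu>\<close>, minimality would make it the leading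
  monomial of \<nu> as well, and \<nu> would equal \<pi>.\<close>

lemma F_part_independent:
  assumes x: "x \<in> free_on (NC n)" and eq: "lin_ext (F_part n) x = 0"
  shows "x = 0"
proof (rule ccontr)
  assume "x \<noteq> 0"
  then have ne: "Poly_Mapping.keys x \<noteq> {}" by simp
  have "finite (Poly_Mapping.keys x)" by simp
  then obtain \<pi> where \<pi>: "\<pi> \<in> Poly_Mapping.keys x"
    and least: "\<And>\<nu>. \<nu> \<in> Poly_Mapping.keys x \<Longrightarrow> weight (leading n \<pi>) \<le> weight (leading n \<nu>)"
    using ne arg_min_if_finite[of "Poly_Mapping.keys x" "\<lambda>\<nu>. weight (leading n \<nu>)"] by (metis not_le)
  have NC: "\<nu> \<in> NC n" "\<nu> \<in> SP n" if "\<nu> \<in> Poly_Mapping.keys x" for \<nu>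
    using that x by (auto simp: free_on_def NC_def)
  let ?S = "leading n \<pi>"
  have zero: "Poly_Mapping.lookup (F_part n \<nu>) ?S = 0" if \<nu>: "\<nu> \<in> Poly_Mapping.keys x" "\<nu> \<noteq> \<pi>" for \<nu>
  proof (rule ccontr)
    assume "Poly_Mapping.lookup (F_part n \<nu>) ?S \<noteq> 0"
    then have "F_monomial n \<nu> ?S" using keys_F_part[OF NC(2)[OF \<nu>(1)]] by (simp add: in_keys_iff)
    then have "?S = leading n \<nu>" using weight_leading_le[OF NC(2)[OF \<nu>(1)]] least[OF \<nu>(1)] by (metis order_antisym)
    then show False using leading_inj NC \<nu> \<pi> by metis
  qed
  have "0 = Poly_Mapping.lookup (lin_ext (F_part n) x) ?S" using eq by simp
  also have "\<dots> = (\<Sum>\<nu>\<in>Poly_Mapping.keys x. Poly_Mapping.lookup x \<nu> * Poly_Mapping.lookup (F_part n \<nu>) ?S)"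
    by (simp add: lin_ext_def lookup_sum lookup_cscale)
  also have "\<dots> = Poly_Mapping.lookup x \<pi> * Poly_Mapping.lookup (F_part n \<pi>) ?S"
    using \<pi> zero by (subst sum.remove[OF _ \<pi>]) (auto intro!: sum.neutral)
  finally have "Poly_Mapping.lookup (F_part n \<pi>) ?S = 0" using \<pi> by (simp add: in_keys_iff)
  then show False
    using leading_monomial[OF NC(2)[OF \<pi>]] keys_F_part[OF NC(2)[OF \<pi>], of ?S] by (simp add: in_keys_iff)
qed

section \<open>Contraction with the sum of the \<open>\<xi>\<^sub>i\<close> is injective\<close>

text \<open>Hermitian, with conjugation in the first argument: a bilinear form would not be definite
  over the complex numbers.\<close>

definition ext_inner :: "ext \<Rightarrow> ext \<Rightarrow> complex" where
  "ext_inner x y = (\<Sum>S\<in>Poly_Mapping.keys x. cnj (Poly_Mapping.lookup x S) * Poly_Mapping.lookup y S)"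

lemma ext_inner_superset:
  assumes "finite K" "Poly_Mapping.keys x \<subseteq> K"
  shows "ext_inner x y = (\<Sum>S\<in>K. cnj (Poly_Mapping.lookup x S) * Poly_Mapping.lookup y S)"
  unfolding ext_inner_def using assms by (intro sum.mono_neutral_left) (auto simp: in_keys_iff)

lemma ext_inner_add_right: "ext_inner x (y + z) = ext_inner x y + ext_inner x z"
  by (simp add: ext_inner_def lookup_add ring_distribs sum.distrib)

lemma ext_inner_scale_right: "ext_inner x (cscale c y) = c * ext_inner x y"
  by (simp add: ext_inner_def lookup_cscale sum_distrib_left mult_ac)

lemma ext_inner_zero [simp]: "ext_inner x 0 = 0" "ext_inner 0 y = 0"
  by (simp_all add: ext_inner_def)

lemma ext_inner_diff_right: "ext_inner x (y - z) = ext_inner x y - ext_inner x z"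
  by (simp add: ext_inner_def lookup_minus ring_distribs sum_subtractf)

lemma ext_inner_sum_right: "ext_inner x (\<Sum>a\<in>A. f a) = (\<Sum>a\<in>A. ext_inner x (f a))"
  by (induction A rule: infinite_finite_induct) (simp_all add: ext_inner_add_right)

lemma ext_inner_add_left: "ext_inner (x + y) z = ext_inner x z + ext_inner y z"
proof -
  let ?K = "Poly_Mapping.keys x \<union> Poly_Mapping.keys y"
  show ?thesis using keys_add[of x y]
    by (simp add: ext_inner_superset[of ?K] lookup_add ring_distribs sum.distrib)
qed

lemma ext_inner_scale_left: "ext_inner (cscale c x) y = cnj c * ext_inner x y"
proof -
  have "Poly_Mapping.keys (cscale c x) \<subseteq> Poly_Mapping.keys x" by (auto simp: in_keys_iff lookup_cscale)
  then show ?thesis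
    by (simp add: ext_inner_superset[of "Poly_Mapping.keys x"] lookup_cscale sum_distrib_left mult_ac)
qed

lemma ext_inner_sum_left: "ext_inner (\<Sum>a\<in>A. f a) y = (\<Sum>a\<in>A. ext_inner (f a) y)"
  by (induction A rule: infinite_finite_induct) (simp_all add: ext_inner_add_left)

lemma ext_inner_self_eq_0:
  assumes "ext_inner x x = 0"
  shows "x = 0"
proof -
  have "ext_inner x x = of_real (\<Sum>S\<in>Poly_Mapping.keys x. (cmod (Poly_Mapping.lookup x S))\<^sup>2)"
    unfolding ext_inner_def of_real_sum
    by (intro sum.cong refl) (simp only: complex_norm_square mult.commute)
  then have "(\<Sum>S\<in>Poly_Mapping.keys x. (cmod (Poly_Mapping.lookup x S))\<^sup>2) = 0"
    using assms by (metis of_real_eq_0_iff)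
  then have "\<forall>S\<in>Poly_Mapping.keys x. Poly_Mapping.lookup x S = 0"
    by (subst (asm) sum_nonneg_eq_0_iff) auto
  then show ?thesis by (intro poly_mapping_eqI) (auto simp: in_keys_iff)
qed

lemma ext_inner_disjoint:
  assumes "\<And>S. S \<in> Poly_Mapping.keys x \<Longrightarrow> S \<notin> Poly_Mapping.keys y"
  shows "ext_inner x y = 0"
  unfolding ext_inner_def using assms by (intro sum.neutral) (auto simp: in_keys_iff)

lemma cnj_esgn: "cnj (esgn \<omega> S) = esgn \<omega> S"
  by (simp add: esgn_def)

text \<open>Removing \<omega> is a bijection from the monomials containing \<omega> onto those
  without it, and contraction and multiplication carry the same real sign along it.\<close>

lemma ext_inner_contract: "ext_inner (contract \<omega> x) y = ext_inner x (ext_mult \<omega> y)"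
proof -
  let ?K = "{S \<in> Poly_Mapping.keys x. \<omega> |\<in>| S}"
  let ?r = "\<lambda>S. S |-| {|\<omega>|}"
  have ins: "finsert \<omega> (?r S) = S" if "\<omega> |\<in>| S" for S using that by auto
  have inj: "inj_on ?r ?K" using ins by (metis (mono_tags, lifting) inj_onI mem_Collect_eq)
  have keys: "Poly_Mapping.keys (contract \<omega> x) \<subseteq> ?r ` ?K"
  proof
    fix T assume "T \<in> Poly_Mapping.keys (contract \<omega> x)"
    then have T: "\<omega> |\<notin>| T" "finsert \<omega> T \<in> Poly_Mapping.keys x"
      by (auto simp: in_keys_iff lookup_contract split: if_splits)
    then have "?r (finsert \<omega> T) = T" by auto
    then show "T \<in> ?r ` ?K" using T(2) by (intro image_eqI[of _ _ "finsert \<omega> T"]) auto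
  qed
  have "ext_inner (contract \<omega> x) y =
      (\<Sum>S\<in>?K. cnj (Poly_Mapping.lookup (contract \<omega> x) (?r S)) * Poly_Mapping.lookup y (?r S))"
    by (subst ext_inner_superset[OF _ keys]) (simp_all add: sum.reindex[OF inj])
  also have "\<dots> = (\<Sum>S\<in>?K. cnj (Poly_Mapping.lookup x S) * Poly_Mapping.lookup (ext_mult \<omega> y) S)"
    by (intro sum.cong refl) (auto simp: lookup_contract lookup_ext_mult finsert_absorb esgn_remove cnj_esgn)
  also have "\<dots> = ext_inner x (ext_mult \<omega> y)"
    unfolding ext_inner_def by (intro sum.mono_neutral_left) (auto simp: lookup_ext_mult)
  finally show ?thesis .
qed

lemma ext_inner_dxi: "ext_inner (dxi n x) y = ext_inner x (xi_sum {1..n} y)"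
  by (simp add: dxi_def xi_sum_def ext_inner_sum_left ext_inner_sum_right ext_inner_contract)

section \<open>The vectors \<open>G_part\<close> as multiples of the sum of the xi_i\<close>

definition full_op :: "nat set \<Rightarrow> ext \<Rightarrow> ext" where
  "full_op B x = xi_sum B (dtheta_sum B x)"

lemma clinear_full_op: "clinear (full_op B)"
  unfolding full_op_def[abs_def] by (intro clinear_comp[OF clinear_xi_sum clinear_dtheta_sum])

lemmas full_op_simps = clinear_simps[OF clinear_full_op]

lemma ext_eq_minus_self:
  assumes "(x::ext) = - x"
  shows "x = 0"
proof (rule poly_mapping_eqI)
  fix S
  have "Poly_Mapping.lookup x S = - Poly_Mapping.lookup x S" using assms by (metis lookup_uminus)
  then have "2 * Poly_Mapping.lookup x S = 0" unfolding mult_2 by (metis add.right_inverse)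
  then show "Poly_Mapping.lookup x S = Poly_Mapping.lookup 0 S" by simp
qed

lemma xi_sum_twice [simp]: "xi_sum B (xi_sum B x) = 0"
  by (rule ext_eq_minus_self) (rule xi_sum_anticommute)

lemma full_op_xi_sum: "full_op B (xi_sum C x) = xi_sum C (full_op B x)"
  unfolding full_op_def by (simp add: dtheta_xi_sum op_simps xi_sum_anticommute[of B C])

lemma full_op_dtheta_sum: "full_op B (dtheta_sum C x) = dtheta_sum C (full_op B x)"
  unfolding full_op_def by (simp add: dtheta_xi_sum op_simps dtheta_sum_anticommute[of B C])

lemma full_op_commute: "full_op B (full_op C x) = full_op C (full_op B x)"
  by (simp add: full_op_def[of C] full_op_xi_sum full_op_dtheta_sum)

interpretation full_op_fold: comp_fun_commute full_op
  by unfold_locales (simp add: fun_eq_iff full_op_commute)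

definition G_part :: "nat \<Rightarrow> nat set set \<Rightarrow> ext" where
  "G_part n Q = Finite_Set.fold full_op (theta_top n) Q"

lemma G_part_empty [simp]: "G_part n {} = theta_top n"
  by (simp add: G_part_def)

lemma G_part_insert: "finite Q \<Longrightarrow> B \<notin> Q \<Longrightarrow> G_part n (insert B Q) = full_op B (G_part n Q)"
  unfolding G_part_def by (rule full_op_fold.fold_insert)

lemma G_part_remove: "finite Q \<Longrightarrow> B \<in> Q \<Longrightarrow> G_part n Q = full_op B (G_part n (Q - {B}))"
  using G_part_insert[of "Q - {B}" B n] by (simp add: insert_absorb)

lemma xi_sum_G_part: "finite Q \<Longrightarrow> C \<in> Q \<Longrightarrow> xi_sum C (G_part n Q) = 0"
  by (simp add: G_part_remove[of Q C] full_op_def)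

lemma xi_sum_Union:
  assumes "finite \<pi>" "disjoint \<pi>" "\<And>B. B \<in> \<pi> \<Longrightarrow> finite B"
  shows "xi_sum (\<Union>\<pi>) x = (\<Sum>B\<in>\<pi>. xi_sum B x)"
  unfolding xi_sum_def using assms
  by (subst sum.Union_disjoint) (auto simp: disjoint_def)

text \<open>Split off one block \<open>B\<close>, which exists as \<open>0 < n\<close>, and take
  \<open>z = dtheta_sum B y\<close> with \<open>y\<close> the product over the other blocks. For
  another block \<open>C\<close>, \<open>xi_sum C\<close> anticommutes past
  \<open>dtheta_sum B\<close> and kills \<open>y\<close>, so enlarging \<open>xi_sum B\<close> to
  the sum over all indices changes nothing.\<close>

lemma G_part_eq_xi_sum:
  assumes \<pi>: "\<pi> \<in> SP n" and "0 < n"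
  obtains z where "G_part n \<pi> = xi_sum {1..n} z"
proof -
  note f = SP_facts[OF \<pi>]
  have "\<pi> \<noteq> {}" using f(3) \<open>0 < n\<close> by auto
  then obtain B where B: "B \<in> \<pi>" by blast
  define y where "y = G_part n (\<pi> - {B})"
  have "xi_sum {1..n} (dtheta_sum B y) = (\<Sum>C\<in>\<pi>. xi_sum C (dtheta_sum B y))"
    using xi_sum_Union[OF f(1,2)] f(3,4) by metis
  also have "\<dots> = xi_sum B (dtheta_sum B y) + (\<Sum>C\<in>\<pi> - {B}. xi_sum C (dtheta_sum B y))"
    using f(1) B by (rule sum.remove)
  also have "(\<Sum>C\<in>\<pi> - {B}. xi_sum C (dtheta_sum B y)) = 0"
  proof (intro sum.neutral ballI)
    fix C assume "C \<in> \<pi> - {B}"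
    then have "xi_sum C y = 0" unfolding y_def using f(1) by (intro xi_sum_G_part) auto
    then have "dtheta_sum B (xi_sum C y) = 0" by (simp add: op_simps)
    then show "xi_sum C (dtheta_sum B y) = 0" by (simp add: dtheta_xi_sum)
  qed
  also have "xi_sum B (dtheta_sum B y) + 0 = G_part n \<pi>"
    using G_part_remove[OF f(1) B] by (simp add: y_def full_op_def)
  finally show ?thesis using that by metis
qed

section \<open>Monomials in which an index is chosen twice\<close>

text \<open>Here some i with \<open>P i\<close> serves both as xi index and as deleted theta index.
  Multiplying by a xi or contracting with a theta cannot undo this, so the span of these monomials
  is stable under \<open>full_op\<close>.\<close>

definition doubled :: "(nat \<Rightarrow> bool) \<Rightarrow> fgen fset set" where
  "doubled P = {S. \<exists>i. P i \<and> Xi i |\<in>| S \<and> Theta i |\<notin>| S}"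

lemma doubled_ext_mult: "z \<in> free_on (doubled P) \<Longrightarrow> ext_mult (Xi k) z \<in> free_on (doubled P)"
  unfolding free_on_def doubled_def
  by (fastforce simp: in_keys_iff lookup_ext_mult split: if_splits)

lemma doubled_contract: "z \<in> free_on (doubled P) \<Longrightarrow> contract (Theta k) z \<in> free_on (doubled P)"
  unfolding free_on_def doubled_def
  by (fastforce simp: in_keys_iff lookup_contract split: if_splits)

lemma doubled_full_op:
  assumes "z \<in> free_on (doubled P)"
  shows "full_op B z \<in> free_on (doubled P)"
  unfolding full_op_def xi_sum_def dtheta_sum_def
  by (intro cvs.subspace_sum[OF subspace_free_on] doubled_ext_mult doubled_contract assms)

lemma doubled_xi_dtheta: "P i \<Longrightarrow> ext_mult (Xi i) (contract (Theta i) z) \<in> free_on (doubled P)"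
  unfolding free_on_def doubled_def
  by (fastforce simp: in_keys_iff lookup_ext_mult lookup_contract split: if_splits)

lemma full_op_diff_rho:
  assumes "finite B" "B \<noteq> {}" and P: "\<And>i. i \<in> B \<Longrightarrow> card B > 1 \<Longrightarrow> P i"
  shows "full_op B y - rho B y \<in> free_on (doubled P)"
proof (cases "card B > 1")
  case True
  then have "full_op B y - rho B y = (\<Sum>i\<in>B. ext_mult (Xi i) (contract (Theta i) y))"
    by (simp add: full_op_def rho_eq_pair_op pair_op_eq_sum)
  then show ?thesis using True P
    by (simp add: cvs.subspace_sum[OF subspace_free_on] doubled_xi_dtheta)
next
  case False
  then have "card B = 1" using assms card_gt_0_iff[of B] by linarith
  then obtain b where "B = {b}" by (rule card_1_singletonE)
  then have "full_op B y - rho B y = 0" by (simp add: full_op_def rho_singleton xi_sum_def dtheta_sum_def)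
  then show ?thesis by (simp add: cvs.subspace_0[OF subspace_free_on])
qed

text \<open>Replacing the operators one block at a time, each replacement contributes diagonal terms
  xi_i d/dtheta_i of a block with more than one element; on singletons \<open>full_op\<close> and
  \<open>rho\<close> agree.\<close>

lemma G_part_diff_F_part:
  assumes "finite Q" "\<And>B. B \<in> Q \<Longrightarrow> finite B \<and> B \<noteq> {}"
    and "\<And>B i. B \<in> Q \<Longrightarrow> i \<in> B \<Longrightarrow> card B > 1 \<Longrightarrow> P i"
  shows "G_part n Q - F_part n Q \<in> free_on (doubled P)"
  using assms
proof (induction Q rule: finite_induct)
  case empty
  then show ?case by (simp add: cvs.subspace_0[OF subspace_free_on])
next
  case (insert B Q)
  have "G_part n (insert B Q) - F_part n (insert B Q) =
      full_op B (G_part n Q - F_part n Q) + (full_op B (F_part n Q) - rho B (F_part n Q))"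
    using insert.hyps by (simp add: G_part_insert F_part_insert full_op_simps)
  also have "\<dots> \<in> free_on (doubled P)"
  proof (rule cvs.subspace_add[OF subspace_free_on])
    show "full_op B (G_part n Q - F_part n Q) \<in> free_on (doubled P)"
      using insert by (intro doubled_full_op insert.IH) auto
    show "full_op B (F_part n Q) - rho B (F_part n Q) \<in> free_on (doubled P)"
      using insert.prems by (intro full_op_diff_rho) auto
  qed
  finally show ?case .
qed

definition sing :: "nat set set \<Rightarrow> nat set" where
  "sing \<pi> = {i. {i} \<in> \<pi>}"

text \<open>In a block with more than one element the two chosen indices differ, so a monomial of
  \<open>F_part n \<pi>\<close> can double an index only at a singleton of \<pi>.\<close>

lemma F_part_orthogonal_doubled:
  assumes \<pi>: "\<pi> \<in> SP n" and P: "\<And>i. P i \<Longrightarrow> i \<in> {1..n} \<and> {i} \<notin> \<pi>" and z: "z \<in> free_on (doubled P)"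
  shows "ext_inner (F_part n \<pi>) z = 0"
proof (rule ext_inner_disjoint)
  note f = SP_facts[OF \<pi>]
  fix S assume "S \<in> Poly_Mapping.keys (F_part n \<pi>)"
  then have S: "F_monomial n \<pi> S" using keys_F_part[OF \<pi>] by simp
  show "S \<notin> Poly_Mapping.keys z"
  proof
    assume "S \<in> Poly_Mapping.keys z"
    then obtain i where i: "P i" "Xi i |\<in>| S" "Theta i |\<notin>| S"
      using z unfolding free_on_def doubled_def by blast
    then obtain B where B: "B \<in> \<pi>" "i \<in> B" using P[OF i(1)] f(3) by blast
    obtain k l where "picks B S k l" using S B unfolding F_monomial_def by blast
    then have "k = i \<and> l = i \<and> (card B > 1 \<longrightarrow> k \<noteq> l)" using i(2,3) B(2) unfolding picks_def by metis
    then have "card B = 1" using f(4)[OF B(1)] card_gt_0_iff[of B] by linarith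
    then have "B = {i}" using B(2) by (metis card_1_singletonE singletonD)
    then show False using P[OF i(1)] B by simp
  qed
qed

text \<open>In the first case the difference of \<open>G_part\<close> and \<open>F_part\<close>
  doubles indices that are not singletons of \<nu>, hence not of \<pi>. In the second,
  \<open>G_part n \<nu>\<close> itself doubles a singleton of \<nu> that is not one of
  \<pi>.\<close>

lemma ext_inner_F_G:
  assumes \<pi>: "\<pi> \<in> SP n" and \<nu>: "\<nu> \<in> SP n"
  shows "sing \<pi> \<subseteq> sing \<nu> \<Longrightarrow> ext_inner (F_part n \<pi>) (G_part n \<nu>) = ext_inner (F_part n \<pi>) (F_part n \<nu>)"
    and "\<not> sing \<nu> \<subseteq> sing \<pi> \<Longrightarrow> ext_inner (F_part n \<pi>) (G_part n \<nu>) = 0"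
proof -
  note f = SP_facts[OF \<nu>]
  assume sub: "sing \<pi> \<subseteq> sing \<nu>"
  define P where "P = (\<lambda>i. i \<in> {1..n} \<and> {i} \<notin> \<nu>)"
  have "G_part n \<nu> - F_part n \<nu> \<in> free_on (doubled P)"
  proof (rule G_part_diff_F_part[OF f(1,4)])
    fix B i assume B: "B \<in> \<nu>" "i \<in> B" "card B > 1"
    have "{i} \<noteq> B" using B(3) by auto
    then have "{i} \<notin> \<nu>" using disjointD[OF f(2), of "{i}" B] B by auto
    then show "P i" using B f(5)[OF B(1)] by (auto simp: P_def)
  qed
  moreover have "i \<in> {1..n} \<and> {i} \<notin> \<pi>" if "P i" for i using that sub by (auto simp: P_def sing_def)
  ultimately have "ext_inner (F_part n \<pi>) (G_part n \<nu> - F_part n \<nu>) = 0"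
    by (intro F_part_orthogonal_doubled[OF \<pi>])
  then show "ext_inner (F_part n \<pi>) (G_part n \<nu>) = ext_inner (F_part n \<pi>) (F_part n \<nu>)"
    by (simp add: ext_inner_diff_right)
next
  note f = SP_facts[OF \<nu>]
  assume "\<not> sing \<nu> \<subseteq> sing \<pi>"
  then obtain i where i: "{i} \<in> \<nu>" "{i} \<notin> \<pi>" by (auto simp: sing_def)
  then have "i \<in> {1..n}" using f(5) by blast
  have "G_part n \<nu> = ext_mult (Xi i) (contract (Theta i) (G_part n (\<nu> - {{i}})))"
    using G_part_remove[OF f(1) i(1)] by (simp add: full_op_def xi_sum_def dtheta_sum_def)
  then have "G_part n \<nu> \<in> free_on (doubled (\<lambda>j. j = i))" by (simp add: doubled_xi_dtheta)
  then show "ext_inner (F_part n \<pi>) (G_part n \<nu>) = 0"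
    by (rule F_part_orthogonal_doubled[OF \<pi>, rotated]) (use i \<open>i \<in> {1..n}\<close> in auto)
qed

lemma dxi_injective:
  assumes x: "x \<in> free_on (SP n)" and n: "0 < n" and eq: "dxi n (lin_ext (F_part n) x) = 0"
  shows "lin_ext (F_part n) x = 0"
proof -
  let ?K = "Poly_Mapping.keys x" and ?c = "Poly_Mapping.lookup x"
  have SP: "\<pi> \<in> SP n" if "\<pi> \<in> ?K" for \<pi> using that x by (auto simp: free_on_def)
  \<comment> \<open>The component of the combination formed by the partitions whose set of
    singletons is \<open>M\<close>.\<close>
  define FM where "FM M = (\<Sum>\<pi>\<in>{\<pi> \<in> ?K. sing \<pi> = M}. cscale (?c \<pi>) (F_part n \<pi>))" for M
  have F: "lin_ext (F_part n) x = (\<Sum>M\<in>sing ` ?K. FM M)"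
    unfolding lin_ext_def FM_def by (rule sum.image_gen) simp
  have G: "ext_inner (lin_ext (F_part n) x) (G_part n \<nu>) = 0" if \<nu>: "\<nu> \<in> SP n" for \<nu>
  proof -
    obtain z where "G_part n \<nu> = xi_sum {1..n} z" using G_part_eq_xi_sum[OF \<nu> n] by blast
    then show ?thesis using eq ext_inner_dxi[of n "lin_ext (F_part n) x" z] by simp
  qed
  have FM: "FM M = 0" if "M \<in> sing ` ?K" for M
  proof (rule ccontr)
    assume "FM M \<noteq> 0"
    then have "{M \<in> sing ` ?K. FM M \<noteq> 0} \<noteq> {}" using that by blast
    then obtain N where N: "N \<in> sing ` ?K" "FM N \<noteq> 0"
      and maxi: "\<And>M. M \<in> sing ` ?K \<Longrightarrow> FM M \<noteq> 0 \<Longrightarrow> N \<subseteq> M \<Longrightarrow> N = M"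
      using finite_has_maximal[of "{M \<in> sing ` ?K. FM M \<noteq> 0}"] by auto
    \<comment> \<open>Pairing with \<open>G_part n \<nu>\<close> isolates \<open>FM N\<close>: a
      component with \<open>M\<close> not containing \<open>N\<close> pairs to zero, and one with
      \<open>M\<close> strictly larger vanishes by maximality of \<open>N\<close>. On
      \<open>FM N\<close> itself \<open>G_part\<close> may be replaced by
      \<open>F_part\<close>.\<close>
    have orth: "ext_inner (FM N) (F_part n \<nu>) = 0" if \<nu>: "\<nu> \<in> ?K" "sing \<nu> = N" for \<nu>
    proof -
      have "ext_inner (FM M) (G_part n \<nu>) = 0" if "M \<in> sing ` ?K - {N}" for M
      proof (cases "N \<subseteq> M")
        case True
        then have "FM M = 0" using maxi that by blast
        then show ?thesis by simp
      next
        case False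
        then show ?thesis unfolding FM_def ext_inner_sum_left ext_inner_scale_left
          using ext_inner_F_G(2)[OF SP SP[OF \<nu>(1)]] \<nu>(2) by (intro sum.neutral) auto
      qed
      then have "ext_inner (lin_ext (F_part n) x) (G_part n \<nu>) = ext_inner (FM N) (G_part n \<nu>)"
        unfolding F ext_inner_sum_left using N by (subst sum.remove[of _ N]) auto
      then have "ext_inner (FM N) (G_part n \<nu>) = 0" using G[OF SP[OF \<nu>(1)]] by simp
      moreover have "ext_inner (FM N) (G_part n \<nu>) = ext_inner (FM N) (F_part n \<nu>)"
        unfolding FM_def ext_inner_sum_left ext_inner_scale_left
        using ext_inner_F_G(1)[OF SP SP[OF \<nu>(1)]] \<nu>(2) by (intro sum.cong) auto
      ultimately show ?thesis by simp
    qed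
    have "ext_inner (FM N) (FM N) =
        (\<Sum>\<nu>\<in>{\<pi> \<in> ?K. sing \<pi> = N}. ?c \<nu> * ext_inner (FM N) (F_part n \<nu>))"
      by (subst (2) FM_def) (simp add: ext_inner_sum_right ext_inner_scale_right)
    also have "\<dots> = 0" using orth by (intro sum.neutral) auto
    finally show False using ext_inner_self_eq_0 N by blast
  qed
  then show ?thesis unfolding F by (intro sum.neutral) blast
qed

section \<open>The module isomorphisms\<close>

lemma adj_word_Nil [simp]: "adj_word [] = id"
  and adj_word_Cons: "adj_word (i # is) = adj i \<circ> adj_word is"
  by (simp_all add: adj_word_def)

lemma adj_word_append: "adj_word (is @ js) = adj_word is \<circ> adj_word js"
  by (induction "is") (simp_all add: adj_word_Cons o_assoc)

lemma transpose_adj_word: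
  "1 \<le> a \<Longrightarrow> a < b \<Longrightarrow> b \<le> n \<Longrightarrow> \<exists>is. set is \<subseteq> {1..<n} \<and> adj_word is = transpose a b"
proof (induction b)
  case (Suc b)
  show ?case
  proof (cases "a = b")
    case True
    then show ?thesis using Suc.prems by (intro exI[of _ "[b]"]) (simp add: adj_word_Cons adj_def)
  next
    case False
    then obtain "is" where "is": "set is \<subseteq> {1..<n}" "adj_word is = transpose a b"
      using Suc by auto
    \<comment> \<open>Conjugating the transposition of \<open>a\<close> and \<open>b\<close> by that
      of \<open>b\<close> and \<open>b + 1\<close> moves its upper end to
      \<open>b + 1\<close>.\<close>
    have "adj_word (b # is @ [b]) = transpose a (Suc b)"
      using False Suc.prems unfolding adj_word_Cons adj_word_append "is"(2) adj_word_Nil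
      by (auto simp: fun_eq_iff adj_def transpose_def)
    then show ?thesis using "is" Suc.prems by (intro exI[of _ "b # is @ [b]"]) auto
  qed
qed simp

lemma permutes_adj_word:
  assumes "w permutes {1..n}"
  shows "\<exists>is. set is \<subseteq> {1..<n} \<and> adj_word is = w"
  using assms finite_atLeastAtMost
proof (induction rule: permutes_induct)
  case id
  show ?case by (intro exI[of _ "[]"]) simp
next
  case (swap a b w)
  obtain js where js: "set js \<subseteq> {1..<n}" "adj_word js = w" using swap.IH by blast
  have "\<exists>is. set is \<subseteq> {1..<n} \<and> adj_word is = transpose a b"
  proof (cases "a < b")
    case True
    then show ?thesis using swap by (intro transpose_adj_word) auto
  next
    case False
    then show ?thesis using swap transpose_adj_word[of b a n] by (auto simp: transpose_commute)
  qed
  then obtain "is" where "set is \<subseteq> {1..<n}" "adj_word is = transpose a b" by blast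
  with js show ?case by (intro exI[of _ "is @ js"]) (simp add: adj_word_append)
qed

lemma perm_act_adj_word_Cons:
  "perm_act (adj_word (i # is)) x = perm_act (adj i) (perm_act (adj_word is) x)"
  unfolding adj_word_Cons by (rule perm_act_comp)

section \<open>Transport of module structures along linear maps\<close>

lemma clinear_image_span:
  assumes "clinear f"
  shows "f ` cvs.span S = cvs.span (f ` S)"
proof
  have "f x \<in> cvs.span (f ` S)" if "x \<in> cvs.span S" for x
    using that
  proof (induction rule: cvs.span_induct_alt)
    case base
    then show ?case by (simp add: clinear_0[OF assms] cvs.span_zero)
  next
    case (step c x y)
    then show ?case
      by (simp add: clinear_add[OF assms] clinear_scale[OF assms] cvs.span_add cvs.span_scale cvs.span_base)
  qed
  then show "f ` cvs.span S \<subseteq> cvs.span (f ` S)" by blast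
  have "cvs.subspace (f ` cvs.span S)"
    unfolding cvs.subspace_def
  proof (intro conjI ballI allI)
    show "0 \<in> f ` cvs.span S" using clinear_0[OF assms] cvs.span_zero by (metis image_eqI)
  next
    fix x y assume "x \<in> f ` cvs.span S" "y \<in> f ` cvs.span S"
    then show "x + y \<in> f ` cvs.span S"
      by (auto simp flip: clinear_add[OF assms] intro!: imageI cvs.span_add)
  next
    fix c x assume "x \<in> f ` cvs.span S"
    then show "cscale c x \<in> f ` cvs.span S"
      by (auto simp flip: clinear_scale[OF assms] intro!: imageI cvs.span_scale)
  qed
  then show "cvs.span (f ` S) \<subseteq> f ` cvs.span S"
    by (intro cvs.span_minimal) (auto intro: cvs.span_base)
qed

lemma linear_within_subset: "clinear f \<Longrightarrow> linear_within U f"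
  by (simp add: linear_within_def)

lemma subspace_image:
  assumes "cvs.subspace U" "linear_within U \<phi>"
  shows "cvs.subspace (\<phi> ` U)"
  unfolding cvs.subspace_def
proof (intro conjI ballI allI)
  have 0: "0 \<in> U" using assms(1) by (rule cvs.subspace_0)
  then have "\<phi> (cscale 0 0) = cscale 0 (\<phi> 0)" using assms(2) unfolding linear_within_def by blast
  then show "0 \<in> \<phi> ` U" using 0 by (intro image_eqI[of _ _ 0]) simp_all
next
  fix x y assume "x \<in> \<phi> ` U" "y \<in> \<phi> ` U"
  then obtain u v where uv: "u \<in> U" "v \<in> U" "x = \<phi> u" "y = \<phi> v" by blast
  then have "x + y = \<phi> (u + v)" using assms(2) by (simp add: linear_within_def)
  then show "x + y \<in> \<phi> ` U" using cvs.subspace_add[OF assms(1) uv(1,2)] by blast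
next
  fix c x assume "x \<in> \<phi> ` U"
  then obtain u where u: "u \<in> U" "x = \<phi> u" by blast
  then have "cscale c x = \<phi> (cscale c u)" using assms(2) by (simp add: linear_within_def)
  then show "cscale c x \<in> \<phi> ` U" using cvs.subspace_scale[OF assms(1) u(1)] by blast
qed

text \<open>The module axioms pass from \<open>U\<close> to its image through equivariance, so the
  spans V and W require no verification of their own.\<close>

lemma Sn_module_iso_image:
  assumes U: "Sn_module n U actU" and \<phi>: "linear_within U \<phi>" "inj_on \<phi> U"
    and lin: "\<And>w. w permutes {1..n} \<Longrightarrow> clinear (actV w)"
    and equiv: "\<And>w x. w permutes {1..n} \<Longrightarrow> x \<in> U \<Longrightarrow> \<phi> (actU w x) = actV w (\<phi> x)"
  shows "Sn_module_iso n U actU (\<phi> ` U) actV \<phi>"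
proof -
  have actU: "actU w x \<in> U" if "w permutes {1..n}" "x \<in> U" for w x
    using that U unfolding Sn_module_def by blast
  have "Sn_module n (\<phi> ` U) actV"
    unfolding Sn_module_def
  proof (intro conjI allI impI ballI)
    show "cvs.subspace (\<phi> ` U)" using U \<phi>(1) subspace_image unfolding Sn_module_def by blast
    show "linear_within (\<phi> ` U) (actV w)" if "w permutes {1..n}" for w
      using lin[OF that] by (rule linear_within_subset)
    show "actV w ` \<phi> ` U \<subseteq> \<phi> ` U" if "w permutes {1..n}" for w
      using equiv[OF that] actU[OF that] by (auto simp flip: equiv[OF that])
    show "actV id y = y" if y: "y \<in> \<phi> ` U" for y
    proof -
      obtain x where x: "x \<in> U" "y = \<phi> x" using y by blast
      then show ?thesis using equiv[OF permutes_id x(1)] U unfolding Sn_module_def by simp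
    qed
    show "actV (v \<circ> w) y = actV v (actV w y)" if v: "v permutes {1..n}" and w: "w permutes {1..n}" and y: "y \<in> \<phi> ` U" for v w y
    proof -
      obtain x where x: "x \<in> U" "y = \<phi> x" using y by blast
      have "actV (v \<circ> w) y = \<phi> (actU (v \<circ> w) x)" using equiv[OF permutes_compose[OF w v] x(1)] x by simp
      also have "\<dots> = \<phi> (actU v (actU w x))" using U v w x unfolding Sn_module_def by simp
      finally show ?thesis using equiv v w x actU by simp
    qed
  qed
  then show ?thesis using assms by (simp add: Sn_module_iso_def bij_betw_def)
qed

lemma Sn_module_iso_inverse:
  assumes "Sn_module_iso n U actU V actV \<phi>"
  shows "Sn_module_iso n V actV U actU (inv_into U \<phi>)"
proof -
  have U: "Sn_module n U actU" and V: "Sn_module n V actV" and lin: "linear_within U \<phi>"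
    and bij: "bij_betw \<phi> U V" and equiv: "\<And>w x. w permutes {1..n} \<Longrightarrow> x \<in> U \<Longrightarrow> \<phi> (actU w x) = actV w (\<phi> x)"
    using assms by (auto simp: Sn_module_iso_def)
  have sub: "cvs.subspace U" using U by (simp add: Sn_module_def)
  let ?\<psi> = "inv_into U \<phi>"
  have inj: "inj_on \<phi> U" and img: "\<phi> ` U = V" using bij by (auto simp: bij_betw_def)
  have \<psi>: "?\<psi> y \<in> U" "\<phi> (?\<psi> y) = y" if "y \<in> V" for y
    using that img by (auto intro: inv_into_into f_inv_into_f)
  have eqI: "?\<psi> y = x" if "x \<in> U" "\<phi> x = y" for x y using that inj by auto
  have "linear_within V ?\<psi>"
    unfolding linear_within_def
  proof (intro conjI ballI allI)
    fix y z assume "y \<in> V" "z \<in> V"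
    then show "?\<psi> (y + z) = ?\<psi> y + ?\<psi> z"
      using lin \<psi> cvs.subspace_add[OF sub] by (intro eqI) (auto simp: linear_within_def)
  next
    fix c y assume "y \<in> V"
    then show "?\<psi> (cscale c y) = cscale c (?\<psi> y)"
      using lin \<psi> cvs.subspace_scale[OF sub] by (intro eqI) (auto simp: linear_within_def)
  qed
  moreover have "?\<psi> (actV w y) = actU w (?\<psi> y)" if w: "w permutes {1..n}" and y: "y \<in> V" for w y
    using \<psi>[OF y] equiv[OF w] U w by (intro eqI) (auto simp: Sn_module_def)
  ultimately show ?thesis using U V bij_betw_inv_into[OF bij] by (simp add: Sn_module_iso_def)
qed

section \<open>The skein action on a class of noncrossing partitions\<close>

lemma clinear_skein_gen: "clinear (skein_gen i)"
  unfolding skein_gen_def by (rule clinear_lin_ext)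

text \<open>A predicate on the numbers of blocks and of singletons covers all three families of the
  theorem at once.\<close>

definition NC_class :: "nat \<Rightarrow> (nat \<Rightarrow> nat \<Rightarrow> bool) \<Rightarrow> nat set set set" where
  "NC_class n P = {\<pi> \<in> NC n. P (card \<pi>) (singles \<pi>)}"

definition SP_class :: "nat \<Rightarrow> (nat \<Rightarrow> nat \<Rightarrow> bool) \<Rightarrow> nat set set set" where
  "SP_class n P = {\<pi> \<in> SP n. P (card \<pi>) (singles \<pi>)}"

lemma free_on_mono: "X \<subseteq> Y \<Longrightarrow> free_on X \<subseteq> free_on Y"
  by (auto simp: free_on_def)

lemma free_on_NC_class: "x \<in> free_on (NC_class n P) \<Longrightarrow> x \<in> free_on (NC n)"
  using free_on_mono[of "NC_class n P" "NC n"] by (auto simp: NC_class_def)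

lemma skein_gen_NC_class:
  assumes x: "x \<in> free_on (NC_class n P)" and i: "i \<in> {1..<n}"
  shows "skein_gen i x \<in> free_on (NC_class n P)"
    and "lin_ext (F_part n) (skein_gen i x) = perm_act (adj i) (lin_ext (F_part n) x)"
proof -
  let ?K = "Poly_Mapping.keys x" and ?c = "Poly_Mapping.lookup x"
  have K: "\<pi> \<in> NC_class n P" "\<pi> \<in> NC n" if "\<pi> \<in> ?K" for \<pi>
    using that x by (auto simp: free_on_def NC_class_def)
  have exp: "skein_gen i x = (\<Sum>\<pi>\<in>?K. cscale (?c \<pi>) (skein_gen i (basis_vec \<pi>)))"
    by (subst basis_expansion[of x]) (simp add: clinear_simps[OF clinear_skein_gen])
  have "skein_gen i (basis_vec \<pi>) \<in> free_on (NC_class n P)" if "\<pi> \<in> ?K" for \<pi>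
  proof -
    have "{\<nu> \<in> NC n. card \<nu> = card \<pi> \<and> singles \<nu> = singles \<pi>} \<subseteq> NC_class n P"
      using K(1)[OF that] by (auto simp: NC_class_def)
    then show ?thesis using skein_gen_in[OF K(2)[OF that] i] free_on_mono by blast
  qed
  then show "skein_gen i x \<in> free_on (NC_class n P)"
    unfolding exp
    by (intro cvs.subspace_sum[OF subspace_free_on] cvs.subspace_scale[OF subspace_free_on])
  have "lin_ext (F_part n) (skein_gen i x) = (\<Sum>\<pi>\<in>?K. cscale (?c \<pi>) (perm_act (adj i) (F_part n \<pi>)))"
    unfolding exp using lin_ext_skein_gen[OF K(2) i] by (simp add: clinear_simps[OF clinear_lin_ext])
  also have "\<dots> = perm_act (adj i) (lin_ext (F_part n) x)"
    by (simp add: lin_ext_def perm_act_simps)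
  finally show "lin_ext (F_part n) (skein_gen i x) = perm_act (adj i) (lin_ext (F_part n) x)" .
qed

lemma skein_word_NC_class:
  assumes "set is \<subseteq> {1..<n}" and x: "x \<in> free_on (NC_class n P)"
  shows "skein_word is x \<in> free_on (NC_class n P) \<and>
    lin_ext (F_part n) (skein_word is x) = perm_act (adj_word is) (lin_ext (F_part n) x)"
  using assms(1)
proof (induction "is")
  case Nil
  have "perm_act id (lin_ext (F_part n) x) = lin_ext (F_part n) x" by (rule perm_act_id)
  then show ?case using x by (simp only: skein_word_def adj_word_Nil) simp
next
  case (Cons i "is")
  then have "skein_word is x \<in> free_on (NC_class n P)" "i \<in> {1..<n}" by auto
  note skein_gen_NC_class[OF this]
  then show ?case using Cons by (simp add: skein_word_def perm_act_adj_word_Cons)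
qed

text \<open>Any word for \<open>w\<close> acts under F as \<open>w\<close> itself, so these facts
  hold for whichever word the choice in \<open>skein_act\<close> returns.\<close>

lemma skein_act_NC_class:
  assumes w: "w permutes {1..n}" and x: "x \<in> free_on (NC_class n P)"
  shows "skein_act n w x \<in> free_on (NC_class n P)"
    and "lin_ext (F_part n) (skein_act n w x) = perm_act w (lin_ext (F_part n) x)"
proof -
  define js where "js = (SOME is. set is \<subseteq> {1..<n} \<and> adj_word is = w)"
  have js: "set js \<subseteq> {1..<n} \<and> adj_word js = w"
    unfolding js_def by (rule someI_ex[OF permutes_adj_word[OF w]])
  have "skein_act n w x = skein_word js x" by (simp add: skein_act_def js_def)
  then show "skein_act n w x \<in> free_on (NC_class n P)"
    "lin_ext (F_part n) (skein_act n w x) = perm_act w (lin_ext (F_part n) x)"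
    using skein_word_NC_class[of js n x P] js x by auto
qed

lemma inj_on_F_part: "inj_on (lin_ext (F_part n)) (free_on (NC n))"
proof (rule inj_onI)
  fix x y assume "x \<in> free_on (NC n)" "y \<in> free_on (NC n)" and eq: "lin_ext (F_part n) x = lin_ext (F_part n) y"
  then have "x - y \<in> free_on (NC n)" by (intro cvs.subspace_diff[OF subspace_free_on])
  then show "x = y" using F_part_independent[of "x - y" n] eq by (simp add: clinear_simps[OF clinear_lin_ext])
qed

lemma clinear_skein_word: "clinear (skein_word is)"
  by (induction "is") (simp_all add: skein_word_def[abs_def] clinear_id o_def clinear_comp[OF clinear_skein_gen])

text \<open>The identity and composition laws hold after applying the injective map F, since
  \<open>perm_act\<close> satisfies them.\<close>

lemma Sn_module_skein: "Sn_module n (free_on (NC_class n P)) (skein_act n)"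
  unfolding Sn_module_def
proof (intro conjI allI impI ballI)
  let ?U = "free_on (NC_class n P)" and ?\<phi> = "lin_ext (F_part n)"
  have inj: "x = y" if "x \<in> ?U" "y \<in> ?U" "?\<phi> x = ?\<phi> y" for x y
    using that inj_on_F_part free_on_NC_class unfolding inj_on_def by blast
  show "cvs.subspace ?U" by (rule subspace_free_on)
  show "linear_within ?U (skein_act n w)" for w
    unfolding skein_act_def by (rule linear_within_subset[OF clinear_skein_word])
  show "skein_act n w ` ?U \<subseteq> ?U" if "w permutes {1..n}" for w
    using skein_act_NC_class(1)[OF that] by blast
  show "skein_act n id x = x" if "x \<in> ?U" for x
    using skein_act_NC_class[OF permutes_id that] that by (intro inj) (auto simp: perm_act_id)
  show "skein_act n (v \<circ> w) x = skein_act n v (skein_act n w x)"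
    if v: "v permutes {1..n}" and w: "w permutes {1..n}" and x: "x \<in> ?U" for v w x
    using skein_act_NC_class[OF permutes_compose[OF w v] x] skein_act_NC_class[OF w x]
      skein_act_NC_class[OF v skein_act_NC_class(1)[OF w x]]
    by (intro inj) (auto simp: perm_act_comp)
qed

text \<open>The chosen word for \<open>adj i\<close> may be longer than the single letter i;
  injectivity of F shows that it acts in the same way.\<close>

lemma skein_act_adj:
  assumes "i \<in> {1..<n}" "x \<in> free_on (NC_class n P)"
  shows "skein_act n (adj i) x = skein_gen i x"
proof (rule inj_onD[OF inj_on_F_part])
  show "lin_ext (F_part n) (skein_act n (adj i) x) = lin_ext (F_part n) (skein_gen i x)"
    using skein_gen_NC_class(2)[OF assms(2,1)] skein_act_NC_class(2)[OF adj_permutes[OF assms(1)] assms(2)] by simp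
  show "skein_act n (adj i) x \<in> free_on (NC n)" "skein_gen i x \<in> free_on (NC n)"
    using skein_gen_NC_class(1)[OF assms(2,1)] skein_act_NC_class(1)[OF adj_permutes[OF assms(1)] assms(2)]
    by (auto intro: free_on_NC_class)
qed

section \<open>Every set partition is a permuted noncrossing one\<close>

lemma interval_rearrangement:
  assumes "finite Q" "disjoint Q" "\<And>B. B \<in> Q \<Longrightarrow> finite B"
  shows "\<exists>g. bij_betw g (\<Union>Q) {1..card (\<Union>Q)} \<and>
    (\<forall>B\<in>Q. \<forall>a\<in>g ` B. \<forall>c\<in>g ` B. \<forall>b. a < b \<and> b < c \<longrightarrow> b \<in> g ` B)"
  using assms
proof (induction Q rule: finite_induct)
  case empty
  then show ?case by (simp add: bij_betw_def)
next
  case (insert B Q)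
  have "disjoint Q" using insert.prems(1) by (auto simp: disjoint_def)
  then have "\<exists>g. bij_betw g (\<Union>Q) {1..card (\<Union>Q)} \<and>
      (\<forall>C\<in>Q. \<forall>a\<in>g ` C. \<forall>c\<in>g ` C. \<forall>b. a < b \<and> b < c \<longrightarrow> b \<in> g ` C)"
    using insert.prems(2) by (intro insert.IH) auto
  then obtain g where g: "bij_betw g (\<Union>Q) {1..card (\<Union>Q)}"
    "\<And>C. C \<in> Q \<Longrightarrow> \<forall>a\<in>g ` C. \<forall>c\<in>g ` C. \<forall>b. a < b \<and> b < c \<longrightarrow> b \<in> g ` C"
    by (elim exE conjE) (rule that, assumption, blast)
  define N where "N = card (\<Union>Q)"
  have fin: "finite B" "finite (\<Union>Q)" using insert by auto
  have disj: "B \<inter> \<Union>Q = {}" using insert.prems(1) insert.hyps(2) by (auto simp: disjoint_def)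
  \<comment> \<open>The new block receives the interval directly after the numbers used by the
    earlier blocks.\<close>
  obtain h where h: "bij_betw h B {N + 1..N + card B}"
    using fin(1) finite_same_card_bij[of B "{N + 1..N + card B}"] by auto
  define k where "k x = (if x \<in> B then h x else g x)" for x
  have kB: "k ` B = {N + 1..N + card B}" and bB: "bij_betw k B {N + 1..N + card B}"
    using h by (auto simp: k_def bij_betw_def inj_on_def)
  have kC: "k ` C = g ` C" if "C \<in> Q" for C using that disj by (auto simp: k_def image_iff)
  have bQ: "bij_betw k (\<Union>Q) {1..N}"
    using g(1) disj by (subst bij_betw_cong[of _ _ g]) (auto simp: k_def N_def)
  have "bij_betw k (\<Union>Q \<union> B) ({1..N} \<union> {N + 1..N + card B})"
    by (rule bij_betw_combine[OF bQ bB]) auto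
  moreover have "{1..N} \<union> {N + 1..N + card B} = {1..N + card B}" by auto
  moreover have "card (\<Union>(insert B Q)) = N + card B" "\<Union>(insert B Q) = \<Union>Q \<union> B"
    using disj fin by (auto simp: N_def card_Un_disjoint)
  ultimately have "bij_betw k (\<Union>(insert B Q)) {1..card (\<Union>(insert B Q))}" by simp
  moreover have "\<forall>C\<in>insert B Q. \<forall>a\<in>k ` C. \<forall>c\<in>k ` C. \<forall>b. a < b \<and> b < c \<longrightarrow> b \<in> k ` C"
  proof
    fix C assume "C \<in> insert B Q"
    then show "\<forall>a\<in>k ` C. \<forall>c\<in>k ` C. \<forall>b. a < b \<and> b < c \<longrightarrow> b \<in> k ` C"
    proof
      assume "C = B"
      then show ?thesis unfolding \<open>C = B\<close> kB by auto
    next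
      assume "C \<in> Q"
      then show ?thesis unfolding kC[OF \<open>C \<in> Q\<close>] using g(2) by blast
    qed
  qed
  ultimately show ?case by blast
qed

lemma SP_permuted_noncrossing:
  assumes \<pi>: "\<pi> \<in> SP n"
  obtains w \<nu> where "w permutes {1..n}" "\<nu> \<in> NC n" "perm_partition w \<nu> = \<pi>"
proof -
  note f = SP_facts[OF \<pi>]
  obtain g where g: "bij_betw g {1..n} {1..n}"
    and convex: "\<And>B a b c. B \<in> \<pi> \<Longrightarrow> a \<in> g ` B \<Longrightarrow> c \<in> g ` B \<Longrightarrow> a < b \<Longrightarrow> b < c \<Longrightarrow> b \<in> g ` B"
  proof -
    have "\<exists>g. bij_betw g (\<Union>\<pi>) {1..card (\<Union>\<pi>)} \<and>
      (\<forall>B\<in>\<pi>. \<forall>a\<in>g ` B. \<forall>c\<in>g ` B. \<forall>b. a < b \<and> b < c \<longrightarrow> b \<in> g ` B)"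
      using f(4) by (intro interval_rearrangement[OF f(1,2)]) blast
    then show ?thesis unfolding f(3) by (elim exE conjE) (rule that, simp, blast)
  qed
  define u where "u x = (if x \<in> {1..n} then g x else x)" for x
  have u: "u permutes {1..n}"
  proof (rule bij_imp_permutes)
    have "bij_betw u {1..n} {1..n} \<longleftrightarrow> bij_betw g {1..n} {1..n}"
      by (rule bij_betw_cong) (simp add: u_def)
    then show "bij_betw u {1..n} {1..n}" using g by simp
  qed (auto simp: u_def)
  have uB: "u ` B = g ` B" if "B \<in> \<pi>" for B
    using f(5)[OF that] by (intro image_cong) (auto simp: u_def)
  define \<nu> where "\<nu> = perm_partition u \<pi>"
  have SP: "\<nu> \<in> SP n" unfolding \<nu>_def by (rule perm_partition_SP(1)[OF u \<pi>])
  have "noncrossing \<nu>" unfolding noncrossing_def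
  proof (intro ballI allI impI)
    fix B C a b c d
    assume *: "B \<in> \<nu>" "C \<in> \<nu>" "a < b \<and> b < c \<and> c < d \<and> a \<in> B \<and> c \<in> B \<and> b \<in> C \<and> d \<in> C"
    obtain B' where B': "B' \<in> \<pi>" "B = g ` B'" using *(1) uB by (auto simp: \<nu>_def perm_partition_def)
    \<comment> \<open>\<open>b\<close> lies between two elements of the interval \<open>B\<close>,
      so the blocks \<open>B\<close> and \<open>C\<close> share it.\<close>
    have "b \<in> B" using convex[OF B'(1)] * B' by blast
    then show "B = C" using * SP disjointD[of \<nu> B C] by (auto simp: SP_def partition_on_def)
  qed
  then have "\<nu> \<in> NC n" using SP by (simp add: NC_def)
  moreover have "perm_partition (inv u) \<nu> = \<pi>"
    using permutes_inverses[OF u] permutes_inj[OF u] unfolding \<nu>_def perm_partition_def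
    by (simp add: image_image)
  ultimately show ?thesis using that permutes_inv[OF u] by blast
qed

lemma perm_act_theta_top:
  assumes "w permutes {1..n}"
  shows "\<exists>c. c \<noteq> 0 \<and> perm_act w (theta_top n) = cscale c (theta_top n)"
proof -
  obtain "is" where "is": "set is \<subseteq> {1..<n}" "adj_word is = w" using permutes_adj_word[OF assms] by blast
  have "\<exists>c. c \<noteq> 0 \<and> perm_act (adj_word is) (theta_top n) = cscale c (theta_top n)"
    using "is"(1)
  proof (induction "is")
    case Nil
    show ?case unfolding adj_word_Nil perm_act_id by (intro exI[of _ 1]) simp
  next
    case (Cons i "is")
    then obtain c where c: "c \<noteq> 0" "perm_act (adj_word is) (theta_top n) = cscale c (theta_top n)" by auto
    have "perm_act (adj i) (theta_top n) = - theta_top n" using Cons.prems by (intro perm_act_adj_theta_top) auto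
    then have "perm_act (adj_word (i # is)) (theta_top n) = cscale (- c) (theta_top n)"
      using c(2) by (simp add: perm_act_adj_word_Cons perm_act_simps del: upt_Suc)
    then show ?case using c(1) by (intro exI[of _ "- c"] conjI) (simp, assumption)
  qed
  then show ?thesis using "is" by simp
qed

section \<open>Images of the classes and the isomorphisms\<close>

lemma image_F_part: "lin_ext (F_part n) ` free_on (NC_class n P) = cvs.span (F_part n ` SP_class n P)"
proof
  show "lin_ext (F_part n) ` free_on (NC_class n P) \<subseteq> cvs.span (F_part n ` SP_class n P)"
  proof
    fix y assume "y \<in> lin_ext (F_part n) ` free_on (NC_class n P)"
    then obtain x where x: "Poly_Mapping.keys x \<subseteq> NC_class n P" "y = lin_ext (F_part n) x"
      by (auto simp: free_on_def)
    have "NC_class n P \<subseteq> SP_class n P" by (auto simp: NC_class_def SP_class_def NC_def)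
    then show "y \<in> cvs.span (F_part n ` SP_class n P)" unfolding x(2) lin_ext_def using x(1)
      by (intro cvs.span_sum cvs.span_scale cvs.span_base) blast
  qed
  have sub: "cvs.subspace (lin_ext (F_part n) ` free_on (NC_class n P))"
    by (rule subspace_image[OF subspace_free_on linear_within_subset[OF clinear_lin_ext]])
  show "cvs.span (F_part n ` SP_class n P) \<subseteq> lin_ext (F_part n) ` free_on (NC_class n P)"
  proof (rule cvs.span_minimal[OF _ sub], safe)
    fix \<pi> assume \<pi>: "\<pi> \<in> SP_class n P"
    then have SP: "\<pi> \<in> SP n" by (simp add: SP_class_def)
    obtain w \<nu> where w: "w permutes {1..n}" and \<nu>: "\<nu> \<in> NC n" and \<pi>eq: "perm_partition w \<nu> = \<pi>"
      using SP_permuted_noncrossing[OF SP] by blast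
    have \<nu>SP: "\<nu> \<in> SP n" using \<nu> by (simp add: NC_def)
    then have "\<nu> \<in> NC_class n P"
      using \<pi> \<nu> perm_partition_SP(2,3)[OF w \<nu>SP] by (simp add: NC_class_def SP_class_def \<pi>eq)
    then have b: "basis_vec \<nu> \<in> free_on (NC_class n P)" by (rule free_on_basis_vec)
    obtain c where c: "c \<noteq> 0" "perm_act w (theta_top n) = cscale c (theta_top n)"
      using perm_act_theta_top[OF w] by blast
    \<comment> \<open>Up to a nonzero scalar, \<open>F_part n \<pi>\<close> is \<open>w\<close>
      applied to a noncrossing \<open>F_part n \<nu>\<close>, hence the image of a vector obtained
      by the skein action, which stays in the class.\<close>
    have "lin_ext (F_part n) (skein_act n w (basis_vec \<nu>)) = perm_act w (F_part n \<nu>)"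
      using skein_act_NC_class(2)[OF w b] by simp
    also have "\<dots> = cscale c (F_part n \<pi>)"
      using perm_act_F_part[OF permutes_inj[OF w] c(2) SP_facts(1,4)[OF \<nu>SP]] \<pi>eq by simp
    finally have "F_part n \<pi> = cscale (inverse c) (lin_ext (F_part n) (skein_act n w (basis_vec \<nu>)))"
      using c(1) by simp
    then show "F_part n \<pi> \<in> lin_ext (F_part n) ` free_on (NC_class n P)"
      using cvs.subspace_scale[OF sub] skein_act_NC_class(1)[OF w b] by simp
  qed
qed

text \<open>For \<open>n = 0\<close> the map \<open>dxi n\<close> is zero, so injectivity then
  requires the span to vanish, as it does for an empty class.\<close>

lemma inj_on_dxi:
  assumes "0 < n \<or> SP_class n P = {}"
  shows "inj_on (dxi n) (cvs.span (F_part n ` SP_class n P))"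
proof (rule inj_onI)
  let ?W = "cvs.span (F_part n ` SP_class n P)"
  fix x y assume x: "x \<in> ?W" and y: "y \<in> ?W" and eq: "dxi n x = dxi n y"
  show "x = y"
  proof (cases "0 < n")
    case True
    have "x - y \<in> ?W" using x y by (rule cvs.span_diff)
    then obtain z where z: "z \<in> free_on (NC_class n P)" "x - y = lin_ext (F_part n) z"
      unfolding image_F_part[symmetric] by blast
    have "z \<in> free_on (SP n)" using z(1) by (auto simp: free_on_def NC_class_def NC_def)
    moreover have "dxi n (lin_ext (F_part n) z) = 0"
      using eq by (simp add: clinear_diff[OF clinear_dxi] flip: z(2))
    ultimately have "x - y = 0" using dxi_injective[OF _ True] z(2) by simp
    then show ?thesis by simp
  next
    case False
    then show ?thesis using assms x y by simp
  qed
qed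

lemma iso_W:
  "Sn_module_iso n (free_on (NC_class n P)) (skein_act n) (cvs.span (F_part n ` SP_class n P)) perm_act
     (lin_ext (F_part n))"
  unfolding image_F_part[symmetric]
proof (rule Sn_module_iso_image[OF Sn_module_skein])
  show "linear_within (free_on (NC_class n P)) (lin_ext (F_part n))"
    by (rule linear_within_subset[OF clinear_lin_ext])
  show "inj_on (lin_ext (F_part n)) (free_on (NC_class n P))"
    using inj_on_F_part by (rule inj_on_subset) (auto intro: free_on_NC_class)
qed (auto intro: clinear_perm_act skein_act_NC_class(2))

lemma iso_W_V:
  assumes "0 < n \<or> SP_class n P = {}"
  shows "Sn_module_iso n (cvs.span (F_part n ` SP_class n P)) perm_act
    (cvs.span (f_part n ` SP_class n P)) perm_act (dxi n)"
proof -
  have img: "cvs.span (f_part n ` SP_class n P) = dxi n ` cvs.span (F_part n ` SP_class n P)"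
    unfolding clinear_image_span[OF clinear_dxi] by (simp add: image_image f_part_eq_dxi)
  show ?thesis unfolding img
  proof (rule Sn_module_iso_image)
    show "Sn_module n (cvs.span (F_part n ` SP_class n P)) perm_act"
      using iso_W by (simp add: Sn_module_iso_def)
  qed (auto intro: inj_on_dxi[OF assms] clinear_perm_act perm_act_dxi[symmetric] linear_within_subset[OF clinear_dxi])
qed

lemma Sn_module_iso_trans:
  assumes "Sn_module_iso n U actU V actV \<phi>" "Sn_module_iso n V actV W actW \<psi>"
  shows "Sn_module_iso n U actU W actW (\<psi> \<circ> \<phi>)"
proof -
  have \<phi>: "\<phi> x \<in> V" if "x \<in> U" for x
    using assms(1) that by (auto simp: Sn_module_iso_def bij_betw_def)
  show ?thesis using assms \<phi> bij_betw_trans[of \<phi> U V \<psi> W]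
    by (simp add: Sn_module_iso_def linear_within_def)
qed

lemma class_isomorphisms:
  shows "\<exists>\<phi>. Sn_module_iso n (free_on (NC_class n P)) (skein_act n) (cvs.span (F_part n ` SP_class n P)) perm_act \<phi> \<and>
         (\<forall>\<pi>\<in>NC_class n P. \<phi> (basis_vec \<pi>) = F_part n \<pi>)"
    and "0 < n \<or> SP_class n P = {} \<Longrightarrow>
       (\<exists>\<phi>. Sn_module_iso n (free_on (NC_class n P)) (skein_act n) (cvs.span (f_part n ` SP_class n P)) perm_act \<phi> \<and>
            (\<forall>\<pi>\<in>NC_class n P. \<phi> (basis_vec \<pi>) = f_part n \<pi>)) \<and>
       (\<exists>\<phi>. Sn_module_iso n (cvs.span (f_part n ` SP_class n P)) perm_act (cvs.span (F_part n ` SP_class n P)) perm_act \<phi> \<and>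
            (\<forall>\<pi>\<in>NC_class n P. \<phi> (f_part n \<pi>) = F_part n \<pi>))"
proof -
  show "\<exists>\<phi>. Sn_module_iso n (free_on (NC_class n P)) (skein_act n) (cvs.span (F_part n ` SP_class n P)) perm_act \<phi> \<and>
         (\<forall>\<pi>\<in>NC_class n P. \<phi> (basis_vec \<pi>) = F_part n \<pi>)"
    using iso_W by (intro exI[of _ "lin_ext (F_part n)"]) simp
  assume n: "0 < n \<or> SP_class n P = {}"
  let ?W = "cvs.span (F_part n ` SP_class n P)"
  have "inv_into ?W (dxi n) (f_part n \<pi>) = F_part n \<pi>" if "\<pi> \<in> NC_class n P" for \<pi>
  proof -
    have "F_part n \<pi> \<in> ?W" using that by (intro cvs.span_base) (auto simp: NC_class_def SP_class_def NC_def)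
    then show ?thesis unfolding f_part_eq_dxi by (rule inv_into_f_f[OF inj_on_dxi[OF n]])
  qed
  then show "(\<exists>\<phi>. Sn_module_iso n (free_on (NC_class n P)) (skein_act n) (cvs.span (f_part n ` SP_class n P)) perm_act \<phi> \<and>
            (\<forall>\<pi>\<in>NC_class n P. \<phi> (basis_vec \<pi>) = f_part n \<pi>)) \<and>
       (\<exists>\<phi>. Sn_module_iso n (cvs.span (f_part n ` SP_class n P)) perm_act ?W perm_act \<phi> \<and>
            (\<forall>\<pi>\<in>NC_class n P. \<phi> (f_part n \<pi>) = F_part n \<pi>))"
    using Sn_module_iso_trans[OF iso_W iso_W_V[OF n]] Sn_module_iso_inverse[OF iso_W_V[OF n]]
    by (intro conjI exI[of _ "dxi n \<circ> lin_ext (F_part n)"] exI[of _ "inv_into ?W (dxi n)"]) (simp_all add: f_part_eq_dxi)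
qed

lemma SP_0: "SP 0 = {{}}"
  by (auto simp: SP_def partition_on_def)

lemma class_eqs:
  "SP_class n (\<lambda>_ _. True) = SP n" "NC_class n (\<lambda>_ _. True) = NC n"
  "SP_class n (\<lambda>a _. a = k) = SP_blocks n k" "NC_class n (\<lambda>a _. a = k) = NC_blocks n k"
  "SP_class n (\<lambda>a b. a = k \<and> b = m) = SP_singles n k m" "NC_class n (\<lambda>a b. a = k \<and> b = m) = NC_singles n k m"
  by (auto simp: SP_class_def NC_class_def NC_def SP_blocks_def NC_blocks_def SP_singles_def NC_singles_def singles_def)

theorem theorem5p6:
  fixes n k m :: nat
  shows "extends_skein_gens n (skein_act n) \<and>
    (\<exists>\<phi>. Sn_module_iso n (free_on (NC n)) (skein_act n) (W_all n) perm_act \<phi> \<and>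
         (\<forall>\<pi>\<in>NC n. \<phi> (basis_vec \<pi>) = F_part n \<pi>)) \<and>
    (n \<noteq> 0 \<longrightarrow>
       (\<exists>\<phi>. Sn_module_iso n (free_on (NC n)) (skein_act n) (V_all n) perm_act \<phi> \<and>
            (\<forall>\<pi>\<in>NC n. \<phi> (basis_vec \<pi>) = f_part n \<pi>)) \<and>
       (\<exists>\<phi>. Sn_module_iso n (V_all n) perm_act (W_all n) perm_act \<phi> \<and>
            (\<forall>\<pi>\<in>NC n. \<phi> (f_part n \<pi>) = F_part n \<pi>))) \<and>
    (\<exists>\<phi>. Sn_module_iso n (free_on (NC_blocks n k)) (skein_act n) (W_blocks n k) perm_act \<phi> \<and>
         (\<forall>\<pi>\<in>NC_blocks n k. \<phi> (basis_vec \<pi>) = F_part n \<pi>)) \<and>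
    ((n, k) \<noteq> (0, 0) \<longrightarrow>
       (\<exists>\<phi>. Sn_module_iso n (free_on (NC_blocks n k)) (skein_act n) (V_blocks n k) perm_act \<phi> \<and>
            (\<forall>\<pi>\<in>NC_blocks n k. \<phi> (basis_vec \<pi>) = f_part n \<pi>)) \<and>
       (\<exists>\<phi>. Sn_module_iso n (V_blocks n k) perm_act (W_blocks n k) perm_act \<phi> \<and>
            (\<forall>\<pi>\<in>NC_blocks n k. \<phi> (f_part n \<pi>) = F_part n \<pi>))) \<and>
    (\<exists>\<phi>. Sn_module_iso n (free_on (NC_singles n k m)) (skein_act n) (W_singles n k m) perm_act \<phi> \<and>
         (\<forall>\<pi>\<in>NC_singles n k m. \<phi> (basis_vec \<pi>) = F_part n \<pi>)) \<and>
    ((n, k, m) \<noteq> (0, 0, 0) \<longrightarrow>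
       (\<exists>\<phi>. Sn_module_iso n (free_on (NC_singles n k m)) (skein_act n) (V_singles n k m) perm_act \<phi> \<and>
            (\<forall>\<pi>\<in>NC_singles n k m. \<phi> (basis_vec \<pi>) = f_part n \<pi>)) \<and>
       (\<exists>\<phi>. Sn_module_iso n (V_singles n k m) perm_act (W_singles n k m) perm_act \<phi> \<and>
            (\<forall>\<pi>\<in>NC_singles n k m. \<phi> (f_part n \<pi>) = F_part n \<pi>)))"
proof -
  have skein: "extends_skein_gens n (skein_act n)"
    using Sn_module_skein[of n "\<lambda>_ _. True"] skein_act_adj[of _ n _ "\<lambda>_ _. True"]
    by (simp add: extends_skein_gens_def class_eqs)
  \<comment> \<open>The only partition for \<open>n = 0\<close> is the empty one, with no blocks and
    no singletons; any other prescribed numbers leave the class empty.\<close>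
  have "n \<noteq> 0 \<Longrightarrow> 0 < n \<or> SP n = {}" "(n, k) \<noteq> (0, 0) \<Longrightarrow> 0 < n \<or> SP_blocks n k = {}"
    "(n, k, m) \<noteq> (0, 0, 0) \<Longrightarrow> 0 < n \<or> SP_singles n k m = {}"
    by (auto simp: SP_blocks_def SP_singles_def SP_0)
  note V = class_isomorphisms(2)[of n "\<lambda>_ _. True", unfolded class_eqs, OF this(1)]
    class_isomorphisms(2)[of n "\<lambda>a _. a = k", unfolded class_eqs, OF this(2)]
    class_isomorphisms(2)[of n "\<lambda>a b. a = k \<and> b = m", unfolded class_eqs, OF this(3)]
  note W = class_isomorphisms(1)[of n "\<lambda>_ _. True", unfolded class_eqs]
    class_isomorphisms(1)[of n "\<lambda>a _. a = k", unfolded class_eqs]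
    class_isomorphisms(1)[of n "\<lambda>a b. a = k \<and> b = m", unfolded class_eqs]
  show ?thesis
    unfolding W_all_def V_all_def W_blocks_def V_blocks_def W_singles_def V_singles_def
    by (intro conjI[OF skein] conjI[OF W(1)] conjI[OF W(2)] conjI[OF W(3)] conjI[OF impI[OF V(1)]]
        conjI[OF impI[OF V(2)]] impI[OF V(3)])
qed

end
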